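(* Fix any integer $N\ge 1$. For any $N$-step schedule $\boldsymbol\eta=(\eta_1,\dots,\eta_N)\in(0,\infty)^N$, it holds that $$\mathcal R_N(\boldsymbol\eta)=\Omega(N^{-\alpha_\star}),\qquad \text{with } \alpha_\star:=\log_2(1+\sqrt3)=1.4499\cdots.$$
   Context: For $d\ge1$, $\mathscr F_1(\mathbb R^d)$ is the class of convex differentiable functions $f:\mathbb R^d\to\mathbb R$ with $1$-Lipschitz gradient (Euclidean norm) whose set of minimizers $X_f^\star:=\arg\min f$ satisfies $\emptyset\ne X_f^\star\subsetneq\mathbb R^d$. Given an initial point $\boldsymbol x_0$ and step-sizes $\eta_t>0$, gradient descent is $\boldsymbol x_t=\boldsymbol x_{t-1}-\eta_t\nabla f(\boldsymbol x_{t-1})$. The worst-case convergence rate of a schedule $\boldsymbol\eta=(\eta_1,\dots,\eta_N)\in(0,\infty)^N$ is $$\mathcal R_N(\boldsymbol\eta):=\sup\frac{f(\boldsymbol x_N)-f(\boldsymbol x^\star)}{\|\boldsymbol x_0-\boldsymbol x^\star\|^2},$$ where the supremum is over all $d\ge1$, $f\in\mathscr F_1(\mathbb R^d)$, $\boldsymbol x^\star\in X_f^\star$, $\boldsymbol x_0\in\mathbb R^d\setminus X_f^\star$, and $\boldsymbol x_N$ is the $N$-th gradient descent iterate started at $\boldsymbol x_0$ with schedule $\boldsymbol\eta$. Notation: for positive sequences, $b_N=\Omega(a_N)$ means that there is a constant $c>0$ with $a_N\le c\,b_N$ for all large enough $N$; here the constant does not depend on the schedule $\boldsymbol\eta$.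 *)

theory Defs
  imports "HOL-Analysis.Analysis"
begin

text \<open>
  The worst-case rate is a supremum over all dimensions $d$, so $d$ must be a natural number inside
  the formula and not a type. All the spaces $\mathbb{R}^d$ are therefore realised inside one
  inner product space, the finitely supported real sequences with the standard inner product:
  \<open>Rd d\<close> consists of the sequences supported on the first \<open>d\<close> coordinates. (The library's own
  normed space of finitely supported functions, in \<open>Finite_Function_Topology\<close>, carries the
  1-norm and is not usable here.)
\<close>

typedef fin_seq = "{x :: nat \<Rightarrow> real. finite {i. x i \<noteq> 0}}"
  morphisms coord Abs_fin_seq
  by (rule exI[of _ "\<lambda>_. 0"]) simp

setup_lifting type_definition_fin_seq

lemma finite_coord_support: "finite {i. coord x i \<noteq> 0}"
  using coord[of x] by simp

lemma fin_seq_eqI: "(\<And>i. coord x i = coord y i) \<Longrightarrow> x = y"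
  by (simp add: coord_inject[symmetric] fun_eq_iff)

instantiation fin_seq :: real_vector
begin

lift_definition zero_fin_seq :: fin_seq is "\<lambda>_. 0" by simp

lift_definition plus_fin_seq :: "fin_seq \<Rightarrow> fin_seq \<Rightarrow> fin_seq" is "\<lambda>x y i. x i + y i"
  subgoal for x y by (rule finite_subset[of _ "{i. x i \<noteq> 0} \<union> {i. y i \<noteq> 0}"]) auto
  done

lift_definition minus_fin_seq :: "fin_seq \<Rightarrow> fin_seq \<Rightarrow> fin_seq" is "\<lambda>x y i. x i - y i"
  subgoal for x y by (rule finite_subset[of _ "{i. x i \<noteq> 0} \<union> {i. y i \<noteq> 0}"]) auto
  done

lift_definition uminus_fin_seq :: "fin_seq \<Rightarrow> fin_seq" is "\<lambda>x i. - x i" by simp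

lift_definition scaleR_fin_seq :: "real \<Rightarrow> fin_seq \<Rightarrow> fin_seq" is "\<lambda>c x i. c * x i"
  by (auto elim: rev_finite_subset)

instance
  by standard (transfer, simp add: algebra_simps fun_eq_iff)+

end

lemma coord_simps [simp]:
  "coord 0 i = 0"
  "coord (x + y) i = coord x i + coord y i"
  "coord (x - y) i = coord x i - coord y i"
  "coord (- x) i = - coord x i"
  "coord (c *\<^sub>R x) i = c * coord x i"
  by (transfer, simp)+

instantiation fin_seq :: real_inner
begin

definition inner_fin_seq :: "fin_seq \<Rightarrow> fin_seq \<Rightarrow> real" where
  "inner_fin_seq x y = (\<Sum>i | coord x i \<noteq> 0. coord x i * coord y i)"

definition norm_fin_seq :: "fin_seq \<Rightarrow> real" where
  "norm_fin_seq x = sqrt (x \<bullet> x)"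

definition dist_fin_seq :: "fin_seq \<Rightarrow> fin_seq \<Rightarrow> real" where
  "dist_fin_seq x y = norm (x - y)"

definition sgn_fin_seq :: "fin_seq \<Rightarrow> fin_seq" where
  "sgn_fin_seq x = x /\<^sub>R norm x"

definition uniformity_fin_seq :: "(fin_seq \<times> fin_seq) filter" where
  "uniformity_fin_seq = (INF e\<in>{0<..}. principal {(x, y). dist (x :: fin_seq) y < e})"

definition open_fin_seq :: "fin_seq set \<Rightarrow> bool" where
  "open_fin_seq U \<longleftrightarrow> (\<forall>x\<in>U. \<forall>\<^sub>F (x', y) in uniformity. x' = x \<longrightarrow> y \<in> U)"

lemma inner_fin_seq_superset:
  assumes "finite A" "{i. coord x i \<noteq> 0} \<inter> {i. coord y i \<noteq> 0} \<subseteq> A"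
  shows "x \<bullet> y = (\<Sum>i\<in>A. coord x i * coord y i)"
  unfolding inner_fin_seq_def
  by (rule sum.mono_neutral_cong) (use assms finite_coord_support in auto)

instance
proof
  fix x y z :: fin_seq and r :: real
  let ?A = "{i. coord x i \<noteq> 0} \<union> {i. coord y i \<noteq> 0}"
  have fin: "finite ?A"
    by (simp add: finite_coord_support)
  show "x \<bullet> y = y \<bullet> x"
    by (subst (1 2) inner_fin_seq_superset[OF fin]) (auto simp: mult.commute)
  show "(x + y) \<bullet> z = x \<bullet> z + y \<bullet> z"
    by (subst (1 2 3) inner_fin_seq_superset[OF fin]) (auto simp: algebra_simps sum.distrib)
  show "(r *\<^sub>R x) \<bullet> y = r * (x \<bullet> y)"
    by (subst (1 2) inner_fin_seq_superset[OF fin]) (auto simp: algebra_simps sum_distrib_left)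
  show "0 \<le> x \<bullet> x"
    by (simp add: inner_fin_seq_def sum_nonneg)
  show "x \<bullet> x = 0 \<longleftrightarrow> x = 0"
  proof
    assume "x \<bullet> x = 0"
    then have "\<forall>i\<in>{i. coord x i \<noteq> 0}. coord x i * coord x i = 0"
      unfolding inner_fin_seq_def by (subst (asm) sum_nonneg_eq_0_iff) (auto simp: finite_coord_support)
    then show "x = 0"
      by (intro fin_seq_eqI) auto
  qed (simp add: inner_fin_seq_def)
qed (fact norm_fin_seq_def dist_fin_seq_def sgn_fin_seq_def uniformity_fin_seq_def open_fin_seq_def)+

end

definition Rd :: "nat \<Rightarrow> fin_seq set" where
  "Rd d = {x. \<forall>i\<ge>d. coord x i = 0}"

lemma subspace_Rd: "subspace (Rd d)"
  by (auto simp: subspace_def Rd_def)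

lemma inner_Rd: "x \<in> Rd d \<Longrightarrow> x \<bullet> y = (\<Sum>i<d. coord x i * coord y i)"
  by (rule inner_fin_seq_superset) (auto simp: Rd_def not_le[symmetric])

text \<open>
  A function on $\mathbb{R}^d$ is represented by \<open>f :: fin_seq \<Rightarrow> real\<close>, of which only the values
  on \<open>Rd d\<close> matter: derivatives are taken within \<open>Rd d\<close>, and the gradient is the vector of
  \<open>Rd d\<close> representing the derivative.
\<close>

definition gradient :: "nat \<Rightarrow> (fin_seq \<Rightarrow> real) \<Rightarrow> fin_seq \<Rightarrow> fin_seq" where
  "gradient d f x = (THE g. g \<in> Rd d \<and> (f has_derivative (\<lambda>h. g \<bullet> h)) (at x within Rd d))"

lemma gradient_unique:
  assumes x: "x \<in> Rd d"
    and g: "g \<in> Rd d" "(f has_derivative (\<lambda>h. g \<bullet> h)) (at x within Rd d)"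
    and g': "g' \<in> Rd d" "(f has_derivative (\<lambda>h. g' \<bullet> h)) (at x within Rd d)"
  shows "g = g'"
proof (rule ccontr)
  assume ne: "g \<noteq> g'"
  define u where "u = g - g'"
  have u: "u \<in> Rd d" "u \<noteq> 0"
    using g(1) g'(1) ne by (auto simp: u_def Rd_def)
  let ?p = "\<lambda>t::real. x + t *\<^sub>R u"
  have p: "(?p has_derivative (\<lambda>t. t *\<^sub>R u)) (at 0)"
    by (auto intro!: derivative_eq_intros)
  have ran: "range ?p \<subseteq> Rd d"
    using x u(1) by (auto simp: Rd_def)
  have chain: "((\<lambda>t. f (?p t)) has_derivative (\<lambda>t. k \<bullet> (t *\<^sub>R u))) (at 0)"
    if "(f has_derivative (\<lambda>h. k \<bullet> h)) (at x within Rd d)" for k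
    using has_derivative_in_compose[OF p, of f "\<lambda>h. k \<bullet> h"]
      has_derivative_subset[OF that ran] by simp
  have "(\<lambda>t::real. g \<bullet> (t *\<^sub>R u)) = (\<lambda>t. g' \<bullet> (t *\<^sub>R u))"
    by (rule has_derivative_unique[OF chain[OF g(2)] chain[OF g'(2)]])
  from fun_cong[OF this, of 1] have "u \<bullet> u = 0"
    by (simp add: u_def inner_diff_left)
  with u(2) show False by simp
qed

lemma gradient_eqI:
  assumes "x \<in> Rd d" "g \<in> Rd d" "(f has_derivative (\<lambda>h. g \<bullet> h)) (at x within Rd d)"
  shows "gradient d f x = g"
  unfolding gradient_def using assms gradient_unique by (intro the_equality) blast+

lemma gradient_exists:
  assumes x: "x \<in> Rd d" and diff: "f differentiable (at x within Rd d)"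
  shows "\<exists>g. g \<in> Rd d \<and> (f has_derivative (\<lambda>h. g \<bullet> h)) (at x within Rd d)"
proof -
  obtain D where D: "(f has_derivative D) (at x within Rd d)"
    using diff by (auto simp: differentiable_def)
  interpret D: bounded_linear D
    using D by (rule has_derivative_bounded_linear)
  define e where "e i = Abs_fin_seq (\<lambda>j. if j = i then 1 else 0)" for i :: nat
  have e: "coord (e i) j = (if j = i then 1 else 0)" for i j
    by (simp add: e_def Abs_fin_seq_inverse)
  have coord_sum: "coord (\<Sum>i\<in>A. c i *\<^sub>R e i) j = (\<Sum>i\<in>A. c i * coord (e i) j)"
    for A c j by (induction A rule: infinite_finite_induct) auto
  define g where "g = (\<Sum>i<d. D (e i) *\<^sub>R e i)"
  have gc: "coord g j = (if j < d then D (e j) else 0)" for j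
    by (simp add: g_def coord_sum e if_distrib cong: if_cong)
  have g: "g \<in> Rd d"
    by (simp add: Rd_def gc)
  have Dg: "D h = g \<bullet> h" if "h \<in> Rd d" for h
  proof -
    have "h = (\<Sum>i<d. coord h i *\<^sub>R e i)"
      using that by (intro fin_seq_eqI)
        (auto simp: coord_sum e Rd_def if_distrib cong: if_cong)
    then have "D h = D (\<Sum>i<d. coord h i *\<^sub>R e i)" by simp
    also have "\<dots> = (\<Sum>i<d. coord h i * D (e i))"
      by (simp add: D.sum D.scaleR)
    also have "\<dots> = g \<bullet> h"
      by (simp add: inner_Rd[OF g] gc mult.commute)
    finally show ?thesis .
  qed
  have "((\<lambda>y. (f y - f x - D (y - x)) /\<^sub>R norm (y - x)) \<longlongrightarrow> 0) (at x within Rd d)"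
    using D by (simp add: has_derivative_at_within algebra_simps)
  then have "((\<lambda>y. (f y - f x - g \<bullet> (y - x)) /\<^sub>R norm (y - x)) \<longlongrightarrow> 0) (at x within Rd d)"
    by (rule Lim_transform_eventually)
      (use x in \<open>auto simp: eventually_at_filter Dg subspace_diff[OF subspace_Rd]\<close>)
  then show ?thesis
    using g by (auto simp: has_derivative_at_within bounded_linear_inner_right algebra_simps)
qed

definition argmin_set :: "nat \<Rightarrow> (fin_seq \<Rightarrow> real) \<Rightarrow> fin_seq set" where
  "argmin_set d f = {x. is_arg_min f (\<lambda>y. y \<in> Rd d) x}"

definition F1 :: "nat \<Rightarrow> (fin_seq \<Rightarrow> real) set" where
  "F1 d = {f. convex_on (Rd d) f \<and> f differentiable_on Rd d
     \<and> 1-lipschitz_on (Rd d) (gradient d f)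
     \<and> argmin_set d f \<noteq> {} \<and> argmin_set d f \<subset> Rd d}"

primrec gd :: "nat \<Rightarrow> (fin_seq \<Rightarrow> real) \<Rightarrow> (nat \<Rightarrow> real) \<Rightarrow> fin_seq \<Rightarrow> nat \<Rightarrow> fin_seq" where
  "gd d f \<eta> x0 0 = x0"
| "gd d f \<eta> x0 (Suc t) = gd d f \<eta> x0 t - \<eta> (Suc t) *\<^sub>R gradient d f (gd d f \<eta> x0 t)"

text \<open>
  A schedule is a function of which only the values at $1,\dots,N$ are used. The supremum is taken
  in the extended reals, so that it needs no separate boundedness argument to be meaningful.
\<close>

definition worst_rate :: "nat \<Rightarrow> (nat \<Rightarrow> real) \<Rightarrow> ereal" where
  "worst_rate N \<eta> = Sup {ereal ((f (gd d f \<eta> x0 N) - f xs) / (norm (x0 - xs))\<^sup>2) | d f xs x0.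
     1 \<le> d \<and> f \<in> F1 d \<and> xs \<in> argmin_set d f \<and> x0 \<in> Rd d - argmin_set d f}"

definition alpha_star :: real where
  "alpha_star = log 2 (1 + sqrt 3)"

end

theory Submission
  imports Defs
begin

text \<open>
  The hard function is the Moreau envelope of a maximum of finitely many affine functions and 0,
  chosen adaptively. Fix some of the steps as flips; between two flips the gradient is constant, and
  each flip, which overshoots by the excess of its step-size over 1, moves to a new affine piece.
  What is needed of the gradients \<open>p i\<close> are linear inequalities for their Gram matrix. A Gram matrix close
  to that of a random walk satisfies them with
  \<open>(norm x\<^sub>0)\<^sup>2 \<le> 4 * s k * prod (\<lambda>i. r i * (1 + r i)) * f x\<^sub>N\<close> up to small corrections, where \<open>r i\<close> is the
  length of segment \<open>i\<close> divided by the excess of the flip that ends it. It remains to find flips for which this product is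
  bounded while the last segment has length at most \<open>N powr \<alpha>\<close>. If the flips are the longest steps,
  their number being chosen to minimize a weighted length of the remaining ones, then the tail sums of the
  excesses dominate those of a power law, and the product is largest for that power law;
  Lagrange multipliers for the total length of the segments bound it by a constant, as long as
  \<open>\<alpha>\<close> is at most (slightly more than) \<open>log 2 (1 + sqrt 3)\<close>.
\<close>

section \<open>The envelope and its gradient descent\<close>

text \<open>The gradient of the envelope is the affine piece active at the proximal point, here
  \<open>z i\<close> plus a multiple of \<open>p i\<close>, so a trajectory can be certified by
  inner products alone. The scaling makes \<open>a i * v i = a (Suc i) * s (Suc i)\<close>; hence
  the step from \<open>z i\<close> to \<open>z (Suc i)\<close> is a multiple of
  \<open>Y i - Y (Suc i)\<close>, which for a random walk is orthogonal to every \<open>Y j\<close>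
  with \<open>j > i\<close>. The obstacle is a later piece \<open>j\<close> of the same sign: at the
  start of segment \<open>i\<close> it may be too high if \<open>a j * E j > a i * E i\<close>,
  which can happen because \<open>a i\<close> contains \<open>1 / v i\<close>. Subtracting
  \<open>H\<close> from the covariance lowers that piece, but the kernel must stay positive
  semidefinite. The inflations in \<open>b\<close> pay for this, and the cost analysis must absorb
  them.

  The constant 22/49 is \<open>\<alpha> - 1\<close>. If the remaining length is proportional to
  \<open>x powr (- (22/49))\<close>, with \<open>x\<close> the number of flips plus one, then it
  decreases at the rate 22/49 times length over \<open>x\<close>, and length over \<open>x\<close>
  is the unit \<open>\<sigma>\<close>; this is the origin of the smallest excess.\<close>

definition env_val :: "fin_seq \<times> real \<Rightarrow> fin_seq \<Rightarrow> real" where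
  "env_val q x = fst q \<bullet> x - snd q - (fst q \<bullet> fst q) / 2"

text \<open>For compact convex \<open>Q\<close> this is, by duality, the Moreau envelope of the
  maximum of the affine functions \<open>fst q \<bullet> x - snd q\<close>. In the dual form the
  maximizer is directly the gradient.\<close>

definition envelope :: "(fin_seq \<times> real) set \<Rightarrow> fin_seq \<Rightarrow> real" where
  "envelope Q x = (SUP q\<in>Q. env_val q x)"

definition env_max :: "(fin_seq \<times> real) set \<Rightarrow> fin_seq \<Rightarrow> fin_seq \<times> real \<Rightarrow> bool" where
  "env_max Q x q \<longleftrightarrow> q \<in> Q \<and> (\<forall>q'\<in>Q. env_val q' x \<le> env_val q x)"

lemma envelope_eq: "env_max Q x q \<Longrightarrow> envelope Q x = env_val q x"
  unfolding envelope_def env_max_def by (intro cSup_eq_maximum) auto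

lemma env_max_exists:
  assumes "compact Q" "Q \<noteq> {}"
  shows "\<exists>q. env_max Q x q"
proof -
  have "continuous_on Q (\<lambda>q. env_val q x)"
    unfolding env_val_def by (intro continuous_intros) auto
  from continuous_attains_sup[OF assms this] show ?thesis
    unfolding env_max_def by blast
qed

text \<open>The objective is strongly concave in \<open>fst q\<close>, hence the quadratic decay away from the
  maximizer.\<close>

lemma env_max_strong:
  assumes Q: "convex Q" and q: "env_max Q x q" and q': "q' \<in> Q"
  shows "env_val q' x \<le> env_val q x - ((fst q' - fst q) \<bullet> (fst q' - fst q)) / 2"
proof (rule ccontr)
  define D where "D = (fst q' - fst q) \<bullet> (fst q' - fst q) / 2"
  define \<delta> where "\<delta> = env_val q' x - env_val q x + D"
  assume "\<not> ?thesis"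
  then have pos: "\<delta> > 0" by (simp add: \<delta>_def D_def)
  have D0: "D \<ge> 0" by (simp add: D_def)
  \<comment> \<open>Moving from \<open>q\<close> towards \<open>q'\<close> by the fraction
    \<open>t\<close> changes the value by \<open>t * (\<delta> - t * D)\<close>; this
    \<open>t\<close> is small enough to keep that positive.\<close>
  define t where "t = min 1 (\<delta> / (2 * D + 1))"
  have t: "0 < t" "t \<le> 1" using pos D0 by (auto simp: t_def)
  have "t * D < \<delta>"
  proof -
    have "t * D \<le> \<delta> / (2 * D + 1) * D" using D0 by (intro mult_right_mono) (auto simp: t_def)
    also have "\<dots> = \<delta> * (D / (2 * D + 1))" by simp
    also have "\<dots> < \<delta> * 1" using pos D0 by (intro mult_strict_left_mono) auto
    finally show ?thesis by simp
  qed
  define r where "r = (1 - t) *\<^sub>R q + t *\<^sub>R q'"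
  have "r \<in> Q"
    unfolding r_def using Q q q' t by (intro convexD) (auto simp: env_max_def)
  then have le: "env_val r x \<le> env_val q x" using q by (auto simp: env_max_def)
  have "env_val r x = (1 - t) * env_val q x + t * env_val q' x + t * (1 - t) * D"
    unfolding env_val_def r_def D_def
    by (simp add: inner_add_left inner_add_right inner_diff_left inner_diff_right inner_commute
        algebra_simps add_divide_distrib diff_divide_distrib power2_eq_square)
  then have "env_val r x - env_val q x = t * (\<delta> - t * D)"
    unfolding \<delta>_def by (simp add: algebra_simps)
  moreover have "t * (\<delta> - t * D) > 0" using t \<open>t * D < \<delta>\<close> by simp
  ultimately show False using le by linarith
qed

text \<open>The first bound uses \<open>q\<close> as a competitor at \<open>y\<close>, the second
  uses \<open>q'\<close> as a competitor at \<open>x\<close> and completes a square. Adding the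
  quadratic decays at \<open>x\<close> and \<open>y\<close> and applying Cauchy-Schwarz gives the
  Lipschitz bound.\<close>

lemma envelope_bounds:
  assumes Q: "convex Q" and q: "env_max Q x q" and q': "env_max Q y q'"
  shows "fst q \<bullet> (y - x) \<le> envelope Q y - envelope Q x"
    and "envelope Q y - envelope Q x \<le> fst q \<bullet> (y - x) + (norm (y - x))\<^sup>2 / 2"
    and "norm (fst q' - fst q) \<le> norm (y - x)"
proof -
  let ?g = "fst q" and ?g' = "fst q'"
  let ?D = "(?g' - ?g) \<bullet> (?g' - ?g)"
  have e: "env_val r y - env_val r x = fst r \<bullet> (y - x)" for r
    by (simp add: env_val_def inner_diff_right)
  have qy: "env_val q y \<le> env_val q' y - ?D / 2"
    using env_max_strong[OF Q q', of q] q
    by (simp add: env_max_def inner_diff_left inner_diff_right algebra_simps)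
  have q'x: "env_val q' x \<le> env_val q x - ?D / 2"
    using env_max_strong[OF Q q, of q'] q' by (simp add: env_max_def)
  have D0: "?D \<ge> 0" by simp
  note E = envelope_eq[OF q] envelope_eq[OF q']
  show "?g \<bullet> (y - x) \<le> envelope Q y - envelope Q x"
    unfolding E using qy e[of q] D0 by linarith
  have "0 \<le> (?g' - ?g - (y - x)) \<bullet> (?g' - ?g - (y - x))" by simp
  also have "\<dots> = ?D - 2 * ((?g' - ?g) \<bullet> (y - x)) + (y - x) \<bullet> (y - x)"
    by (simp add: inner_diff_left inner_diff_right inner_commute algebra_simps)
  finally have "(?g' - ?g) \<bullet> (y - x) \<le> ?D / 2 + (norm (y - x))\<^sup>2 / 2"
    by (simp add: power2_norm_eq_inner)
  then show "envelope Q y - envelope Q x \<le> ?g \<bullet> (y - x) + (norm (y - x))\<^sup>2 / 2"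
    unfolding E using q'x e[of q'] by (simp add: inner_diff_left)
  have "?D \<le> (?g' - ?g) \<bullet> (y - x)"
    using qy q'x e[of q] e[of q'] inner_diff_left[of ?g' ?g "y - x"] by linarith
  also have "\<dots> \<le> norm (?g' - ?g) * norm (y - x)" by (rule norm_cauchy_schwarz)
  finally have "norm (?g' - ?g) * norm (?g' - ?g) \<le> norm (?g' - ?g) * norm (y - x)"
    by (simp add: power2_norm_eq_inner[symmetric] power2_eq_square)
  then show "norm (?g' - ?g) \<le> norm (y - x)"
    by (cases "norm (?g' - ?g) = 0") (auto simp: mult_le_cancel_left)
qed

lemma envelope_has_derivative:
  assumes Q: "convex Q" "compact Q" and q: "env_max Q x q"
  shows "(envelope Q has_derivative (\<lambda>h. fst q \<bullet> h)) (at x within S)"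
proof (rule has_derivativeI_sandwich[of 1 _ _ _ _ "\<lambda>y. norm (y - x) / 2"])
  show "bounded_linear (\<lambda>h. fst q \<bullet> h)" by (rule bounded_linear_inner_right)
  have "((\<lambda>y. norm (y - x) / 2) \<longlongrightarrow> norm (x - x) / 2) (at x within S)"
    by (intro tendsto_intros) auto
  then show "((\<lambda>y. norm (y - x) / 2) \<longlongrightarrow> 0) (at x within S)" by simp
  fix y assume "y \<in> S" "y \<noteq> x"
  have "Q \<noteq> {}" using q by (auto simp: env_max_def)
  then obtain q' where q': "env_max Q y q'" using env_max_exists[OF Q(2)] by blast
  have "norm (envelope Q y - envelope Q x - fst q \<bullet> (y - x)) \<le> norm (y - x) * norm (y - x) / 2"
    using envelope_bounds(1,2)[OF Q(1) q q'] by (simp add: power2_eq_square)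
  then show "norm (envelope Q y - envelope Q x - fst q \<bullet> (y - x)) / norm (y - x) \<le> norm (y - x) / 2"
    using \<open>y \<noteq> x\<close> by (simp add: divide_le_eq algebra_simps)
qed auto

lemma gradient_envelope:
  assumes Q: "convex Q" "compact Q" "fst ` Q \<subseteq> Rd d" and x: "x \<in> Rd d" and q: "env_max Q x q"
  shows "gradient d (envelope Q) x = fst q"
  using assms by (intro gradient_eqI envelope_has_derivative) (auto simp: env_max_def)

text \<open>The zero piece makes the envelope nonnegative, so \<open>y\<close> is a minimizer, and
  \<open>x\<close> shows that the minimizers do not fill the space.\<close>

lemma envelope_in_F1:
  assumes Q: "convex Q" "compact Q" "fst ` Q \<subseteq> Rd d" and "0 \<in> Q"
    and y: "y \<in> Rd d" "envelope Q y \<le> 0" and x: "x \<in> Rd d" "envelope Q x > 0"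
  shows "envelope Q \<in> F1 d" "y \<in> argmin_set d (envelope Q)" "x \<notin> argmin_set d (envelope Q)"
    "envelope Q y = 0"
proof -
  have ne: "Q \<noteq> {}" using \<open>0 \<in> Q\<close> by auto
  have mx: "\<exists>q. env_max Q w q" for w using env_max_exists[OF Q(2) ne] .
  have ge0: "envelope Q w \<ge> 0" for w
  proof -
    obtain q where q: "env_max Q w q" using mx by blast
    then have "env_val 0 w \<le> env_val q w" using \<open>0 \<in> Q\<close> by (simp add: env_max_def)
    then show ?thesis by (simp add: envelope_eq[OF q] env_val_def)
  qed
  show y0: "envelope Q y = 0" using ge0[of y] y by simp
  show ym: "y \<in> argmin_set d (envelope Q)"
    using y y0 ge0 by (auto simp: argmin_set_def is_arg_min_def not_less)
  show xm: "x \<notin> argmin_set d (envelope Q)"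
    using x y y0 by (auto simp: argmin_set_def is_arg_min_def not_less)
  have "convex_on (Rd d) (envelope Q)"
  proof (rule convex_onI)
    show "convex (Rd d)" by (rule subspace_imp_convex[OF subspace_Rd])
    fix t :: real and a b assume t: "0 < t" "t < 1" and "a \<in> Rd d" "b \<in> Rd d"
    define w where "w = (1 - t) *\<^sub>R a + t *\<^sub>R b"
    obtain q qa qb where q: "env_max Q w q" and qa: "env_max Q a qa" and qb: "env_max Q b qb"
      using mx by blast
    have "(1 - t) * (fst q \<bullet> (a - w)) + t * (fst q \<bullet> (b - w)) \<le>
        (1 - t) * (envelope Q a - envelope Q w) + t * (envelope Q b - envelope Q w)"
      using envelope_bounds(1)[OF Q(1) q qa] envelope_bounds(1)[OF Q(1) q qb] t
      by (intro add_mono mult_left_mono) auto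
    moreover have "(1 - t) * (fst q \<bullet> (a - w)) + t * (fst q \<bullet> (b - w)) = 0"
      unfolding w_def by (simp add: inner_diff_right inner_add_right algebra_simps)
    ultimately show "envelope Q ((1 - t) *\<^sub>R a + t *\<^sub>R b)
        \<le> (1 - t) * envelope Q a + t * envelope Q b"
      unfolding w_def[symmetric] by (simp add: algebra_simps)
  qed
  moreover have "envelope Q differentiable_on Rd d"
    unfolding differentiable_on_def differentiable_def
    using envelope_has_derivative[OF Q(1,2)] mx by blast
  moreover have "1-lipschitz_on (Rd d) (gradient d (envelope Q))"
  proof (rule lipschitz_onI)
    fix a b assume ab: "a \<in> Rd d" "b \<in> Rd d"
    obtain qa qb where qa: "env_max Q a qa" and qb: "env_max Q b qb"
      using mx by blast
    show "dist (gradient d (envelope Q) a) (gradient d (envelope Q) b) \<le> 1 * dist a b"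
      unfolding gradient_envelope[OF Q ab(1) qa] gradient_envelope[OF Q ab(2) qb] dist_norm
      using envelope_bounds(3)[OF Q(1) qb qa] by simp
  qed simp
  moreover have "argmin_set d (envelope Q) \<subseteq> Rd d"
    by (auto simp: argmin_set_def is_arg_min_def)
  ultimately show "envelope Q \<in> F1 d"
    using ym xm x unfolding F1_def by blast
qed

text \<open>The point \<open>z\<close> is the proximal point of \<open>z + g\<close>. Activity at
  \<open>z\<close> is a linear condition on the piece, so it passes from \<open>P\<close> to its
  hull; the quadratic terms only help.\<close>

lemma env_max_hullI:
  assumes P: "(g, c) \<in> P" and act: "\<And>g' c'. (g', c') \<in> P \<Longrightarrow> g' \<bullet> z - c' \<le> g \<bullet> z - c"
  shows "env_max (convex hull P) (z + g) (g, c)"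
proof -
  have lin: "linear (\<lambda>q :: fin_seq \<times> real. fst q \<bullet> z - snd q)"
    by (rule linearI) (auto simp: inner_add_left algebra_simps)
  have "convex ((\<lambda>q :: fin_seq \<times> real. fst q \<bullet> z - snd q) -` {..g \<bullet> z - c})"
    by (intro convex_linear_vimage[OF lin]) simp
  then have sub: "convex hull P \<subseteq> (\<lambda>q. fst q \<bullet> z - snd q) -` {..g \<bullet> z - c}"
    using act by (intro hull_minimal) auto
  show ?thesis unfolding env_max_def
  proof (intro conjI ballI)
    show "(g, c) \<in> convex hull P" using P by (rule hull_inc)
    fix q assume "q \<in> convex hull P"
    with sub have "fst q \<bullet> z - snd q \<le> g \<bullet> z - c" by auto
    moreover have "0 \<le> (fst q - g) \<bullet> (fst q - g)" by simp
    then have "fst q \<bullet> g \<le> (fst q \<bullet> fst q) / 2 + (g \<bullet> g) / 2"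
      by (simp add: inner_diff_left inner_diff_right inner_commute)
    ultimately show "env_val q (z + g) \<le> env_val (g, c) (z + g)"
      by (simp add: env_val_def inner_add_right)
  qed
qed

text \<open>Segment \<open>i\<close> runs from \<open>z i + s i *\<^sub>R p i\<close> straight down
  to \<open>z i + p i\<close>; a flip of size \<open>1 + v i\<close> then lands on
  \<open>z i - v i *\<^sub>R p i\<close>, the start of the next segment. \<open>C1\<close> and
  \<open>C2\<close> keep piece \<open>i\<close> active at the two ends of the range of proximal
  points, hence in between by linearity. The condition on \<open>s k\<close> leaves at least half of
  the height at the end.\<close>

lemma worst_rate_ge:
  fixes p z :: "nat \<Rightarrow> fin_seq" and s v :: "nat \<Rightarrow> real" and T :: "nat \<Rightarrow> nat"
  assumes d: "1 \<le> d" and p: "\<And>i. i \<le> k \<Longrightarrow> p i \<in> Rd d" and pk: "p k \<noteq> 0"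
    and \<eta>: "\<And>t. t \<in> {1..N} \<Longrightarrow> 0 < \<eta> t"
    and T0: "T 0 = 0" and TN: "T (Suc k) = Suc N" and T: "\<And>i. i \<le> k \<Longrightarrow> T i < T (Suc i)"
    and s: "\<And>i. i < k \<Longrightarrow> s i = 1 + (\<Sum>t\<in>{T i<..<T (Suc i)}. \<eta> t)"
    and sk: "2 * (1 + (\<Sum>t\<in>{T k<..<T (Suc k)}. \<eta> t)) \<le> s k"
    and v: "\<And>i. i < k \<Longrightarrow> \<eta> (T (Suc i)) = 1 + v i"
    and z0: "z 0 = 0" and z: "\<And>i. i < k \<Longrightarrow> z (Suc i) = z i - v i *\<^sub>R p i - s (Suc i) *\<^sub>R p (Suc i)"
    and C1: "\<And>i j. i \<le> k \<Longrightarrow> j \<le> k \<Longrightarrow> p j \<bullet> (z i - z j) \<le> 0"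
    and C2: "\<And>i j. i \<le> k \<Longrightarrow> j \<le> k \<Longrightarrow> p j \<bullet> (z i + s i *\<^sub>R p i - z j) \<le> s i * (p i \<bullet> p i)"
    and M: "M > 0" "(s 0)\<^sup>2 * (p 0 \<bullet> p 0) \<le> M * (s k * (p k \<bullet> p k) / 2)"
    and p0: "p 0 \<noteq> 0"
  shows "ereal (1 / M) \<le> worst_rate N \<eta>"
proof -
  \<comment> \<open>The piece \<open>(0, 0)\<close> fixes the minimum value 0, attained at the
    origin since \<open>z 0 = 0\<close> and \<open>C1\<close> holds.\<close>
  define P where "P = insert (0, 0) ((\<lambda>j. (p j, p j \<bullet> z j)) ` {..k})"
  define Q where "Q = convex hull P"
  define f where "f = envelope Q"
  have "finite P" by (simp add: P_def)
  then have Q: "convex Q" "compact Q"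
    by (auto simp: Q_def finite_imp_compact_convex_hull)
  have zin: "z i \<in> Rd d" if "i \<le> k" for i
    using that
  proof (induction i)
    case (Suc i)
    then show ?case
      using p by (auto simp: z intro!: subspace_diff[OF subspace_Rd] subspace_scale[OF subspace_Rd])
  qed (simp add: z0 subspace_0[OF subspace_Rd])
  have Qd: "fst ` Q \<subseteq> Rd d"
  proof -
    have lin: "linear (fst :: fin_seq \<times> real \<Rightarrow> fin_seq)" by (rule linear_fst)
    have "convex ((fst :: fin_seq \<times> real \<Rightarrow> fin_seq) -` Rd d)"
      by (intro convex_linear_vimage[OF lin] subspace_imp_convex subspace_Rd)
    then have "Q \<subseteq> fst -` Rd d"
      unfolding Q_def using p by (intro hull_minimal) (auto simp: P_def subspace_0[OF subspace_Rd])
    then show ?thesis by auto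
  qed
  have zQ: "0 \<in> Q" unfolding Q_def zero_prod_def by (rule hull_inc) (simp add: P_def)
  have act: "env_max Q (z i + (c + 1) *\<^sub>R p i) (p i, p i \<bullet> z i)"
    if i: "i \<le> k" and c: "0 \<le> c" "c \<le> s i" for i c
  proof -
    have "env_max Q ((z i + c *\<^sub>R p i) + p i) (p i, p i \<bullet> z i)"
      unfolding Q_def
    proof (rule env_max_hullI)
      show "(p i, p i \<bullet> z i) \<in> P" using i by (auto simp: P_def)
      fix g' c' assume "(g', c') \<in> P"
      then consider "g' = 0" "c' = 0" | j where "j \<le> k" "g' = p j" "c' = p j \<bullet> z j"
        by (auto simp: P_def)
      then show "g' \<bullet> (z i + c *\<^sub>R p i) - c' \<le> p i \<bullet> (z i + c *\<^sub>R p i) - p i \<bullet> z i"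
      proof cases
        case 1
        then show ?thesis using c by (simp add: inner_add_right)
      next
        case 2
        define \<theta> where "\<theta> = (if s i = 0 then 0 else c / s i)"
        have \<theta>: "0 \<le> \<theta>" "\<theta> \<le> 1" "c = \<theta> * s i" using c by (auto simp: \<theta>_def divide_simps)
        have "(1 - \<theta>) * (p j \<bullet> (z i - z j)) + \<theta> * (p j \<bullet> (z i + s i *\<^sub>R p i - z j))
            \<le> (1 - \<theta>) * 0 + \<theta> * (s i * (p i \<bullet> p i))"
          using \<theta> C1[OF i 2(1)] C2[OF i 2(1)] by (intro add_mono mult_left_mono) auto
        then show ?thesis
          using \<theta>(3) 2 by (simp add: inner_add_right inner_diff_right algebra_simps)
      qed
    qed
    then show ?thesis by (simp add: algebra_simps)
  qed
  have Tle: "T i \<le> Suc N" if "i \<le> Suc k" for i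
    using that
  proof (induction i rule: inc_induct)
    case (step i)
    then show ?case using T[of i] by simp
  qed (simp add: TN)
  have Smono: "0 \<le> (\<Sum>t\<in>{T i<..T i + n}. \<eta> t)"
    "(\<Sum>t\<in>{T i<..T i + n}. \<eta> t) \<le> (\<Sum>t\<in>{T i<..<T (Suc i)}. \<eta> t)"
    if "i \<le> k" "T i + n < T (Suc i)" for i n
  proof -
    have pos: "0 \<le> \<eta> t" if "t \<in> {T i<..<T (Suc i)}" for t
      using that \<open>i \<le> k\<close> Tle[of "Suc i"] \<eta>[of t] by auto
    have sub: "{T i<..T i + n} \<subseteq> {T i<..<T (Suc i)}" using that by auto
    show "0 \<le> (\<Sum>t\<in>{T i<..T i + n}. \<eta> t)" using pos sub by (intro sum_nonneg) blast
    show "(\<Sum>t\<in>{T i<..T i + n}. \<eta> t) \<le> (\<Sum>t\<in>{T i<..<T (Suc i)}. \<eta> t)"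
      using pos sub by (intro sum_mono2) auto
  qed
  have snn: "0 \<le> (\<Sum>t\<in>{T i<..<T (Suc i)}. \<eta> t)" if "i \<le> k" for i
    using Smono[of i 0] that T[of i] by auto
  have s1: "1 + (\<Sum>t\<in>{T i<..<T (Suc i)}. \<eta> t) \<le> s i" if "i \<le> k" for i
    using that s[of i] sk snn[of k] by (cases "i = k") auto
  define x0 where "x0 = s 0 *\<^sub>R p 0"
  have x0: "x0 \<in> Rd d" unfolding x0_def using p by (intro subspace_scale[OF subspace_Rd]) auto
  define X where "X = gd d f \<eta> x0"
  have step: "X (Suc t) = X t - \<eta> (Suc t) *\<^sub>R p i"
    if "i \<le> k" "0 \<le> c" "c \<le> s i" "X t = z i + (c + 1) *\<^sub>R p i" for t i c
  proof -
    have "X t \<in> Rd d" unfolding that(4) using zin p that(1)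
      by (intro subspace_add[OF subspace_Rd] subspace_scale[OF subspace_Rd]) auto
    then have "gradient d f (X t) = p i"
      using gradient_envelope[OF Q Qd _ act[OF that(1-3)]] that(4) by (simp add: f_def)
    then show ?thesis by (simp add: X_def)
  qed
  have within: "X (T i + n) = z i + (s i - (\<Sum>t\<in>{T i<..T i + n}. \<eta> t)) *\<^sub>R p i"
    if i: "i \<le> k" and start: "X (T i) = z i + s i *\<^sub>R p i" and n: "T i + n < T (Suc i)" for i n
    using n
  proof (induction n)
    case 0
    then show ?case by (simp add: start)
  next
    case (Suc n)
    define c where "c = s i - (\<Sum>t\<in>{T i<..T i + n}. \<eta> t) - 1"
    have "0 \<le> c" "c \<le> s i"
      using Smono[of i n] i Suc.prems s1[OF i] by (auto simp: c_def)
    moreover have "X (T i + n) = z i + (c + 1) *\<^sub>R p i"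
      using Suc by (simp add: c_def)
    ultimately have "X (Suc (T i + n)) = X (T i + n) - \<eta> (Suc (T i + n)) *\<^sub>R p i"
      by (intro step[OF i]) auto
    moreover have "{T i<..T i + Suc n} = insert (Suc (T i + n)) {T i<..T i + n}" by auto
    ultimately have "X (T i + Suc n) = z i + (s i - (\<Sum>t\<in>{T i<..T i + n}. \<eta> t)) *\<^sub>R p i
        - \<eta> (Suc (T i + n)) *\<^sub>R p i"
      "(\<Sum>t\<in>{T i<..T i + Suc n}. \<eta> t) = \<eta> (Suc (T i + n)) + (\<Sum>t\<in>{T i<..T i + n}. \<eta> t)"
      using Suc by simp_all
    then show ?case by (simp add: scaleR_left_diff_distrib scaleR_add_left)
  qed
  have starts: "X (T i) = z i + s i *\<^sub>R p i" if "i \<le> k" for i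
    using that
  proof (induction i)
    case 0
    then show ?case by (simp add: X_def T0 x0_def z0)
  next
    case (Suc i)
    define n where "n = T (Suc i) - T i - 1"
    have Tn: "Suc (T i + n) = T (Suc i)" using T[of i] Suc.prems by (auto simp: n_def)
    have set: "{T i<..T i + n} = {T i<..<T (Suc i)}" using Tn by auto
    \<comment> \<open>The summand 1 in \<open>s i\<close> is what remains here, so the flip is made
      when the proximal point is exactly \<open>z i\<close>.\<close>
    have "X (T i + n) = z i + (0 + 1) *\<^sub>R p i"
      using within[of i n] Suc Tn s[of i] unfolding set by simp
    then have "X (T (Suc i)) = X (T i + n) - \<eta> (T (Suc i)) *\<^sub>R p i"
      using step[of i 0 "T i + n"] Suc.prems Tn s1[of i] snn[of i] by simp
    then show ?case
      using \<open>X (T i + n) = _\<close> Suc.prems by (simp add: v z algebra_simps)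
  qed
  define c where "c = s k - (\<Sum>t\<in>{T k<..<T (Suc k)}. \<eta> t) - 1"
  have c: "0 \<le> c" "c \<le> s k" "s k / 2 \<le> c"
    using sk snn[of k] by (auto simp: c_def)
  define n where "n = N - T k"
  have Tk: "T k + n = N" "{T k<..T k + n} = {T k<..<T (Suc k)}"
    using T[of k] TN by (auto simp: n_def)
  have XN: "X N = z k + (c + 1) *\<^sub>R p k"
    using within[OF _ starts, of k n] Tk T[of k] TN by (simp add: c_def)
  have ppk: "p k \<bullet> p k > 0" using pk by simp
  have fN: "f (X N) \<ge> s k * (p k \<bullet> p k) / 2"
  proof -
    have "f (X N) = (c + 1) * (p k \<bullet> p k) - (p k \<bullet> p k) / 2"
      unfolding XN f_def envelope_eq[OF act[OF order_refl c(1,2)]]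
      by (simp add: env_val_def inner_add_right inner_commute)
    also have "\<dots> = c * (p k \<bullet> p k) + (p k \<bullet> p k) / 2"
      by (simp add: algebra_simps)
    also have "\<dots> \<ge> s k / 2 * (p k \<bullet> p k)"
      using mult_right_mono[OF c(3), of "p k \<bullet> p k"] ppk by linarith
    finally show ?thesis by simp
  qed
  have s0: "1 \<le> s 0" using s1[of 0] snn[of 0] by simp
  have fx0: "f x0 > 0"
  proof -
    have "env_max Q (z 0 + ((s 0 - 1) + 1) *\<^sub>R p 0) (p 0, p 0 \<bullet> z 0)"
      using s0 by (intro act) auto
    then have "env_max Q x0 (p 0, 0)" by (simp add: x0_def z0)
    then have "f x0 = s 0 * (p 0 \<bullet> p 0) - (p 0 \<bullet> p 0) / 2"
      unfolding f_def by (simp add: envelope_eq env_val_def x0_def)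
    also have "\<dots> = (s 0 - 1/2) * (p 0 \<bullet> p 0)" by (simp add: algebra_simps)
    also have "\<dots> > 0" using s0 p0 by (intro mult_pos_pos) auto
    finally show ?thesis .
  qed
  have f0: "f 0 \<le> 0"
  proof -
    have "env_max Q (0 + 0) (0, 0)"
      unfolding Q_def
    proof (rule env_max_hullI)
      fix g' c' assume "(g', c') \<in> P"
      then show "g' \<bullet> 0 - c' \<le> 0 \<bullet> (0::fin_seq) - 0"
        using C1[of 0] by (auto simp: P_def z0)
    qed (simp add: P_def)
    then show ?thesis by (simp add: f_def envelope_eq env_val_def)
  qed
  note F = envelope_in_F1[OF Q Qd zQ subspace_0[OF subspace_Rd] f0[unfolded f_def] x0 fx0[unfolded f_def],
      folded f_def]
  have nx0: "(norm (x0 - 0))\<^sup>2 = (s 0)\<^sup>2 * (p 0 \<bullet> p 0)"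
    by (simp add: x0_def power_mult_distrib power2_norm_eq_inner)
  have "1 / M \<le> (f (X N) - f 0) / (norm (x0 - 0))\<^sup>2"
  proof -
    have "0 < (s 0)\<^sup>2 * (p 0 \<bullet> p 0)" using s0 p0 by simp
    moreover have "(s 0)\<^sup>2 * (p 0 \<bullet> p 0) \<le> M * f (X N)"
      using M(2) mult_left_mono[OF fN, of M] M(1) by linarith
    ultimately show ?thesis unfolding nx0 F(4) using M(1) by (simp add: divide_simps mult.commute)
  qed
  then have "ereal (1 / M) \<le> ereal ((f (X N) - f 0) / (norm (x0 - 0))\<^sup>2)" by simp
  also have "\<dots> \<le> worst_rate N \<eta>"
    unfolding worst_rate_def X_def using d F x0 by (intro Sup_upper) blast
  finally show ?thesis .
qed

section \<open>Gram matrices of flip patterns\<close>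

lemma cubic_ratio_le:
  fixes x :: real assumes "1 \<le> x" shows "x - 1 \<le> 4 / 27 * x ^ 3"
proof -
  have "0 \<le> (x - 3/2)\<^sup>2 * (x + 3)" using assms by simp
  also have "\<dots> = x ^ 3 - 27/4 * (x - 1)" by algebra
  finally show ?thesis by simp
qed

lemma split_cube:
  fixes X :: real
  shows "(k / (X * Y * Z))\<^sup>2 * M * ((W * (x / X) * (y / Y)) * (c * B))
    = k\<^sup>2 * (M * x / X ^ 3) * (c * (B * y / Y ^ 3)) * (W / Z\<^sup>2)"
  by (simp add: power2_eq_square power3_eq_cube mult_ac)

lemma split_fifth:
  fixes X :: real
  shows "(k / (X * Y * Z)\<^sup>2)\<^sup>2 * ((W * (x / X) * (y / Y)) * (b * D) * (c * B))
    = k\<^sup>2 * (b * (D * x / X ^ 5)) * (c * (B * y / Y ^ 5)) * (W / Z ^ 4)"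
  by (simp add: eval_nat_numeral mult_ac)

text \<open>Maximizing \<open>r * (1 - \<gamma> * r)\<close> gives
  \<open>1 / (4 * \<gamma>)\<close>, whose denominator contains \<open>X * Y * Z\<close>; then the
  expression splits into functions of one variable. Those of \<open>X\<close> and \<open>Y\<close>
  are nearly maximal at 2 and 1.76. The target 23/54 is half of \<open>1 - 4/27\<close>, so that two
  geometric series of ratio 4/27 will add up to 1.\<close>

lemma pair_bound_long_step:
  fixes r X Y Z W g :: real
  assumes r: "0 < r" and XY: "1 < X" "1 < Y" and Z: "0 < Z" and W: "0 \<le> W"
    and g: "2200 / 6027 * (X * Y * Z) * r \<le> g"
  defines "h \<equiv> r / (1 + r) * max 0 (1 - g)"
  shows "h\<^sup>2 * (W * (1 - 1 / X) * (1 - 1 / Y)) * (8/5 * X + 8/3 * r) * (8/3 * (Y + 4/5))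
    \<le> (23/54)\<^sup>2 * (W / Z\<^sup>2)"
proof -
  define \<gamma> where "\<gamma> = 2200 / 6027 * (X * Y * Z)"
  define M where "M = max (8/5 * X) (8/3)"
  have \<gamma>: "0 < \<gamma>" using XY Z by (simp add: \<gamma>_def)
  have M: "0 < M" by (simp add: M_def)
  have "r * max 0 (1 - g) \<le> 1 / (4 * \<gamma>)"
  proof -
    have "r * max 0 (1 - g) \<le> r * max 0 (1 - \<gamma> * r)"
      using r g by (intro mult_left_mono) (auto simp: \<gamma>_def)
    also have "\<dots> \<le> 1 / (4 * \<gamma>)"
    proof (cases "1 - \<gamma> * r \<ge> 0")
      case True
      have "0 \<le> (1 - 2 * \<gamma> * r)\<^sup>2" by simp
      then show ?thesis using True \<gamma> by (simp add: field_simps power2_eq_square)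
    qed (use \<gamma> in auto)
    finally show ?thesis .
  qed
  moreover have "h = r * max 0 (1 - g) / (1 + r)" by (simp add: h_def)
  ultimately have h: "h \<le> 1 / (4 * \<gamma>) / (1 + r)" "0 \<le> h"
    using r by (auto intro!: divide_right_mono simp del: divide_divide_eq_left)
  have "h\<^sup>2 * (8/5 * X + 8/3 * r) \<le> (1 / (4 * \<gamma>))\<^sup>2 * M"
  proof -
    have "8/5 * X + 8/3 * r \<le> M + M * r"
      using r by (intro add_mono mult_right_mono) (auto simp: M_def)
    also have "\<dots> \<le> M * (1 + r)\<^sup>2"
      using M r by (simp add: power2_eq_square algebra_simps)
    finally have "h\<^sup>2 * (8/5 * X + 8/3 * r) \<le> (1 / (4 * \<gamma>) / (1 + r))\<^sup>2 * (M * (1 + r)\<^sup>2)"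
      using h r XY by (intro mult_mono power_mono) auto
    also have "\<dots> = (1 / (4 * \<gamma>))\<^sup>2 * M"
      using r by (simp add: power_divide power_mult_distrib)
    finally show ?thesis .
  qed
  then have "h\<^sup>2 * (8/5 * X + 8/3 * r) * ((W * (1 - 1 / X) * (1 - 1 / Y)) * (8/3 * (Y + 4/5)))
      \<le> (1 / (4 * \<gamma>))\<^sup>2 * M * ((W * (1 - 1 / X) * (1 - 1 / Y)) * (8/3 * (Y + 4/5)))"
    using XY W by (intro mult_right_mono) auto
  also have "\<dots> = (6027 / 8800)\<^sup>2 * (M * (X - 1) / X ^ 3)
      * (8/3 * ((Y + 4/5) * (Y - 1) / Y ^ 3)) * (W / Z\<^sup>2)"
  proof -
    have "1 / (4 * \<gamma>) = (6027 / 8800) / (X * Y * Z)" by (simp add: \<gamma>_def)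
    moreover have "1 - 1 / X = (X - 1) / X" "1 - 1 / Y = (Y - 1) / Y"
      using XY by (simp_all add: diff_divide_distrib)
    ultimately show ?thesis
      using split_cube[of "6027/8800" X Y Z M W "X - 1" "Y - 1" "8/3" "Y + 4/5"] by simp
  qed
  also have "\<dots> \<le> (6027 / 8800)\<^sup>2 * (2/5) * (8/3 * (3574/10000)) * (W / Z\<^sup>2)"
  proof -
    have "8/5 * X * (X - 1) \<le> 2/5 * X ^ 3"
    proof -
      have "0 \<le> 2/5 * X * (X - 2)\<^sup>2" using XY by simp
      also have "\<dots> = 2/5 * X ^ 3 - 8/5 * X * (X - 1)" by algebra
      finally show ?thesis by simp
    qed
    moreover have "8/3 * (X - 1) \<le> 2/5 * X ^ 3"
    proof -
      define c where "c = X ^ 3"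
      have "0 < c" "X - 1 \<le> 4 / 27 * c"
        using cubic_ratio_le[OF less_imp_le[OF XY(1)]] XY by (simp_all add: c_def)
      then show ?thesis unfolding c_def[symmetric] by argo
    qed
    ultimately have "M * (X - 1) \<le> 2/5 * X ^ 3" unfolding M_def by (auto simp: max_def)
    then have a: "M * (X - 1) / X ^ 3 \<le> 2/5" using XY by (simp add: divide_le_eq)
    have "(Y + 4/5) * (Y - 1) \<le> 3574/10000 * Y ^ 3"
    proof -
      have "0 \<le> (Y - 176/100)\<^sup>2 * (Y + 722/1000)" "0 \<le> Y\<^sup>2" using XY by auto
      moreover have "(Y - 176/100)\<^sup>2 * (Y + 722/1000)
          = Y ^ 3 - 2798/1000 * Y\<^sup>2 + 55616/100000 * Y + 22364672/10000000"
        "(Y + 4/5) * (Y - 1) = Y\<^sup>2 - 1/5 * Y - 4/5"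
        by algebra+
      ultimately show ?thesis using XY by argo
    qed
    then have b: "(Y + 4/5) * (Y - 1) / Y ^ 3 \<le> 3574/10000" using XY by (simp add: divide_le_eq)
    show ?thesis
      using a b M XY W by (intro mult_mono mult_nonneg_nonneg divide_nonneg_nonneg) auto
  qed
  also have "\<dots> \<le> (23/54)\<^sup>2 * (W / Z\<^sup>2)"
    using W by (intro mult_right_mono) (auto simp: power2_eq_square)
  finally show ?thesis by (simp add: mult_ac)
qed

text \<open>Here the bound on \<open>h\<close> lacks the factor \<open>r\<close>, but it decays like
  the inverse square of \<open>P = X * Y * Z\<close>, which yields fifth powers instead of
  cubes.\<close>

lemma pair_bound_short_step:
  fixes X Y Z W h :: real
  assumes XY: "1 < X" "1 < Y" and Z: "0 < Z" and W: "0 \<le> W"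
    and h: "0 \<le> h" "h \<le> max 0 (1 - 22/49 * (X * Y * Z))"
  shows "h\<^sup>2 * (W * (1 - 1 / X) * (1 - 1 / Y)) * (8/5 * X + 16/3) * (8/3 * (Y + 4/5))
    \<le> (23/54)\<^sup>2 * (W / Z ^ 4)"
proof -
  define P where "P = X * Y * Z"
  have P: "0 < P" using XY Z by (simp add: P_def)
  have "h * P\<^sup>2 \<le> max 0 (1 - 22/49 * P) * P\<^sup>2"
    using h by (intro mult_right_mono) (auto simp: P_def)
  \<comment> \<open>The constant is \<open>4/27 * (49/22)\<^sup>2\<close>, the maximum, reached
    where \<open>22/49 * P = 2/3\<close>.\<close>
  also have "\<dots> \<le> 9604/13068"
  proof (cases "22/49 * P \<le> 1")
    case True
    have "0 \<le> (22/49 * P - 2/3)\<^sup>2 * (22/49 * P + 1/3)" using P by simp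
    also have "\<dots> = 4/27 - 484/2401 * ((1 - 22/49 * P) * P\<^sup>2)" by algebra
    finally have "(1 - 22/49 * P) * P\<^sup>2 \<le> 9604/13068" by linarith
    moreover have "max 0 (1 - 22/49 * P) = 1 - 22/49 * P" using True by simp
    ultimately show ?thesis by simp
  qed auto
  finally have "h \<le> 9604/13068 / P\<^sup>2" using P by (simp add: le_divide_eq)
  then have "h\<^sup>2 \<le> (9604/13068 / P\<^sup>2)\<^sup>2" using h by (intro power_mono) auto
  then have "h\<^sup>2 * ((W * (1 - 1 / X) * (1 - 1 / Y)) * (8/5 * X + 16/3) * (8/3 * (Y + 4/5)))
      \<le> (9604/13068 / P\<^sup>2)\<^sup>2 * ((W * (1 - 1 / X) * (1 - 1 / Y)) * (8/5 * X + 16/3) * (8/3 * (Y + 4/5)))"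
    using XY W by (intro mult_right_mono) auto
  also have "\<dots> = (9604/13068)\<^sup>2 * (8/5 * ((X + 10/3) * (X - 1) / X ^ 5))
      * (8/3 * ((Y + 4/5) * (Y - 1) / Y ^ 5)) * (W / Z ^ 4)"
  proof -
    have "1 - 1 / X = (X - 1) / X" "1 - 1 / Y = (Y - 1) / Y" "8/5 * X + 16/3 = 8/5 * (X + 10/3)"
      using XY by (simp_all add: diff_divide_distrib)
    then show ?thesis
      using split_fifth[of "9604/13068" X Y Z W "X - 1" "Y - 1" "8/5" "X + 10/3" "8/3" "Y + 4/5"]
      by (simp only: P_def)
  qed
  also have "\<dots> \<le> (9604/13068)\<^sup>2 * (8/5 * (4375/10000)) * (8/3 * (17625/100000)) * (W / Z ^ 4)"
  proof -
    have bern: "1 + 5 * t + 10 * t\<^sup>2 + 10 * t ^ 3 \<le> (1 + t) ^ 5" if "0 \<le> t" for t :: real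
    proof -
      have "(1 + t) ^ 5 = 1 + 5 * t + 10 * t\<^sup>2 + 10 * t ^ 3 + (5 * t ^ 4 + t ^ 5)" by algebra
      then show ?thesis using that by simp
    qed
    have "(X + 10/3) * (X - 1) \<le> 4375/10000 * X ^ 5"
    proof -
      define t where "t = X - 1"
      have t: "0 < t" "X = 1 + t" using XY by (auto simp: t_def)
      have "0 \<le> (t - 1/3)\<^sup>2" "0 \<le> t ^ 3" using t by auto
      moreover have "(t - 1/3)\<^sup>2 = t\<^sup>2 - 2/3 * t + 1/9" "(13/3 + t) * t = t\<^sup>2 + 13/3 * t"
        by algebra+
      ultimately have "(13/3 + t) * t \<le> 4375/10000 * (1 + 5 * t + 10 * t\<^sup>2 + 10 * t ^ 3)"
        using t by argo
      also have "\<dots> \<le> 4375/10000 * (1 + t) ^ 5"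
        using bern[of t] t by (intro mult_left_mono) auto
      finally show ?thesis by (simp add: t algebra_simps)
    qed
    then have a: "(X + 10/3) * (X - 1) / X ^ 5 \<le> 4375/10000" using XY by (simp add: divide_le_eq)
    have "(Y + 4/5) * (Y - 1) \<le> 17625/100000 * Y ^ 5"
    proof -
      define t where "t = Y - 1"
      have t: "0 < t" "Y = 1 + t" using XY by (auto simp: t_def)
      have "0 \<le> (t - 28/100)\<^sup>2" "0 \<le> t * (t - 38/100)\<^sup>2" using t by auto
      moreover have "(t - 28/100)\<^sup>2 = t\<^sup>2 - 56/100 * t + 784/10000"
        "t * (t - 38/100)\<^sup>2 = t ^ 3 - 76/100 * t\<^sup>2 + 1444/10000 * t" "(9/5 + t) * t = t\<^sup>2 + 9/5 * t"
        by algebra+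
      ultimately have "(9/5 + t) * t \<le> 17625/100000 * (1 + 5 * t + 10 * t\<^sup>2 + 10 * t ^ 3)"
        using t by argo
      also have "\<dots> \<le> 17625/100000 * (1 + t) ^ 5"
        using bern[of t] t by (intro mult_left_mono) auto
      finally show ?thesis by (simp add: t algebra_simps)
    qed
    then have b: "(Y + 4/5) * (Y - 1) / Y ^ 5 \<le> 17625/100000" using XY by (simp add: divide_le_eq)
    show ?thesis
      using a b XY W by (intro mult_mono mult_nonneg_nonneg divide_nonneg_nonneg) auto
  qed
  also have "\<dots> \<le> (23/54)\<^sup>2 * (W / Z ^ 4)"
    using W by (intro mult_right_mono) (auto simp: power2_eq_square)
  finally show ?thesis by (simp add: mult_ac)
qed

text \<open>Cholesky factorization: the Schur complement \<open>K'\<close> of the last diagonal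
  entry is again positive semidefinite, and each step uses one new coordinate.\<close>

lemma psd_kernel_realizable:
  fixes K :: "nat \<Rightarrow> nat \<Rightarrow> real"
  assumes sym: "\<And>i j. K i j = K j i"
    and psd: "\<And>x. 0 \<le> (\<Sum>i<n. \<Sum>j<n. K i j * x i * x j)"
  shows "\<exists>y :: nat \<Rightarrow> fin_seq. (\<forall>i<n. y i \<in> Rd n) \<and> (\<forall>i<n. \<forall>j<n. y i \<bullet> y j = K i j)"
  using assms
proof (induction n arbitrary: K)
  case 0
  then show ?case by simp
next
  case (Suc n)
  define c where "c = K n n"
  have quad: "(\<Sum>i<Suc n. \<Sum>j<Suc n. K i j * x i * x j)
      = (\<Sum>i<n. \<Sum>j<n. K i j * x i * x j) + 2 * x n * (\<Sum>i<n. K i n * x i) + c * (x n)\<^sup>2" for x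
  proof -
    have "(\<Sum>i<n. K n i * x n * x i) = x n * (\<Sum>i<n. K i n * x i)"
      "(\<Sum>i<n. K i n * x i * x n) = x n * (\<Sum>i<n. K i n * x i)"
      using Suc.prems(1) by (simp_all add: sum_distrib_left mult_ac)
    then show ?thesis
      by (simp add: sum.distrib c_def power2_eq_square algebra_simps)
  qed
  have c0: "c \<ge> 0"
    using Suc.prems(2)[of "\<lambda>i. if i = n then 1 else 0"] unfolding quad by (simp del: sum.lessThan_Suc)
  \<comment> \<open>If \<open>c = 0\<close>, every quotient by \<open>c\<close> or
    \<open>sqrt c\<close> below is 0, so the off-diagonal entries must vanish as well.\<close>
  have zero: "K i n = 0" if "c = 0" "i < n" for i
  proof -
    have "0 \<le> K i i + 2 * t * K i n" for t
    proof -
      define x where "x j = (if j = n then t else if j = i then 1 else 0)" for j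
      have row: "(\<Sum>b<n. f b * x b) = f i" for f :: "nat \<Rightarrow> real"
      proof -
        have "(\<Sum>b<n. f b * x b) = (\<Sum>b<n. if b = i then f i else 0)"
          by (intro sum.cong) (auto simp: x_def)
        then show ?thesis using that by simp
      qed
      have "(\<Sum>a<n. \<Sum>b<n. K a b * x a * x b) = (\<Sum>a<n. K a i * x a)"
        by (subst row) simp
      also have "\<dots> = K i i" by (rule row)
      finally show ?thesis
        using Suc.prems(2)[of x] that(1) row[of "\<lambda>a. K a n"] unfolding quad
        by (simp add: x_def[of n])
    qed
    note nonneg = this
    show ?thesis
    proof (rule ccontr)
      assume ne: "K i n \<noteq> 0"
      have "2 * (- (K i i + 1) / (2 * K i n)) * K i n = - (K i i + 1)" using ne by simp
      then show False using nonneg[of "- (K i i + 1) / (2 * K i n)"] by linarith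
    qed
  qed
  define K' where "K' i j = K i j - K i n * K j n / c" for i j
  have "\<exists>y :: nat \<Rightarrow> fin_seq. (\<forall>i<n. y i \<in> Rd n) \<and> (\<forall>i<n. \<forall>j<n. y i \<bullet> y j = K' i j)"
  proof (rule Suc.IH)
    show "K' i j = K' j i" for i j using Suc.prems(1)[of i j] by (simp add: K'_def)
    fix x :: "nat \<Rightarrow> real"
    define l where "l = (\<Sum>i<n. K i n * x i)"
    have "(\<Sum>i<n. \<Sum>j<n. K' i j * x i * x j) = (\<Sum>i<n. \<Sum>j<n. K i j * x i * x j) - l\<^sup>2 / c"
      unfolding K'_def l_def power2_eq_square sum_product
      by (simp add: algebra_simps sum_subtractf sum_divide_distrib)
    also have "\<dots> = (\<Sum>i<n. \<Sum>j<n. K i j * x i * x j) + 2 * (- l / c) * l + c * (- l / c)\<^sup>2"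
    proof (cases "c = 0")
      case True
      then have "l = 0" using zero by (simp add: l_def)
      then show ?thesis by simp
    qed (simp add: power2_eq_square)
    also have "\<dots> = (\<Sum>i<Suc n. \<Sum>j<Suc n. K i j * (x(n := - l / c)) i * (x(n := - l / c)) j)"
      unfolding quad by (simp add: l_def)
    also have "\<dots> \<ge> 0" by (rule Suc.prems(2))
    finally show "0 \<le> (\<Sum>i<n. \<Sum>j<n. K' i j * x i * x j)" .
  qed
  then obtain y :: "nat \<Rightarrow> fin_seq" where y: "\<And>i. i < n \<Longrightarrow> y i \<in> Rd n"
    "\<And>i j. i < n \<Longrightarrow> j < n \<Longrightarrow> y i \<bullet> y j = K' i j" by blast
  define e where "e = Abs_fin_seq (\<lambda>j. if j = n then 1 else 0)"
  have e: "coord e j = (if j = n then 1 else 0)" for j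
    by (simp add: e_def Abs_fin_seq_inverse)
  have eR: "e \<in> Rd (Suc n)" by (simp add: Rd_def e)
  have ee: "e \<bullet> e = 1" using inner_Rd[OF eR, of e] by (simp add: e)
  have ye: "y i \<bullet> e = 0" "e \<bullet> y i = 0" if "i < n" for i
    using inner_Rd[OF y(1)[OF that], of e] by (simp_all add: e inner_commute)
  define y' where "y' i = (if i < n then y i + (K i n / sqrt c) *\<^sub>R e else sqrt c *\<^sub>R e)" for i
  have "y' i \<in> Rd (Suc n)" for i
    using y(1)[of i] eR by (auto simp: y'_def Rd_def)
  moreover have "y' i \<bullet> y' j = K i j" if ij: "i < Suc n" "j < Suc n" for i j
  proof -
    have sc: "sqrt c * sqrt c = c" using c0 by simp
    consider "i < n" "j < n" | "i < n" "j = n" | "i = n" "j < n" | "i = n" "j = n"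
      using ij by linarith
    then show ?thesis
    proof cases
      case 1
      then have "y' i \<bullet> y' j = K' i j + K i n * K j n / (sqrt c * sqrt c)"
        by (simp add: y'_def inner_add_left inner_add_right ee ye y(2) del: real_sqrt_mult_self)
      then show ?thesis unfolding sc K'_def by simp
    next
      case 2
      then have "y' i \<bullet> y' j = K i n / sqrt c * sqrt c"
        by (simp add: y'_def inner_add_left ee ye)
      then show ?thesis using 2 zero by (cases "c = 0") auto
    next
      case 3
      then have "y' i \<bullet> y' j = K j n / sqrt c * sqrt c"
        by (simp add: y'_def inner_add_right ee ye)
      then show ?thesis using 3 zero Suc.prems(1)[of i j] by (cases "c = 0") auto
    next
      case 4
      then show ?thesis using sc by (simp add: y'_def ee c_def)
    qed
  qed
  ultimately show ?case by blast
qed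

text \<open>
  A pattern of flips: segment \<open>i\<close> is traversed with constant gradient and has length \<open>s i\<close>; for
  \<open>i < k\<close> it ends with a flip whose step exceeds 1 by \<open>v i\<close>. All lengths are measured in the unit in
  which the excesses are at least \<open>22/49\<close>. There is no flip after segment \<open>k\<close>, and \<open>v k = s k\<close> is
  only a convention that makes the formulas uniform.
\<close>

locale flip_pattern =
  fixes k :: nat and s v :: "nat \<Rightarrow> real"
  assumes s_pos: "i \<le> k \<Longrightarrow> 0 < s i"
    and v_ge: "i \<le> k \<Longrightarrow> 22/49 \<le> v i"
    and v_last: "v k = s k"
begin

text \<open>
  The gradient on segment \<open>i\<close> will be \<open>(-1)^i * a i\<close> times a vector \<open>Y i\<close>, where the \<open>Y i\<close> have Gram
  matrix \<open>C\<close>. If \<open>H = 0\<close>, then the \<open>Y i\<close> form a random walk with variances \<open>E i\<close> running backwards in \<open>i\<close>,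
  and at each flip all later pieces of the function are tied. The correction \<open>H\<close> pushes a later piece
  \<open>m\<close> below the piece \<open>i\<close> at the start of segment \<open>i\<close>, which matters only if the flip after \<open>i\<close>
  is much longer than those that follow it. In \<open>b\<close>, the factor \<open>1 + 1 / \<rho> (Suc i)\<close> is what the
  random walk needs, and the other terms are inflations that keep the correction small.
\<close>

definition \<rho> where "\<rho> i = s i / v i"
definition R where "R i = (\<Prod>l\<in>{i..<k}. \<rho> l)"
definition a where "a i = R (Suc i) / v i"
text \<open>It counteracts the division by \<open>v i\<close> in the lower bound for
  \<open>g i m\<close>: since \<open>s i = \<rho> i * v i\<close>, a long flip keeps
  \<open>F i / v i\<close> at least \<open>\<rho> i / (123/100)\<close>.\<close>

definition F where "F i = (if v i < 1 then 1 else max 1 (s i / (123/100)))"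
definition b where
  "b i = (1 + max (1 / \<rho> (Suc i)) (1/2)) * F i * ((v i + max (s i) (27/49)) / (v i + s i))"
definition E where "E i = (\<Prod>l\<in>{i..<k}. b l)"
definition g where "g i m = a i * E i / (a m * E m)"
text \<open>The least nonnegative value with
  \<open>1 - h i m * (1 + 1 / \<rho> i) \<le> g i m\<close>, the condition that piece
  \<open>m\<close> does not exceed piece \<open>i\<close> at the start of segment
  \<open>i\<close>.\<close>

definition h where "h i m = \<rho> i / (1 + \<rho> i) * max 0 (1 - g i m)"
definition H where
  "H i m = (if even (i + m) \<and> i \<noteq> m then h (min i m) (max i m) * E (max i m) else 0)"
definition C where "C i m = E (max i m) - H i m"

lemma v_pos: "i \<le> k \<Longrightarrow> 0 < v i"
  using v_ge[of i] by simp

lemma \<rho>_pos: "i \<le> k \<Longrightarrow> 0 < \<rho> i"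
  using s_pos v_pos by (simp add: \<rho>_def)

lemma \<rho>_last: "\<rho> k = 1"
  using s_pos[of k] by (simp add: \<rho>_def v_last)

text \<open>It holds at \<open>i = k\<close> too because both products are empty and the convention
  \<open>v k = s k\<close> gives \<open>\<rho> k = 1\<close>.\<close>

lemma R_step: "i \<le> k \<Longrightarrow> R i = \<rho> i * R (Suc i)"
proof (cases "i = k")
  case True
  then show ?thesis by (simp add: R_def \<rho>_last)
next
  case False
  assume "i \<le> k"
  with False show ?thesis
    unfolding R_def by (subst prod.atLeast_Suc_lessThan) auto
qed

lemma R_pos: "0 < R i"
  unfolding R_def by (intro prod_pos) (auto intro: \<rho>_pos)

lemma a_pos: "i \<le> k \<Longrightarrow> 0 < a i"
  using R_pos v_pos by (simp add: a_def)

lemma a_v: "i \<le> k \<Longrightarrow> a i * v i = R (Suc i)"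
  using v_pos[of i] by (simp add: a_def)

lemma a_s: "i \<le> k \<Longrightarrow> a i * s i = R i"
  using v_pos[of i] by (simp add: a_def R_step \<rho>_def)

lemma F_ge1: "1 \<le> F i" by (simp add: F_def)

lemma short_ge1: "i \<le> k \<Longrightarrow> 1 \<le> (v i + max (s i) (27/49)) / (v i + s i)"
  using s_pos[of i] v_pos[of i] by (simp add: le_divide_eq)

lemma b_ge:
  assumes "i < k"
  shows "(1 + max (1 / \<rho> (Suc i)) (1/2)) * F i \<le> b i"
    and "(1 + max (1 / \<rho> (Suc i)) (1/2)) * ((v i + max (s i) (27/49)) / (v i + s i)) \<le> b i"
    and "1 + 1 / \<rho> (Suc i) \<le> b i" and "3/2 \<le> b i"
proof -
  define B where "B = 1 + max (1 / \<rho> (Suc i)) (1/2)"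
  define G where "G = (v i + max (s i) (27/49)) / (v i + s i)"
  have b: "b i = B * F i * G" by (simp add: b_def B_def G_def)
  have B: "1 + 1 / \<rho> (Suc i) \<le> B" "3/2 \<le> B" by (auto simp: B_def)
  have G: "1 \<le> G" using short_ge1 assms by (simp add: G_def)
  have BF: "B \<le> B * F i" using F_ge1[of i] B by (simp add: mult_le_cancel_left1)
  show 1: "(1 + max (1 / \<rho> (Suc i)) (1/2)) * F i \<le> b i"
    unfolding b B_def[symmetric] using mult_left_mono[OF G, of "B * F i"] BF B by simp
  show "(1 + max (1 / \<rho> (Suc i)) (1/2)) * ((v i + max (s i) (27/49)) / (v i + s i)) \<le> b i"
    unfolding b B_def[symmetric] G_def[symmetric] using BF G by (intro mult_right_mono) auto
  show "1 + 1 / \<rho> (Suc i) \<le> b i" "3/2 \<le> b i"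
    using 1 BF B unfolding B_def[symmetric] by linarith+
qed

lemma E_step: "i < k \<Longrightarrow> E i = b i * E (Suc i)"
  unfolding E_def by (subst prod.atLeast_Suc_lessThan) auto

lemma E_last: "E k = 1" by (simp add: E_def)

lemma E_pos: "0 < E i"
  unfolding E_def by (intro prod_pos) (use b_ge(4) in fastforce)

definition X where "X l = 1 + \<rho> l"

lemma X_gt: "l \<le> k \<Longrightarrow> 1 < X l" using \<rho>_pos by (simp add: X_def)


lemma aE_step: "l < k \<Longrightarrow> a l * E l = (s (Suc l) / v l * b l) * (a (Suc l) * E (Suc l))"
  using v_pos[of l] v_pos[of "Suc l"] R_step[of "Suc l"]
  by (simp add: a_def E_step \<rho>_def mult_ac)

lemma b_s_ge: "l < k \<Longrightarrow> 0 \<le> c \<Longrightarrow> (1 + 1 / \<rho> (Suc l)) * c \<le> b l \<Longrightarrow>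
    v (Suc l) * X (Suc l) * c \<le> s (Suc l) * b l"
proof -
  assume l: "l < k" and "(1 + 1 / \<rho> (Suc l)) * c \<le> b l"
  then have "s (Suc l) * ((1 + 1 / \<rho> (Suc l)) * c) \<le> s (Suc l) * b l"
    using s_pos[of "Suc l"] by (intro mult_left_mono) auto
  moreover have "s (Suc l) * (1 + 1 / \<rho> (Suc l)) = v (Suc l) * X (Suc l)"
    using l s_pos[of "Suc l"] v_pos[of "Suc l"] by (simp add: \<rho>_def X_def field_simps)
  ultimately show ?thesis by (simp add: mult.assoc[symmetric])
qed

lemma prod_X_pos: "m \<le> k \<Longrightarrow> 1 \<le> (\<Prod>l\<in>{i<..m}. X l)"
  by (intro prod_ge_1) (use X_gt in \<open>auto intro: less_imp_le\<close>)

text \<open>Telescoping: passing from level \<open>l\<close> to \<open>Suc l\<close> gains at least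
  \<open>v (Suc l) * X (Suc l) / v l\<close>, since \<open>b l\<close> contains
  \<open>1 + 1 / \<rho> (Suc l)\<close>. The extra \<open>F\<close> is claimed only at level
  \<open>i\<close>.\<close>

lemma level_ratio_ge:
  assumes "i < m" "m \<le> k"
  shows "v m * (\<Prod>l\<in>{i<..m}. X l) * F i / v i * (a m * E m) \<le> a i * E i"
  using assms
proof (induction m)
  case (Suc m)
  define Q where "Q = a (Suc m) * E (Suc m)"
  have Q: "0 < Q" using a_pos E_pos Suc.prems by (simp add: Q_def)
  have vm: "0 < v m" "0 < v i" using v_pos Suc.prems by auto
  show ?case
  proof (cases "m = i")
    case True
    have "(1 + 1 / \<rho> (Suc i)) * F i \<le> (1 + max (1 / \<rho> (Suc i)) (1/2)) * F i"
      using F_ge1[of i] by (intro mult_right_mono) auto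
    also have "\<dots> \<le> b i" using b_ge(1)[of i] Suc.prems by simp
    finally have "v (Suc i) * X (Suc i) * F i \<le> s (Suc i) * b i"
      using b_s_ge[of i "F i"] F_ge1[of i] Suc.prems by simp
    then have "v (Suc i) * X (Suc i) * F i / v i * Q \<le> s (Suc i) * b i / v i * Q"
      using vm Q by (intro mult_right_mono divide_right_mono) auto
    moreover have "{i<..Suc i} = {Suc i}" by auto
    ultimately show ?thesis
      using True aE_step[of i] Suc.prems by (simp add: Q_def)
  next
    case False
    define P where "P = (\<Prod>l\<in>{i<..m}. X l)"
    have P: "0 < P" using prod_X_pos[of m i] Suc.prems by (simp add: P_def)
    have "{i<..Suc m} = insert (Suc m) {i<..m}" using Suc.prems by auto
    then have P': "(\<Prod>l\<in>{i<..Suc m}. X l) = X (Suc m) * P" by (simp add: P_def)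
    have "v (Suc m) * (X (Suc m) * P) * F i / v i * Q = (P * F i / v i * Q) * (v (Suc m) * X (Suc m))"
      by (simp add: mult_ac)
    also have "\<dots> \<le> (P * F i / v i * Q) * (s (Suc m) * b m)"
      using b_s_ge[of m 1] b_ge(3)[of m] Suc.prems P Q F_ge1[of i] vm
      by (intro mult_left_mono) auto
    also have "\<dots> = v m * P * F i / v i * (a m * E m)"
      using aE_step[of m] Suc.prems vm by (simp add: Q_def)
    also have "\<dots> \<le> a i * E i" using Suc False by (simp add: P_def)
    finally show ?thesis by (simp add: P' Q_def)
  qed
qed simp

text \<open>The factor \<open>1 + 1 / \<rho> l\<close> is the inverse of
  \<open>1 - 1 / X l\<close>.\<close>

lemma E_ratio_le:
  assumes "i \<le> m" "m \<le> k"
  shows "E m \<le> (\<Prod>l\<in>{i<..m}. 1 - 1 / X l) * E i"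
  using assms
proof (induction m rule: dec_induct)
  case (step m)
  define q where "q = 1 - 1 / X (Suc m)"
  have \<rho>: "0 < \<rho> (Suc m)" using \<rho>_pos step by simp
  have q: "0 \<le> q" using X_gt[of "Suc m"] step by (simp add: q_def)
  have "q = \<rho> (Suc m) / (1 + \<rho> (Suc m))" "1 + 1 / \<rho> (Suc m) = (1 + \<rho> (Suc m)) / \<rho> (Suc m)"
    using \<rho> by (simp_all add: q_def X_def field_simps)
  then have "(1 + 1 / \<rho> (Suc m)) * q = 1" using \<rho> by simp
  then have "1 \<le> b m * q" using mult_right_mono[OF b_ge(3)[of m] q] step by simp
  then have "E (Suc m) \<le> (b m * q) * E (Suc m)" using E_pos[of "Suc m"] by simp
  also have "\<dots> = q * E m" using step by (simp add: E_step)
  also have "\<dots> \<le> q * ((\<Prod>l\<in>{i<..m}. 1 - 1 / X l) * E i)"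
    using step q by (intro mult_left_mono) auto
  also have "\<dots> = (\<Prod>l\<in>{i<..Suc m}. 1 - 1 / X l) * E i"
  proof -
    have "{i<..Suc m} = insert (Suc m) {i<..m}" using step by auto
    then show ?thesis by (simp add: q_def)
  qed
  finally show ?case .
qed simp

lemma g_ge:
  assumes "i < m" "m \<le> k"
  shows "v m * (\<Prod>l\<in>{i<..m}. X l) * F i / v i \<le> g i m"
  using level_ratio_ge[OF assms] a_pos[of m] E_pos[of m] assms
  by (simp add: g_def le_divide_eq)

lemma g_ge_short:
  assumes "i < m" "m \<le> k" "v i < 1"
  shows "v m * (\<Prod>l\<in>{i<..m}. X l) \<le> g i m"
proof -
  have "v m * (\<Prod>l\<in>{i<..m}. X l) * v i \<le> v m * (\<Prod>l\<in>{i<..m}. X l) * 1"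
    using assms v_pos[of m] prod_X_pos[of m i] by (intro mult_left_mono) auto
  then have "v m * (\<Prod>l\<in>{i<..m}. X l) \<le> v m * (\<Prod>l\<in>{i<..m}. X l) * F i / v i"
    using assms v_pos[of i] by (simp add: F_def le_divide_eq)
  then show ?thesis using g_ge[OF assms(1,2)] by simp
qed

lemma g_ge_long:
  assumes "i < m" "m \<le> k" "1 \<le> v i"
  shows "v m * (100/123) * (\<Prod>l\<in>{i<..m}. X l) * \<rho> i \<le> g i m"
proof -
  have "s i / (123/100) \<le> F i" using assms by (simp add: F_def)
  then have "v m * (\<Prod>l\<in>{i<..m}. X l) * (s i / (123/100)) / v i
      \<le> v m * (\<Prod>l\<in>{i<..m}. X l) * F i / v i"
    using assms v_pos[of m] v_pos[of i] prod_X_pos[of m i]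
    by (intro divide_right_mono mult_left_mono) auto
  then show ?thesis using g_ge[OF assms(1,2)] by (simp add: \<rho>_def mult_ac)
qed

text \<open>The middle bound is what \<open>pair_descent\<close> can absorb, as it says
  \<open>1 - h i m \<ge> v m / (27/49 + v m)\<close>. For a short flip it rests on
  \<open>27/49 + 22/49 = 1\<close>, for a long one on maximizing over \<open>r\<close>.\<close>

lemma h_bounds:
  assumes "i < m" "m \<le> k"
  shows "0 \<le> h i m" and "h i m \<le> (27/49) / (27/49 + v m)" and "h i m \<le> 1"
proof -
  define r where "r = \<rho> i"
  have r: "0 < r" using \<rho>_pos assms by (simp add: r_def)
  have vm: "22/49 \<le> v m" using v_ge assms by simp
  have P: "1 \<le> (\<Prod>l\<in>{i<..m}. X l)" using prod_X_pos assms by simp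
  show "0 \<le> h i m" using r by (simp add: h_def r_def[symmetric])
  show "h i m \<le> (27/49) / (27/49 + v m)"
  proof (cases "v i < 1")
    case True
    have "v m * 1 \<le> v m * (\<Prod>l\<in>{i<..m}. X l)" using P vm by (intro mult_left_mono) auto
    then have g: "v m \<le> g i m" using g_ge_short[OF assms True] by simp
    have "r / (1 + r) * max 0 (1 - g i m) \<le> 1 * max 0 (1 - v m)"
      using r g by (intro mult_mono) auto
    also have "\<dots> \<le> (27/49) / (27/49 + v m)"
    proof -
      have "0 \<le> v m * (v m - 22/49)" using vm by simp
      moreover have "(1 - v m) * (27/49 + v m) = 27/49 - v m * (v m - 22/49)" by algebra
      ultimately have "(1 - v m) * (27/49 + v m) \<le> 27/49" by linarith
      then have "1 - v m \<le> (27/49) / (27/49 + v m)" using vm by (intro mult_imp_le_div_pos) auto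
      then show ?thesis using vm by auto
    qed
    finally show ?thesis by (simp add: h_def r_def)
  next
    case False
    define \<gamma> where "\<gamma> = v m * (100/123)"
    have \<gamma>: "0 < \<gamma>" using vm by (simp add: \<gamma>_def)
    have "\<gamma> * 1 * r \<le> \<gamma> * (\<Prod>l\<in>{i<..m}. X l) * r"
      using P r \<gamma> by (intro mult_right_mono mult_left_mono) auto
    then have g: "\<gamma> * r \<le> g i m"
      using g_ge_long[OF assms] False by (simp add: \<gamma>_def r_def)
    have "r / (1 + r) * max 0 (1 - g i m) \<le> r / (1 + r) * max 0 (1 - \<gamma> * r)"
      using r g by (intro mult_left_mono) auto
    also have "\<dots> \<le> 1 / (1 + 4 * \<gamma>)"
    proof (cases "1 - \<gamma> * r \<ge> 0")
      case True
      have "0 \<le> (1 - 2 * \<gamma> * r)\<^sup>2 + \<gamma> * r\<^sup>2" using \<gamma> by simp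
      then have "r * (1 - \<gamma> * r) * (1 + 4 * \<gamma>) \<le> 1 + r"
        by (simp add: algebra_simps power2_eq_square)
      then have "r * (1 - \<gamma> * r) / (1 + r) \<le> 1 / (1 + 4 * \<gamma>)"
        using r \<gamma> by (simp add: divide_le_eq le_divide_eq)
      then show ?thesis using True by simp
    qed (use \<gamma> r in auto)
    also have "\<dots> \<le> (27/49) / (27/49 + v m)"
      using vm by (simp add: \<gamma>_def divide_le_eq le_divide_eq field_simps)
    finally show ?thesis by (simp add: h_def r_def)
  qed
  also have "\<dots> \<le> 1" using vm by simp
  finally show "h i m \<le> 1" .
qed

section \<open>Positive semidefiniteness of the kernel \<open>C\<close>\<close>

definition eps where "eps m = (if m < k then E m - E (Suc m) else E k)"
text \<open>The diagonal form with weights \<open>1 / D m\<close> will separate \<open>H\<close>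
  from the random-walk form, whose increments have variance \<open>eps m\<close>. The coefficients
  are the inverses of 5/8 and 3/8, which add up to 1.\<close>

definition D where "D m = (8/5) / eps m + (if m = 0 then 0 else (8/3) / eps (m - 1))"

lemma eps_eq: "m < k \<Longrightarrow> eps m = (b m - 1) * E (Suc m)"
  by (simp add: eps_def E_step algebra_simps)

lemma eps_pos: "m \<le> k \<Longrightarrow> 0 < eps m"
  using eps_eq[of m] b_ge(4)[of m] E_pos[of "Suc m"] E_pos[of k]
  by (cases "m = k") (auto simp: eps_def)

lemma D_pos: "m \<le> k \<Longrightarrow> 0 < D m"
  by (auto simp: D_def intro!: add_pos_nonneg divide_pos_pos divide_nonneg_nonneg eps_pos
      less_imp_le[OF eps_pos])

text \<open>The cap 2 is the purpose of the alternative 1/2 in \<open>b\<close>: it bounds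
  \<open>E i / eps i\<close> however long the segments are.\<close>

lemma inverse_b_le:
  assumes "i < k" shows "1 / (b i - 1) \<le> min (\<rho> (Suc i)) 2"
proof -
  have \<rho>: "0 < \<rho> (Suc i)" using \<rho>_pos assms by simp
  have "1 / \<rho> (Suc i) \<le> b i - 1" "1/2 \<le> b i - 1" using b_ge(3,4)[OF assms] by auto
  then have "1 / (b i - 1) \<le> 1 / (1 / \<rho> (Suc i))" "1 / (b i - 1) \<le> 1 / (1/2)"
    using \<rho> by (intro divide_left_mono mult_pos_pos; force)+
  then show ?thesis by simp
qed

lemma E_eps_self:
  assumes "i < k" shows "E i / eps i \<le> 1 + min (\<rho> (Suc i)) 2"
proof -
  have "E i / eps i = b i / (b i - 1)"
    using assms E_pos[of "Suc i"] by (simp add: eps_eq E_step)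
  also have "\<dots> = 1 + 1 / (b i - 1)" using b_ge(4)[OF assms] by (simp add: field_simps)
  finally show ?thesis using inverse_b_le[OF assms] by simp
qed

lemma E_eps_prev:
  assumes "0 < i" "i \<le> k" shows "E i / eps (i - 1) \<le> min (\<rho> i) 2"
proof -
  have "E i / eps (i - 1) = 1 / (b (i - 1) - 1)"
    using assms E_pos[of i] by (simp add: eps_eq)
  then show ?thesis using inverse_b_le[of "i - 1"] assms by simp
qed

lemma ED_upper:
  assumes "i < k" shows "E i * D i \<le> 8/5 * X (Suc i) + 8/3 * min (\<rho> i) 2"
proof -
  have "E i * D i = 8/5 * (E i / eps i) + (if i = 0 then 0 else 8/3 * (E i / eps (i - 1)))"
    by (simp add: D_def algebra_simps)
  moreover have "(if i = 0 then 0 else 8/3 * (E i / eps (i - 1))) \<le> 8/3 * min (\<rho> i) 2"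
    using E_eps_prev[of i] assms \<rho>_pos[of i] by auto
  moreover have "E i / eps i \<le> X (Suc i)" using E_eps_self[OF assms] by (auto simp: X_def)
  ultimately show ?thesis by linarith
qed

lemma ED_lower:
  assumes "0 < m" "m \<le> k" shows "E m * D m \<le> 8/3 * (X m + 4/5)"
proof -
  have "E m * D m = 8/5 * (E m / eps m) + 8/3 * (E m / eps (m - 1))"
    using assms by (simp add: D_def algebra_simps)
  moreover have "E m / eps m \<le> 3"
    using E_eps_self[of m] assms E_pos[of k] by (cases "m = k") (auto simp: eps_def)
  ultimately show ?thesis using E_eps_prev[OF assms] by (auto simp: X_def)
qed

text \<open>Bounds for the entries of \<open>H\<close> normalized by \<open>D\<close>, depending
  only on the distance from the diagonal. The ratio 4/27 is the maximum of
  \<open>(x - 1) / x ^ 3\<close>.\<close>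

definition cc where
  "cc i m = (if even (i + m) \<and> i \<noteq> m then 23/54 * (4/27) ^ ((max i m - min i m) div 2 - 1) else (0::real))"

text \<open>Each level strictly between \<open>i\<close> and \<open>m\<close> contributes at most
  4/27 to the square, hence 4/27 to \<open>cc\<close> per two levels. The levels
  \<open>Suc i\<close> and \<open>m\<close> are kept apart because the weights \<open>D\<close>
  involve them.\<close>

lemma pair_bound:
  assumes im: "i < m" "m \<le> k" "even (i + m)"
  shows "(h i m)\<^sup>2 * (E m / E i) * (8/5 * X (Suc i) + 8/3 * min (\<rho> i) 2) * (8/3 * (X m + 4/5))
    \<le> (cc i m)\<^sup>2"
proof -
  define M where "M = {Suc i<..<m}"
  define Z where "Z = (\<Prod>l\<in>M. X l)"
  define W where "W = (\<Prod>l\<in>M. 1 - 1 / X l)"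
  have "i + 2 \<le> m" using im by (cases "m = Suc i") auto
  then have split: "{i<..m} = insert (Suc i) (insert m M)" "Suc i \<notin> insert m M" "m \<notin> M" "finite M"
    by (auto simp: M_def)
  have XM: "1 < X l" if "l \<in> M" for l using that X_gt im by (auto simp: M_def)
  have XY: "1 < X (Suc i)" "1 < X m" using X_gt im by auto
  have Z: "1 \<le> Z" unfolding Z_def using XM by (intro prod_ge_1) (auto intro: less_imp_le)
  have "0 \<le> 1 - 1 / X l" if "l \<in> M" for l using XM[OF that] by simp
  then have W: "0 \<le> W" unfolding W_def by (intro prod_nonneg) blast
  have P: "(\<Prod>l\<in>{i<..m}. X l) = X (Suc i) * X m * Z"
    unfolding split(1) Z_def using split by (simp add: mult_ac)
  have "(\<Prod>l\<in>{i<..m}. 1 - 1 / X l) = W * (1 - 1 / X (Suc i)) * (1 - 1 / X m)"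
    unfolding split(1) W_def using split by (simp add: mult_ac)
  then have E: "E m / E i \<le> W * (1 - 1 / X (Suc i)) * (1 - 1 / X m)"
    using E_ratio_le[of i m] im E_pos[of i] by (simp add: divide_le_eq)
  have r: "0 < \<rho> i" using \<rho>_pos im by simp
  have WZ: "W / Z\<^sup>2 \<le> (4/27) ^ (2 * ((m - i) div 2 - 1))"
  proof -
    have "W / Z\<^sup>2 = (\<Prod>l\<in>M. (1 - 1 / X l) / (X l)\<^sup>2)"
      by (simp add: W_def Z_def prod_dividef prod_power_distrib)
    also have "\<dots> \<le> (\<Prod>l\<in>M. 4/27)"
    proof (rule prod_mono)
      fix l assume "l \<in> M"
      then have x: "1 < X l" by (rule XM)
      have "(1 - 1 / X l) / (X l)\<^sup>2 = (X l - 1) / X l ^ 3"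
        using x by (simp add: field_simps eval_nat_numeral)
      also have "\<dots> \<le> 4/27" using cubic_ratio_le[of "X l"] x by (simp add: divide_le_eq)
      finally show "0 \<le> (1 - 1 / X l) / (X l)\<^sup>2 \<and> (1 - 1 / X l) / (X l)\<^sup>2 \<le> 4/27"
        using x by simp
    qed
    also have "\<dots> = (4/27) ^ (m - i - 2)" by (simp add: M_def)
    also have "m - i - 2 = 2 * ((m - i) div 2 - 1)"
    proof -
      have "even (m - i)" using im by simp
      then obtain p where "m - i = 2 * p" by (elim evenE)
      then have "m = i + 2 * p" using im by simp
      then show ?thesis by simp
    qed
    finally show ?thesis .
  qed
  define N where "N = (h i m)\<^sup>2 * (W * (1 - 1 / X (Suc i)) * (1 - 1 / X m))"
  have N: "0 \<le> N" unfolding N_def using W XY by (intro mult_nonneg_nonneg) auto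
  have "(h i m)\<^sup>2 * (E m / E i) * (8/5 * X (Suc i) + 8/3 * min (\<rho> i) 2) * (8/3 * (X m + 4/5))
      \<le> N * (8/5 * X (Suc i) + 8/3 * min (\<rho> i) 2) * (8/3 * (X m + 4/5))"
    unfolding N_def using XY r E by (intro mult_right_mono mult_left_mono) auto
  also have "\<dots> \<le> (23/54)\<^sup>2 * (W / Z\<^sup>2)"
  proof (cases "v i < 1")
    case True
    have "22/49 * (X (Suc i) * X m * Z) \<le> v m * (X (Suc i) * X m * Z)"
      using v_ge[of m] im XY Z by (intro mult_right_mono) auto
    also have "\<dots> \<le> g i m" using g_ge_short[OF im(1,2) True] by (simp add: P)
    finally have "\<rho> i / (1 + \<rho> i) * max 0 (1 - g i m) \<le> 1 * max 0 (1 - 22/49 * (X (Suc i) * X m * Z))"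
      using r by (intro mult_mono) auto
    then have hle: "h i m \<le> max 0 (1 - 22/49 * (X (Suc i) * X m * Z))" by (simp add: h_def)
    have "N * (8/5 * X (Suc i) + 8/3 * min (\<rho> i) 2) * (8/3 * (X m + 4/5))
        \<le> N * (8/5 * X (Suc i) + 16/3) * (8/3 * (X m + 4/5))"
      using N XY by (intro mult_right_mono mult_left_mono) auto
    also have "\<dots> \<le> (23/54)\<^sup>2 * (W / Z ^ 4)"
      unfolding N_def using pair_bound_short_step[OF XY _ W h_bounds(1)[OF im(1,2)] hle] Z by simp
    also have "\<dots> \<le> (23/54)\<^sup>2 * (W / Z\<^sup>2)"
    proof -
      have "Z\<^sup>2 \<le> Z ^ 4" using Z by (intro power_increasing) auto
      then show ?thesis using Z W by (intro mult_left_mono divide_left_mono) auto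
    qed
    finally show ?thesis .
  next
    case False
    have "22/49 * (100/123) * (X (Suc i) * X m * Z) * \<rho> i \<le> v m * (100/123) * (X (Suc i) * X m * Z) * \<rho> i"
      using v_ge[of m] im XY Z r by (intro mult_right_mono) auto
    also have "\<dots> \<le> g i m" using g_ge_long[OF im(1,2)] False by (simp add: P)
    finally have "2200 / 6027 * (X (Suc i) * X m * Z) * \<rho> i \<le> g i m" by simp
    from pair_bound_long_step[OF r XY _ W this] Z
    have "N * (8/5 * X (Suc i) + 8/3 * \<rho> i) * (8/3 * (X m + 4/5)) \<le> (23/54)\<^sup>2 * (W / Z\<^sup>2)"
      by (simp add: N_def h_def)
    moreover have "N * (8/5 * X (Suc i) + 8/3 * min (\<rho> i) 2) * (8/3 * (X m + 4/5))
        \<le> N * (8/5 * X (Suc i) + 8/3 * \<rho> i) * (8/3 * (X m + 4/5))"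
      using N XY by (intro mult_right_mono mult_left_mono) auto
    ultimately show ?thesis by linarith
  qed
  also have "\<dots> \<le> (23/54)\<^sup>2 * (4/27) ^ (2 * ((m - i) div 2 - 1))"
    using WZ by (intro mult_left_mono) auto
  also have "\<dots> = (cc i m)\<^sup>2"
  proof -
    have "cc i m = 23/54 * (4/27) ^ ((m - i) div 2 - 1)" using im by (simp add: cc_def)
    then show ?thesis
      by (simp only: power_mult_distrib power_mult[symmetric] mult.commute[of _ 2])
  qed
  finally show ?thesis .
qed

lemma H_sym: "H i m = H m i" by (simp add: H_def add.commute min.commute max.commute)
lemma C_sym: "C i m = C m i" by (simp add: C_def H_sym max.commute)
lemma cc_sym: "cc i m = cc m i" by (simp add: cc_def add.commute min.commute max.commute)
lemma cc_nonneg: "0 \<le> cc i m" by (simp add: cc_def)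

lemma H_nonneg: "i \<le> k \<Longrightarrow> m \<le> k \<Longrightarrow> 0 \<le> H i m"
  using h_bounds(1)[of i m] h_bounds(1)[of m i] E_pos
  by (auto simp: H_def min_def max_def intro!: mult_nonneg_nonneg less_imp_le[OF E_pos])

lemma H_D_le:
  assumes "i \<le> k" "m \<le> k" shows "(H i m)\<^sup>2 * D i * D m \<le> (cc i m)\<^sup>2"
proof -
  have *: "(H i m)\<^sup>2 * D i * D m \<le> (cc i m)\<^sup>2" if im: "i < m" "m \<le> k" "even (i + m)" for i m
  proof -
    have "(H i m)\<^sup>2 * D i * D m = (h i m)\<^sup>2 * (E m / E i) * (E i * D i) * (E m * D m)"
      using im E_pos[of i] by (simp add: H_def power2_eq_square)
    also have "\<dots> \<le> (h i m)\<^sup>2 * (E m / E i) * (8/5 * X (Suc i) + 8/3 * min (\<rho> i) 2) * (8/3 * (X m + 4/5))"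
    proof (rule mult_mono[OF mult_left_mono])
      show "E i * D i \<le> 8/5 * X (Suc i) + 8/3 * min (\<rho> i) 2" using ED_upper im by simp
      show "E m * D m \<le> 8/3 * (X m + 4/5)" using ED_lower im by simp
      show nn: "0 \<le> (h i m)\<^sup>2 * (E m / E i)" using E_pos[of i] E_pos[of m] by simp
      have "0 \<le> 8/5 * X (Suc i) + 8/3 * min (\<rho> i) 2"
        using X_gt[of "Suc i"] \<rho>_pos[of i] im by simp
      then show "0 \<le> (h i m)\<^sup>2 * (E m / E i) * (8/5 * X (Suc i) + 8/3 * min (\<rho> i) 2)"
        using nn by (rule mult_nonneg_nonneg[rotated])
      show "0 \<le> E m * D m" using E_pos[of m] D_pos[of m] im by simp
    qed
    also have "\<dots> \<le> (cc i m)\<^sup>2" by (rule pair_bound[OF im])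
    finally show ?thesis .
  qed
  consider "i < m" "even (i + m)" | "m < i" "even (i + m)" | "i = m \<or> odd (i + m)" by linarith
  then show ?thesis
  proof cases
    case 1 then show ?thesis using * assms by simp
  next
    case 2 then show ?thesis
      using *[of m i] assms by (simp add: H_sym[of i m] cc_sym[of i m] add.commute mult_ac)
  next
    case 3 then show ?thesis by (auto simp: H_def)
  qed
qed

end

lemma power2_diff_le_weighted:
  fixes x y \<alpha> \<beta> :: real
  assumes "0 < \<alpha>" "0 < \<beta>"
  shows "(x - y)\<^sup>2 / (\<alpha> + \<beta>) \<le> x\<^sup>2 / \<alpha> + y\<^sup>2 / \<beta>"
proof -
  have "0 \<le> (\<beta> * x + \<alpha> * y)\<^sup>2" by simp
  then have "(x - y)\<^sup>2 * (\<alpha> * \<beta>) \<le> (x\<^sup>2 * \<beta> + y\<^sup>2 * \<alpha>) * (\<alpha> + \<beta>)"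
    by (simp add: power2_eq_square algebra_simps)
  then have "(x - y)\<^sup>2 / (\<alpha> + \<beta>) \<le> (x\<^sup>2 * \<beta> + y\<^sup>2 * \<alpha>) / (\<alpha> * \<beta>)"
    using assms by (simp add: divide_le_eq le_divide_eq mult.commute)
  also have "\<dots> = x\<^sup>2 / \<alpha> + y\<^sup>2 / \<beta>" using assms by (simp add: add_divide_distrib)
  finally show ?thesis .
qed

text \<open>The left kernel is the covariance of a random walk running backwards with independent
  increments of variance \<open>e m\<close>; the right side groups its quadratic form by
  increments.\<close>

lemma sum_max_kernel:
  fixes e x :: "nat \<Rightarrow> real"
  shows "(\<Sum>i\<le>n. \<Sum>j\<le>n. (\<Sum>m\<in>{max i j..n}. e m) * x i * x j) = (\<Sum>m\<le>n. e m * (\<Sum>i\<le>m. x i)\<^sup>2)"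
proof -
  define y where "y m i = (if i \<le> m then x i else 0)" for m i
  have "(\<Sum>m\<in>{max i j..n}. e m) * x i * x j = (\<Sum>m\<le>n. e m * (y m i * y m j))" for i j
  proof -
    have "(\<Sum>m\<in>{max i j..n}. e m) * x i * x j = (\<Sum>m\<in>{max i j..n}. e m * (y m i * y m j))"
      unfolding mult.assoc sum_distrib_right by (intro sum.cong refl) (simp add: y_def)
    also have "\<dots> = (\<Sum>m\<le>n. e m * (y m i * y m j))"
      by (rule sum.mono_neutral_left) (auto simp: y_def)
    finally show ?thesis .
  qed
  then have "(\<Sum>i\<le>n. \<Sum>j\<le>n. (\<Sum>m\<in>{max i j..n}. e m) * x i * x j)
      = (\<Sum>i\<le>n. \<Sum>j\<le>n. \<Sum>m\<le>n. e m * (y m i * y m j))" by simp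
  also have "\<dots> = (\<Sum>i\<le>n. \<Sum>m\<le>n. \<Sum>j\<le>n. e m * (y m i * y m j))"
    by (intro sum.cong refl sum.swap)
  also have "\<dots> = (\<Sum>m\<le>n. \<Sum>i\<le>n. \<Sum>j\<le>n. e m * (y m i * y m j))" by (rule sum.swap)
  also have "\<dots> = (\<Sum>m\<le>n. e m * (\<Sum>i\<le>m. x i)\<^sup>2)"
  proof (intro sum.cong refl)
    fix m assume "m \<in> {..n}"
    then have "(\<Sum>i\<le>n. y m i) = (\<Sum>i\<le>m. x i)"
      by (intro sum.mono_neutral_cong_right) (auto simp: y_def)
    moreover have "(\<Sum>i\<le>n. \<Sum>j\<le>n. e m * (y m i * y m j)) = e m * ((\<Sum>i\<le>n. y m i) * (\<Sum>j\<le>n. y m j))"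
      by (subst sum_product) (simp add: sum_distrib_left)
    ultimately show "(\<Sum>i\<le>n. \<Sum>j\<le>n. e m * (y m i * y m j)) = e m * (\<Sum>i\<le>m. x i)\<^sup>2"
      by (simp add: power2_eq_square)
  qed
  finally show ?thesis .
qed

lemma sum_power_le_geometric:
  fixes q :: real
  assumes "0 \<le> q" "q < 1" "inj_on f A" "finite A"
  shows "(\<Sum>j\<in>A. q ^ f j) \<le> 1 / (1 - q)"
proof -
  have "(\<Sum>j\<in>A. q ^ f j) = (\<Sum>n\<in>f ` A. q ^ n)"
    using assms by (simp add: sum.reindex)
  also have "\<dots> \<le> (\<Sum>n. q ^ n)"
    using assms by (intro sum_le_suminf summable_geometric) auto
  also have "\<dots> = 1 / (1 - q)" using assms by (simp add: suminf_geometric)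
  finally show ?thesis .
qed

context flip_pattern
begin

text \<open>On either side of the diagonal the exponents are distinct naturals, and
  \<open>23/54 * (1 / (1 - 4/27)) = 1/2\<close>.\<close>

lemma cc_row_sum: "(\<Sum>j\<le>k. cc i j) \<le> 1"
proof -
  have half: "(\<Sum>j\<in>J. cc i j) \<le> 1/2"
    if J: "finite J" "\<And>j. j \<in> J \<Longrightarrow> even (i + j)"
      "inj_on (\<lambda>j. (max i j - min i j) div 2 - 1) J" for J
  proof -
    have "(\<Sum>j\<in>J. cc i j) \<le> (\<Sum>j\<in>J. 23/54 * (4/27) ^ ((max i j - min i j) div 2 - 1))"
      by (intro sum_mono) (auto simp: cc_def)
    also have "\<dots> = 23/54 * (\<Sum>j\<in>J. (4/27) ^ ((max i j - min i j) div 2 - 1))"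
      by (simp add: sum_distrib_left)
    also have "\<dots> \<le> 23/54 * (1 / (1 - 4/27))"
      using J by (intro mult_left_mono sum_power_le_geometric) auto
    finally show ?thesis by simp
  qed
  define L where "L = {j. j < i \<and> j \<le> k \<and> even (i + j)}"
  define U where "U = {j. i < j \<and> j \<le> k \<and> even (i + j)}"
  have injL: "inj_on (\<lambda>j. (max i j - min i j) div 2 - 1) L"
  proof (rule inj_onI)
    fix x y assume "x \<in> L" "y \<in> L" and eq: "(max i x - min i x) div 2 - 1 = (max i y - min i y) div 2 - 1"
    then have *: "x < i" "y < i" "even (i - x)" "even (i - y)" by (auto simp: L_def)
    obtain p where "i - x = 2 * p" using *(3) by (elim evenE)
    moreover obtain p' where "i - y = 2 * p'" using *(4) by (elim evenE)
    moreover have "p - 1 = p' - 1" using * eq calculation by (simp add: max_def min_def)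
    ultimately show "x = y" using * by linarith
  qed
  have injU: "inj_on (\<lambda>j. (max i j - min i j) div 2 - 1) U"
  proof (rule inj_onI)
    fix x y assume "x \<in> U" "y \<in> U" and eq: "(max i x - min i x) div 2 - 1 = (max i y - min i y) div 2 - 1"
    then have *: "i < x" "i < y" "even (x - i)" "even (y - i)" by (auto simp: U_def)
    obtain p where "x - i = 2 * p" using *(3) by (elim evenE)
    moreover obtain p' where "y - i = 2 * p'" using *(4) by (elim evenE)
    moreover have "p - 1 = p' - 1" using * eq calculation by (simp add: max_def min_def)
    ultimately show "x = y" using * by linarith
  qed
  have fin: "finite L" "finite U" by (auto simp: L_def U_def)
  have "(\<Sum>j\<in>L. cc i j) \<le> 1/2" using fin injL by (intro half) (auto simp: L_def)
  moreover have "(\<Sum>j\<in>U. cc i j) \<le> 1/2" using fin injU by (intro half) (auto simp: U_def)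
  moreover have "(\<Sum>j\<le>k. cc i j) = (\<Sum>j\<in>L \<union> U. cc i j)"
    by (rule sum.mono_neutral_right) (auto simp: L_def U_def cc_def)
  moreover have "\<dots> = (\<Sum>j\<in>L. cc i j) + (\<Sum>j\<in>U. cc i j)"
    using fin by (intro sum.union_disjoint) (auto simp: L_def U_def)
  ultimately show ?thesis by linarith
qed

lemma H_term_le:
  assumes "i \<le> k" "j \<le> k"
  shows "H i j * x i * x j \<le> cc i j / 2 * ((x i)\<^sup>2 / D i) + cc i j / 2 * ((x j)\<^sup>2 / D j)"
proof -
  define A where "A = cc i j * ((x i)\<^sup>2 / D i)"
  define B where "B = cc i j * ((x j)\<^sup>2 / D j)"
  have AB: "0 \<le> A" "0 \<le> B" using cc_nonneg D_pos assms by (auto simp: A_def B_def less_imp_le)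
  define ui uj where "ui = (x i)\<^sup>2 / D i" and "uj = (x j)\<^sup>2 / D j"
  have u: "(x i)\<^sup>2 = D i * ui" "(x j)\<^sup>2 = D j * uj" "0 \<le> ui" "0 \<le> uj"
    using D_pos[OF assms(1)] D_pos[OF assms(2)] by (auto simp: ui_def uj_def)
  have AB': "A = cc i j * ui" "B = cc i j * uj" by (auto simp: A_def B_def ui_def uj_def)
  have "(2 * (H i j * x i * x j))\<^sup>2 = 4 * (H i j)\<^sup>2 * (x i)\<^sup>2 * (x j)\<^sup>2"
    by (simp add: power_mult_distrib)
  also have "\<dots> = 4 * ((H i j)\<^sup>2 * D i * D j) * (ui * uj)" unfolding u(1,2) by algebra
  also have "\<dots> \<le> 4 * (cc i j)\<^sup>2 * (ui * uj)"
    using H_D_le[OF assms] u by (intro mult_right_mono) auto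
  also have "\<dots> = 4 * A * B" unfolding AB' by algebra
  also have "\<dots> \<le> (A + B)\<^sup>2"
    using sum_squares_bound[of A B] by (simp add: power2_sum)
  finally have "(2 * (H i j * x i * x j))\<^sup>2 \<le> (A + B)\<^sup>2" .
  then have "2 * (H i j * x i * x j) \<le> A + B"
    by (rule power2_le_imp_le) (simp add: AB)
  then show ?thesis by (simp add: A_def B_def)
qed

text \<open>A Schur test: each product is split by the arithmetic-geometric inequality, and the row
  sums of \<open>cc\<close> are at most 1.\<close>

lemma H_form_le: "(\<Sum>i\<le>k. \<Sum>j\<le>k. H i j * x i * x j) \<le> (\<Sum>i\<le>k. (x i)\<^sup>2 / D i)"
proof -
  define y where "y i = (x i)\<^sup>2 / D i" for i
  have y: "0 \<le> y i" if "i \<le> k" for i using D_pos[OF that] by (simp add: y_def)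
  have "(\<Sum>i\<le>k. \<Sum>j\<le>k. H i j * x i * x j) \<le> (\<Sum>i\<le>k. \<Sum>j\<le>k. cc i j / 2 * y i + cc i j / 2 * y j)"
    unfolding y_def by (intro sum_mono H_term_le) auto
  also have "\<dots> = (\<Sum>i\<le>k. \<Sum>j\<le>k. cc i j / 2 * y i) + (\<Sum>i\<le>k. \<Sum>j\<le>k. cc i j / 2 * y j)"
    by (simp add: sum.distrib)
  also have "(\<Sum>i\<le>k. \<Sum>j\<le>k. cc i j / 2 * y j) = (\<Sum>j\<le>k. \<Sum>i\<le>k. cc i j / 2 * y j)"
    by (rule sum.swap)
  also have "\<dots> = (\<Sum>i\<le>k. \<Sum>j\<le>k. cc i j / 2 * y i)" by (simp add: cc_sym)
  also have "(\<Sum>i\<le>k. \<Sum>j\<le>k. cc i j / 2 * y i) + (\<Sum>i\<le>k. \<Sum>j\<le>k. cc i j / 2 * y i)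
      = (\<Sum>i\<le>k. (\<Sum>j\<le>k. cc i j) * y i)"
    unfolding sum.distrib[symmetric] sum_distrib_right by (intro sum.cong refl) simp
  also have "\<dots> \<le> (\<Sum>i\<le>k. 1 * y i)"
    using cc_row_sum y by (intro sum_mono mult_right_mono) auto
  finally show ?thesis by (simp add: y_def)
qed

lemma E_eq_sum_eps: "i \<le> k \<Longrightarrow> (\<Sum>m\<in>{i..k}. eps m) = E i"
proof (induction i rule: inc_induct)
  case (step n)
  then show ?case by (simp add: sum.atLeast_Suc_atMost eps_def)
qed (simp add: eps_def)

text \<open>Each \<open>x m\<close> is a difference of consecutive partial sums; by Cauchy-Schwarz
  the term \<open>y m\<close> is charged with share 5/8 at \<open>m\<close> and 3/8 at
  \<open>Suc m\<close>.\<close>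

lemma D_form_le: "(\<Sum>i\<le>k. (x i)\<^sup>2 / D i) \<le> (\<Sum>m\<le>k. eps m * (\<Sum>i\<le>m. x i)\<^sup>2)"
proof -
  define S where "S m = (\<Sum>i\<le>m. x i)" for m
  define y where "y m = eps m * (S m)\<^sup>2" for m
  define y' where "y' m = (if m = 0 then 0 else y (m - 1))" for m
  have y: "0 \<le> y m" if "m \<le> k" for m using eps_pos[OF that] by (simp add: y_def)
  have "(x m)\<^sup>2 / D m \<le> 5/8 * y m + 3/8 * y' m" if m: "m \<le> k" for m
  proof (cases m)
    case 0
    then show ?thesis using eps_pos[of 0] by (simp add: D_def y_def y'_def S_def)
  next
    case (Suc n)
    have e: "0 < eps m" "0 < eps n" using eps_pos m Suc by auto
    have "x m = S m - S n" by (simp add: S_def Suc)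
    then have "(x m)\<^sup>2 / D m = (S m - S n)\<^sup>2 / ((8/5) / eps m + (8/3) / eps n)"
      by (simp add: D_def Suc)
    also have "\<dots> \<le> (S m)\<^sup>2 / ((8/5) / eps m) + (S n)\<^sup>2 / ((8/3) / eps n)"
      using e by (intro power2_diff_le_weighted) auto
    also have "\<dots> = 5/8 * y m + 3/8 * y' m" by (simp add: y_def y'_def Suc mult_ac)
    finally show ?thesis .
  qed
  then have "(\<Sum>m\<le>k. (x m)\<^sup>2 / D m) \<le> (\<Sum>m\<le>k. 5/8 * y m + 3/8 * y' m)"
    by (intro sum_mono) auto
  also have "\<dots> = 5/8 * (\<Sum>m\<le>k. y m) + 3/8 * (\<Sum>m\<le>k. y' m)"
    by (simp add: sum.distrib sum_distrib_left)
  also have "(\<Sum>m\<le>k. y' m) \<le> (\<Sum>m\<le>k. y m)"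
  proof -
    have "(\<Sum>m\<le>k. y' m) = (\<Sum>m<k. y m)"
      by (simp add: sum.atMost_shift y'_def)
    also have "\<dots> \<le> (\<Sum>m\<le>k. y m)" using y by (intro sum_mono2) auto
    finally show ?thesis .
  qed
  finally show ?thesis by (simp add: y_def S_def)
qed

lemma C_psd: "0 \<le> (\<Sum>i<Suc k. \<Sum>j<Suc k. C i j * x i * x j)"
proof -
  have "(\<Sum>i\<le>k. \<Sum>j\<le>k. E (max i j) * x i * x j) = (\<Sum>m\<le>k. eps m * (\<Sum>i\<le>m. x i)\<^sup>2)"
    unfolding sum_max_kernel[symmetric] by (intro sum.cong refl) (simp add: E_eq_sum_eps)
  then have "(\<Sum>i\<le>k. \<Sum>j\<le>k. H i j * x i * x j) \<le> (\<Sum>i\<le>k. \<Sum>j\<le>k. E (max i j) * x i * x j)"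
    using H_form_le[of x] D_form_le[of x] by linarith
  then show ?thesis
    by (simp add: lessThan_Suc_atMost C_def left_diff_distrib sum_subtractf)
qed

lemma C_self: "C j j = E j" by (simp add: C_def H_def)

lemma C_odd: "odd (i + j) \<Longrightarrow> C i j = E (max i j)" by (simp add: C_def H_def)

lemma C_even: "i < j \<Longrightarrow> even (i + j) \<Longrightarrow> C i j = E j - h i j * E j"
  by (simp add: C_def H_def)

lemma C_nonneg: "i < j \<Longrightarrow> j \<le> k \<Longrightarrow> 0 \<le> C i j"
  using h_bounds(3)[of i j] E_pos[of j]
  by (cases "even (i + j)") (auto simp: C_even C_odd less_imp_le mult_le_cancel_right1)

text \<open>
  Two consecutive terms of the alternating sum that gives the height of the piece \<open>j\<close> at later
  flips have the right sign.
\<close>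

lemma pair_descent:
  assumes "j < l" "even (j + l)" "l < k"
  shows "(R (Suc l) + R (Suc (Suc l))) * E (Suc l) \<le> (R l + R (Suc l)) * C j l"
proof -
  define t where "t = (v l + max (s l) (27/49)) / (v l + s l)"
  define u where "u = h j l"
  have pos: "0 < v l" "0 < s l" "0 < \<rho> (Suc l)" "0 < \<rho> l" "0 < R (Suc (Suc l))" "0 < E (Suc l)"
    using v_pos s_pos \<rho>_pos R_pos E_pos assms by auto
  have u: "0 \<le> u" "u \<le> 1" "u \<le> (27/49) / (27/49 + v l)"
    using h_bounds[of j l] assms by (auto simp: u_def)
  have "(1 + 1 / \<rho> (Suc l)) * t \<le> (1 + max (1 / \<rho> (Suc l)) (1/2)) * t"
    using pos by (intro mult_right_mono) (auto simp: t_def)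
  then have b: "(1 + 1 / \<rho> (Suc l)) * t \<le> b l" using b_ge(2)[OF assms(3)] by (simp add: t_def)
  \<comment> \<open>The inflation \<open>t\<close> raises \<open>(1 + \<rho> l) * t\<close> to at
    least \<open>(v l + 27/49) / v l\<close>, exactly the inverse of the lower bound for
    \<open>1 - u\<close>.\<close>
  have "1 \<le> (1 + \<rho> l) * t * (1 - u)"
  proof -
    have "(1 + \<rho> l) * t = (v l + max (s l) (27/49)) / v l"
    proof -
      have "1 + \<rho> l = (v l + s l) / v l" using pos by (simp add: \<rho>_def add_divide_distrib)
      then show ?thesis using pos by (simp add: t_def)
    qed
    also have "\<dots> \<ge> (v l + 27/49) / v l" using pos by (intro divide_right_mono) auto
    finally have "(v l + 27/49) / v l * (v l / (27/49 + v l)) \<le> (1 + \<rho> l) * t * (1 - u)"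
    proof (rule mult_mono)
      have "v l / (27/49 + v l) = 1 - (27/49) / (27/49 + v l)" using pos by (simp add: field_simps)
      then show "v l / (27/49 + v l) \<le> 1 - u" using u by simp
    qed (use pos in \<open>auto simp: t_def intro!: mult_nonneg_nonneg\<close>)
    moreover have "(v l + 27/49) / v l * (v l / (27/49 + v l)) = 1" using pos by (simp add: add.commute)
    ultimately show ?thesis by simp
  qed
  then have "(1 + 1 / \<rho> (Suc l)) * 1 \<le> (1 + 1 / \<rho> (Suc l)) * ((1 + \<rho> l) * t * (1 - u))"
    using pos by (intro mult_left_mono) auto
  also have "\<dots> = ((1 + 1 / \<rho> (Suc l)) * t) * ((1 + \<rho> l) * (1 - u))" by (simp add: mult_ac)
  also have "\<dots> \<le> b l * ((1 + \<rho> l) * (1 - u))"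
    using b pos u by (intro mult_right_mono) auto
  finally have key: "1 + 1 / \<rho> (Suc l) \<le> b l * ((1 + \<rho> l) * (1 - u))" by simp
  have R: "R (Suc l) = \<rho> (Suc l) * R (Suc (Suc l))" "R l = \<rho> l * R (Suc l)"
    using R_step assms by auto
  have "(R (Suc l) + R (Suc (Suc l))) * E (Suc l) = (R (Suc l) * E (Suc l)) * (1 + 1 / \<rho> (Suc l))"
    using pos R(1) by (simp add: field_simps)
  also have "\<dots> \<le> (R (Suc l) * E (Suc l)) * (b l * ((1 + \<rho> l) * (1 - u)))"
    using key pos R_pos by (intro mult_left_mono) (auto intro: less_imp_le)
  also have "\<dots> = (R l + R (Suc l)) * C j l"
    using assms by (simp add: C_even E_step R(2) u_def algebra_simps)
  finally show ?thesis .
qed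


text \<open>Along the path, \<open>- (a j * T j l)\<close> is the change in the height of piece
  \<open>j\<close> from \<open>z l\<close> to \<open>z (Suc l)\<close>. After its own segment a
  piece drops by an alternating sum, bounded by \<open>fwd\<close>; before it, only \<open>H\<close>
  changes its height.\<close>

lemma vectors_exist:
  obtains p z where "\<And>i. i \<le> k \<Longrightarrow> p i \<in> Rd (Suc k)" "\<And>i. i \<le> k \<Longrightarrow> p i \<noteq> 0" "z 0 = 0"
    "\<And>i. i < k \<Longrightarrow> z (Suc i) = z i - v i *\<^sub>R p i - s (Suc i) *\<^sub>R p (Suc i)"
    "\<And>i j. i \<le> k \<Longrightarrow> j \<le> k \<Longrightarrow> p j \<bullet> (z i - z j) \<le> 0"
    "\<And>i j. i \<le> k \<Longrightarrow> j \<le> k \<Longrightarrow> p j \<bullet> (z i + s i *\<^sub>R p i - z j) \<le> s i * (p i \<bullet> p i)"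
    "(s 0)\<^sup>2 * (p 0 \<bullet> p 0) = (R 0)\<^sup>2 * E 0" "(s k)\<^sup>2 * (p k \<bullet> p k) = 1"
proof -
  obtain Y :: "nat \<Rightarrow> fin_seq" where Yd: "\<And>i. i \<le> k \<Longrightarrow> Y i \<in> Rd (Suc k)"
    and YC: "\<And>i j. i \<le> k \<Longrightarrow> j \<le> k \<Longrightarrow> Y i \<bullet> Y j = C i j"
    using psd_kernel_realizable[of C "Suc k", OF C_sym C_psd] by (auto simp: less_Suc_eq_le)
  define sg where "sg i = (- 1 :: real) ^ i" for i :: nat
  have sg2: "sg i * sg i = 1" for i by (simp add: sg_def flip: power_mult_distrib)
  have sg_mult: "sg i * sg j = (if even (i + j) then 1 else - 1)" for i j
    by (simp add: sg_def flip: power_add)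
  define p where "p i = (sg i * a i) *\<^sub>R Y i" for i
  define z where "z i = - (\<Sum>l<i. v l *\<^sub>R p l + s (Suc l) *\<^sub>R p (Suc l))" for i
  have pp: "p i \<bullet> p j = (sg i * sg j) * (a i * a j * C i j)" if "i \<le> k" "j \<le> k" for i j
    using that by (simp add: p_def YC mult_ac)
  have pself: "p i \<bullet> p i = (a i)\<^sup>2 * E i" if "i \<le> k" for i
    using that by (simp add: pp sg2 C_self power2_eq_square)
  have pd: "v l * (p j \<bullet> p l) + s (Suc l) * (p j \<bullet> p (Suc l))
      = a j * ((if even (j + l) then 1 else - 1) * (R (Suc l) * (C j l - C j (Suc l))))"
    if "j \<le> k" "l < k" for j l
  proof -
    have "v l * (p j \<bullet> p l) + s (Suc l) * (p j \<bullet> p (Suc l))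
        = (sg j * sg l) * (a j * (a l * v l * C j l)) + (sg j * sg (Suc l)) * (a j * (a (Suc l) * s (Suc l) * C j (Suc l)))"
      using that by (simp add: pp mult_ac)
    also have "\<dots> = a j * ((sg j * sg l) * (R (Suc l) * (C j l - C j (Suc l))))"
      using that a_v[of l] a_s[of "Suc l"] by (simp add: sg_def algebra_simps)
    finally show ?thesis by (simp add: sg_mult)
  qed
  define T where "T j l = (if even (j + l) then 1 else - 1) * (R (Suc l) * (C j l - C j (Suc l)))" for j l
  have zdiff: "p j \<bullet> (z m - z i) = - (a j * (\<Sum>l\<in>{i..<m}. T j l))"
    if "i \<le> m" "m \<le> k" "j \<le> k" for i j m
  proof -
    have "{..<m} = {..<i} \<union> {i..<m}" using that by auto
    then have "z m - z i = - (\<Sum>l\<in>{i..<m}. v l *\<^sub>R p l + s (Suc l) *\<^sub>R p (Suc l))"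
      unfolding z_def by (simp add: sum.union_disjoint ivl_disj_int)
    then have "p j \<bullet> (z m - z i) = - (\<Sum>l\<in>{i..<m}. v l * (p j \<bullet> p l) + s (Suc l) * (p j \<bullet> p (Suc l)))"
      by (simp add: inner_sum_right inner_add_right)
    also have "(\<Sum>l\<in>{i..<m}. v l * (p j \<bullet> p l) + s (Suc l) * (p j \<bullet> p (Suc l))) = (\<Sum>l\<in>{i..<m}. a j * T j l)"
      using that by (intro sum.cong refl) (simp add: pd T_def)
    finally show ?thesis by (simp add: sum_distrib_left)
  qed
  \<comment> \<open>The even bound is the room that \<open>C2\<close> needs: a piece of the same
    sign gains \<open>a j * (R i * C j i)\<close> at the start of segment \<open>i\<close>. The odd
    bound carries the induction; its base case is where \<open>1 + 1 / \<rho> (Suc j)\<close> is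
    forced.\<close>
  have fwd: "(odd n \<longrightarrow> R (Suc (j + n)) * E (j + n) \<le> (\<Sum>l\<in>{j..<j + n}. T j l)) \<and>
      (even n \<longrightarrow> R (j + n) * C j (j + n) \<le> (\<Sum>l\<in>{j..<j + n}. T j l))"
    if "0 < n" "j + n \<le> k" for j n
    using that
  proof (induction n)
    case (Suc n)
    define m where "m = j + n"
    have m: "m < k" using Suc.prems by (simp add: m_def)
    have sum: "(\<Sum>l\<in>{j..<j + Suc n}. T j l) = (\<Sum>l\<in>{j..<m}. T j l) + T j m"
      by (simp add: m_def)
    consider "n = 0" | "odd n" | "even n" "0 < n" by auto
    then show ?case
    proof cases
      case 1
      have "R (Suc (Suc j)) * E (Suc j) \<le> R (Suc j) * (E j - E (Suc j))"
      proof -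
        have "E (Suc j) * (1 / \<rho> (Suc j)) \<le> E (Suc j) * (b j - 1)"
          using b_ge(3)[of j] m E_pos[of "Suc j"] 1 by (intro mult_left_mono) (auto simp: m_def)
        then have "R (Suc j) * (E (Suc j) * (1 / \<rho> (Suc j))) \<le> R (Suc j) * (E (Suc j) * (b j - 1))"
          by (rule mult_left_mono) (simp add: less_imp_le[OF R_pos])
        moreover have "R (Suc j) * (E (Suc j) * (1 / \<rho> (Suc j))) = R (Suc (Suc j)) * E (Suc j)"
          using 1 m R_step[of "Suc j"] \<rho>_pos[of "Suc j"] by (simp add: m_def)
        moreover have "E (Suc j) * (b j - 1) = E j - E (Suc j)"
          using 1 m E_step[of j] by (simp add: m_def algebra_simps)
        ultimately show ?thesis by simp
      qed
      then show ?thesis using 1 by (simp add: T_def C_self C_odd)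
    next
      case 2
      then have IH: "R (Suc m) * E m \<le> (\<Sum>l\<in>{j..<m}. T j l)"
        using Suc by (cases n) (auto simp: m_def)
      have "T j m = - (R (Suc m) * (E m - C j (Suc m)))"
        using 2 by (simp add: T_def m_def C_odd)
      then show ?thesis using 2 IH unfolding sum by (simp add: m_def algebra_simps)
    next
      case 3
      then have IH: "R m * C j m \<le> (\<Sum>l\<in>{j..<m}. T j l)"
        using Suc by (auto simp: m_def)
      have "T j m = R (Suc m) * (C j m - E (Suc m))"
        using 3 by (simp add: T_def m_def C_odd)
      moreover have "(R (Suc m) + R (Suc (Suc m))) * E (Suc m) \<le> (R m + R (Suc m)) * C j m"
        using 3 m by (intro pair_descent) (auto simp: m_def)
      ultimately show ?thesis using 3 IH unfolding sum by (simp add: m_def algebra_simps)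
    qed
  qed simp
  \<comment> \<open>For \<open>l < j\<close> both maxima in the difference of covariances are
    \<open>j\<close>, so only the correction remains.\<close>
  have bwd_term: "0 \<le> - T j l" if "l < j" "j \<le> k" for j l
  proof (cases "even (j + l)")
    case True
    then have "Suc l < j" using that by (cases "j = Suc l") auto
    then have "T j l = - (R (Suc l) * H l j)"
      using True that by (simp add: T_def C_def H_def max_def algebra_simps add.commute)
    then show ?thesis using R_pos[of "Suc l"] H_nonneg[of l j] that by simp
  next
    case False
    have "C j l - C j (Suc l) = H (Suc l) j"
    proof -
      have "max j l = j" "max j (Suc l) = j" using that by auto
      moreover have "H j l = 0" using False by (simp add: H_def)
      ultimately show ?thesis by (simp add: C_def H_sym[of j])
    qed
    then have "T j l = - (R (Suc l) * H (Suc l) j)" using False by (simp add: T_def)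
    then show ?thesis using R_pos[of "Suc l"] H_nonneg[of "Suc l" j] that by simp
  qed
  have bwd: "H i j * R (Suc i) \<le> - (\<Sum>l\<in>{i..<j}. T j l)" "0 \<le> - (\<Sum>l\<in>{i..<j}. T j l)"
    if "i < j" "j \<le> k" for i j
  proof -
    have rest: "0 \<le> (\<Sum>l\<in>{Suc i..<j}. - T j l)" using bwd_term that by (intro sum_nonneg) auto
    have split: "- (\<Sum>l\<in>{i..<j}. T j l) = - T j i + (\<Sum>l\<in>{Suc i..<j}. - T j l)"
      using that by (simp add: sum.atLeast_Suc_lessThan sum_negf)
    show "0 \<le> - (\<Sum>l\<in>{i..<j}. T j l)" using rest split bwd_term[of i j] that by simp
    show "H i j * R (Suc i) \<le> - (\<Sum>l\<in>{i..<j}. T j l)"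
    proof (cases "even (j + i)")
      case True
      then have "Suc i < j" using that by (cases "j = Suc i") auto
      then have "T j i = - (R (Suc i) * H i j)"
        using True that by (simp add: T_def C_def H_def max_def algebra_simps add.commute)
      then show ?thesis using rest split by (simp add: mult.commute)
    next
      case False
      then show ?thesis using rest split bwd_term[of i j] that by (simp add: H_def add.commute)
    qed
  qed
  have zback: "p j \<bullet> (z i - z j) = a j * (\<Sum>l\<in>{i..<j}. T j l)" if "i \<le> j" "j \<le> k" for i j
  proof -
    have "p j \<bullet> (z i - z j) = - (p j \<bullet> (z j - z i))" by (simp add: inner_diff_right)
    then show ?thesis using zdiff[OF that, of j] that by simp
  qed
  have S_nonneg: "0 \<le> (\<Sum>l\<in>{j..<i}. T j l)" if "j < i" "i \<le> k" for i j
  proof (cases "even (i - j)")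
    case True
    then have "R i * C j i \<le> (\<Sum>l\<in>{j..<i}. T j l)" using fwd[of "i - j" j] that by simp
    moreover have "0 \<le> R i * C j i"
      using less_imp_le[OF R_pos[of i]] C_nonneg[OF that] by (rule mult_nonneg_nonneg)
    ultimately show ?thesis by linarith
  next
    case False
    then have "R (Suc i) * E i \<le> (\<Sum>l\<in>{j..<i}. T j l)" using fwd[of "i - j" j] that by simp
    moreover have "0 \<le> R (Suc i) * E i"
      using less_imp_le[OF R_pos] less_imp_le[OF E_pos] by (rule mult_nonneg_nonneg)
    ultimately show ?thesis by linarith
  qed
  have C1: "p j \<bullet> (z i - z j) \<le> 0" if "i \<le> k" "j \<le> k" for i j
  proof -
    consider "j < i" | "i = j" | "i < j" by linarith
    then show ?thesis
    proof cases
      case 1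
      then show ?thesis using zdiff[of j i j] S_nonneg[of j i] a_pos[of j] that by simp
    next
      case 3
      then show ?thesis using zback[of i j] bwd(2)[of i j] a_pos[of j] that
        by (simp add: mult_nonneg_nonpos)
    qed simp
  qed
  have C2: "p j \<bullet> (z i + s i *\<^sub>R p i - z j) \<le> s i * (p i \<bullet> p i)" if ij: "i \<le> k" "j \<le> k" for i j
  proof -
    have spl: "p j \<bullet> (z i + s i *\<^sub>R p i - z j) = p j \<bullet> (z i - z j) + s i * (p j \<bullet> p i)"
      by (simp add: inner_add_right inner_diff_right algebra_simps)
    have rhs: "s i * (p i \<bullet> p i) = R i * (a i * E i)"
      using a_s[of i] ij by (simp add: pself power2_eq_square mult_ac)
    have rhs0: "0 \<le> s i * (p i \<bullet> p i)" using s_pos[of i] ij by simp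
    consider "i = j" | "odd (i + j)" | "j < i" "even (i + j)" | "i < j" "even (i + j)" by linarith
    then show ?thesis
    proof cases
      case 2
      have "C j i = E (max j i)" using 2 by (intro C_odd) (simp add: add.commute)
      then have "p j \<bullet> p i \<le> 0"
        using 2 ij a_pos[of i] a_pos[of j] E_pos[of "max j i"]
        by (simp add: pp sg_mult add.commute less_imp_le)
      then have "s i * (p j \<bullet> p i) \<le> 0" using s_pos[of i] ij by (intro mult_nonneg_nonpos) auto
      then show ?thesis using C1[OF ij] spl rhs0 by linarith
    next
      case 3
      have "s i * (p j \<bullet> p i) = a j * (R i * C j i)"
        using 3 ij a_s[of i] by (simp add: pp sg_mult add.commute mult_ac)
      moreover have "p j \<bullet> (z i - z j) \<le> - (a j * (R i * C j i))"
        using zdiff[of j i j] fwd[of "i - j" j] 3 ij a_pos[of j] by (simp add: mult_left_mono)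
      ultimately show ?thesis using spl rhs0 by linarith
    next
      case 4
      \<comment> \<open>A later piece of the same sign: \<open>H\<close> lowers both its height at
        \<open>z i\<close> and its gain along segment \<open>i\<close>. Together they remove
        \<open>h i j * (1 + 1 / \<rho> i)\<close> of it, as the definition of \<open>h\<close>
        requires.\<close>
      have ik: "i < k" using 4 ij by simp
      have r: "0 < \<rho> i" using \<rho>_pos ij by simp
      have Hij: "H i j = h i j * E j" using 4 by (simp add: H_def)
      have ae: "a j * E j \<noteq> 0" using a_pos[of j] E_pos[of j] ij by simp
      have "s i * (p j \<bullet> p i) = a j * (R i * (E j - H i j))"
        using 4 ij a_s[of i] C_sym[of j i]
        by (simp add: pp sg_mult add.commute mult_ac C_even Hij)
      moreover have "p j \<bullet> (z i - z j) \<le> - (a j * (H i j * R (Suc i)))"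
        using zback[of i j] bwd(1)[of i j] 4 ij a_pos[of j]
          mult_left_mono[of "H i j * R (Suc i)" "- (\<Sum>l\<in>{i..<j}. T j l)" "a j"] by simp
      moreover have "a j * (R i * (E j - H i j)) - a j * (H i j * R (Suc i)) \<le> R i * (a i * E i)"
      proof -
        have "h i j * (1 + 1 / \<rho> i) = max 0 (1 - g i j)"
        proof -
          have "\<rho> i / (1 + \<rho> i) * (1 + 1 / \<rho> i) = 1" 
          proof -
            have "1 + 1 / \<rho> i = (1 + \<rho> i) / \<rho> i" using r by (simp add: add_divide_distrib add.commute)
            then show ?thesis using r by simp
          qed
          moreover have "h i j * (1 + 1 / \<rho> i) = (\<rho> i / (1 + \<rho> i) * (1 + 1 / \<rho> i)) * max 0 (1 - g i j)"
            by (simp only: h_def mult_ac)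
          ultimately show ?thesis by (simp only: mult_1_left)
        qed
        then have "1 - h i j * (1 + 1 / \<rho> i) \<le> g i j" by simp
        then have "R i * (a j * E j * (1 - h i j * (1 + 1 / \<rho> i))) \<le> R i * (a j * E j * g i j)"
          using R_pos[of i] a_pos[of j] E_pos[of j] ij by (intro mult_left_mono) auto
        also have "a j * E j * g i j = a i * E i" using ae by (simp add: g_def)
        also have "R i * (a j * E j * (1 - h i j * (1 + 1 / \<rho> i)))
            = a j * (R i * (E j - H i j)) - a j * (H i j * (R i / \<rho> i))"
          by (simp add: Hij algebra_simps)
        also have "R i / \<rho> i = R (Suc i)" using R_step[of i] ij r by simp
        finally show ?thesis .
      qed
      ultimately show ?thesis using spl rhs by linarith
    qed simp
  qed
  have n1: "(s 0)\<^sup>2 * (p 0 \<bullet> p 0) = (R 0)\<^sup>2 * E 0"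
    using a_s[of 0, symmetric] by (simp add: pself power_mult_distrib)
  have n2: "(s k)\<^sup>2 * (p k \<bullet> p k) = 1"
  proof -
    have "a k * s k = 1" using a_s[of k] by (simp add: R_def)
    then have "(a k * s k)\<^sup>2 = 1" by simp
    then show ?thesis by (simp add: pself E_last power_mult_distrib mult.commute)
  qed
  have n3: "p i \<in> Rd (Suc k)" if "i \<le> k" for i
    unfolding p_def using Yd[OF that] by (intro subspace_scale[OF subspace_Rd])
  have n4: "p i \<noteq> 0" if "i \<le> k" for i
    using pself[OF that] a_pos[OF that] E_pos[of i] by auto
  have n5: "z (Suc i) = z i - v i *\<^sub>R p i - s (Suc i) *\<^sub>R p (Suc i)" for i
    by (simp add: z_def)
  have n6: "z 0 = 0" by (simp add: z_def)
  show ?thesis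
    by (rule that[of p z]) (rule n1 n2 n3 n4 n5 n6 C1 C2 | assumption)+
qed

end

section \<open>The cost of a flip\<close>

text \<open>The even number of terms makes the remainder nonnegative for negative \<open>x\<close>
  as well, which is needed for logarithms of numbers below 1.\<close>

lemma exp_ge_taylor: "(\<Sum>m<12. x ^ m / fact m) \<le> exp (x :: real)"
proof -
  obtain t where "exp x = (\<Sum>m<12. x ^ m / fact m) + exp t / fact 12 * x ^ 12"
    using Maclaurin_exp_le[of x 12] by blast
  moreover have "0 \<le> exp t / fact 12 * x ^ 12" by (intro mult_nonneg_nonneg) auto
  ultimately show ?thesis by linarith
qed

lemma ln_le_by_taylor:
  fixes x y :: real
  assumes "0 < x" "x \<le> (\<Sum>m<12. y ^ m / fact m)"
  shows "ln x \<le> y"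
proof -
  have "x \<le> exp y" using assms exp_ge_taylor[of y] by linarith
  then have "ln x \<le> ln (exp y)" using assms by (subst ln_le_cancel_iff) auto
  then show ?thesis by simp
qed

text \<open>Equality holds at \<open>x = c\<close>. Bounding each factor of a product in this way,
  with \<open>c\<close> near its value at the maximizer, turns the product into a single
  exponential.\<close>

lemma le_exp_tangent: "0 < c \<Longrightarrow> x \<le> c * exp (x / c - 1)" for x c :: real
  using mult_left_mono[OF exp_ge_add_one_self[of "x / c - 1"], of c] by simp

text \<open>
  With the multiplier \<open>164/100\<close> for the total length, \<open>log_cost (1 / v) - ln v\<close> bounds the
  logarithm of the largest cost of a flip of excess \<open>v\<close>. The coefficients come from a numerical fit;
  the slack that remains in the end is the \<open>4/1000\<close> of \<open>\<Phi>_1\<close>.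
\<close>

definition log_cost :: "real \<Rightarrow> real" where "log_cost w = - 1479/1000 + 3/5 * w - 1/20 * w\<^sup>2"

text \<open>Convexity of the left-hand side against concavity of \<open>log_cost\<close>: the bound needs to be tested
  only at the ends of the interval.\<close>

lemma log_cost_ge_between:
  fixes \<kappa> c e w :: real
  assumes w: "wa \<le> w" "w \<le> wb" "wa < wb" and c: "0 \<le> c" "c * wb < 164/100" and \<kappa>: "0 < \<kappa>"
    and a: "ln (\<kappa> / (164/100 - c * wa) ^ m) + e \<le> log_cost wa"
    and b: "ln (\<kappa> / (164/100 - c * wb) ^ m) + e \<le> log_cost wb"
  shows "ln (\<kappa> / (164/100 - c * w) ^ m) + e \<le> log_cost w"
proof -
  define t where "t = (w - wa) / (wb - wa)"
  have t: "0 \<le> t" "t \<le> 1" using w by (auto simp: t_def)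
  have wt: "w = (1 - t) * wa + t * wb"
  proof -
    have "t * (wb - wa) = w - wa" using w by (simp add: t_def)
    then show ?thesis by (simp add: algebra_simps)
  qed
  define y where "y u = 164/100 - c * u" for u
  have y: "0 < y u" if "u \<le> wb" for u
  proof -
    have "c * u \<le> c * wb" using c that by (intro mult_left_mono) auto
    then show ?thesis using c by (simp add: y_def)
  qed
  have l: "ln (\<kappa> / y u ^ m) = ln \<kappa> - m * ln (y u)" if "u \<le> wb" for u
    using y[OF that] \<kappa> by (simp add: ln_div ln_realpow)
  have "ln (y u) - ln (y w) \<le> y u / y w - 1" if "u \<le> wb" for u
    using ln_le_minus_one[of "y u / y w"] y[OF that] y[OF w(2)] by (simp add: ln_div)
  then have "(1 - t) * (ln (y wa) - ln (y w)) + t * (ln (y wb) - ln (y w))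
      \<le> (1 - t) * (y wa / y w - 1) + t * (y wb / y w - 1)"
    using t w by (intro add_mono mult_left_mono) auto
  also have "\<dots> = ((1 - t) * y wa + t * y wb) / y w - 1"
    by (simp add: algebra_simps add_divide_distrib diff_divide_distrib)
  also have "(1 - t) * y wa + t * y wb = y w" unfolding y_def wt by algebra
  also have "y w / y w - 1 = 0" using y[OF w(2)] by simp
  finally have "(1 - t) * ln (y wa) + t * ln (y wb) \<le> ln (y w)" by (simp add: algebra_simps)
  then have "m * ((1 - t) * ln (y wa) + t * ln (y wb)) \<le> m * ln (y w)"
    by (intro mult_left_mono) auto
  moreover have "(1 - t) * (ln \<kappa> - m * ln (y wa) + e) + t * (ln \<kappa> - m * ln (y wb) + e)
      \<le> (1 - t) * log_cost wa + t * log_cost wb"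
    using a b t w unfolding y_def[symmetric] l[OF order_refl]
    by (intro add_mono mult_left_mono) (auto simp: l)
  moreover have "(1 - t) * log_cost wa + t * log_cost wb \<le> log_cost w"
  proof -
    have "0 \<le> 1/20 * (t * (1 - t) * (wa - wb)\<^sup>2)" using t by simp
    also have "\<dots> = log_cost w - ((1 - t) * log_cost wa + t * log_cost wb)" unfolding wt log_cost_def by algebra
    finally show ?thesis by simp
  qed
  ultimately show ?thesis
    unfolding y_def[symmetric] l[OF w(2)] by (simp add: algebra_simps)
qed

lemma exp_boundI:
  assumes "x \<le> \<kappa> * exp (l + e)" "0 < \<kappa>" "ln \<kappa> + e \<le> (g :: real)"
  shows "x \<le> exp (l + g)"
proof -
  have "\<kappa> * exp (l + e) = exp (l + (ln \<kappa> + e))" using assms(2) by (simp add: exp_add)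
  also have "\<dots> \<le> exp (l + g)" using assms(3) by simp
  finally show ?thesis using assms(1) by simp
qed

text \<open>The parameter \<open>t0\<close> is a guess for \<open>w * s\<close> at the maximizer.
  The tangent for \<open>1 + w * s\<close> uses up \<open>c * w\<close> of the multiplier 164/100,
  and the tangent for \<open>s\<close> uses the rest, \<open>y\<close>.\<close>

lemma linear_core_piece:
  fixes s w t0 :: real
  defines "c \<equiv> 1 / (1 + t0)"
  assumes s: "0 \<le> s" and w: "0 \<le> w" and t0: "0 < t0" and cw: "c * w < 164/100"
    and L: "ln ((1 + t0) / (164/100 - c * w) ^ 1) + (c - 2) \<le> log_cost w"
  shows "s * (1 + w * s) \<le> exp (164/100 * s + log_cost w)"
proof -
  define y where "y = 164/100 - c * w"
  have y: "0 < y" using cw by (simp add: y_def)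
  have c0: "0 < c" using t0 by (simp add: c_def)
  have "s \<le> 1 / y * exp (s * y - 1)" using le_exp_tangent[of "1 / y" s] y by simp
  moreover have "1 + w * s \<le> (1 + t0) * exp ((1 + w * s) * c - 1)"
    using le_exp_tangent[of "1 + t0" "1 + w * s"] t0 by (simp add: c_def)
  ultimately have "s * (1 + w * s) \<le> (1 / y * exp (s * y - 1)) * ((1 + t0) * exp ((1 + w * s) * c - 1))"
    using s w y by (intro mult_mono) auto
  also have "\<dots> = (1 + t0) / y * exp ((s * y - 1) + ((1 + w * s) * c - 1))"
    unfolding exp_add by simp
  also have "(s * y - 1) + ((1 + w * s) * c - 1) = 164/100 * s + (c - 2)"
    by (simp add: y_def algebra_simps)
  finally show ?thesis
    by (rule exp_boundI) (use y t0 L in \<open>auto simp: y_def\<close>)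
qed

text \<open>Four ranges of \<open>w\<close>, each with its own fitted \<open>t0\<close>; only the
  endpoints of the ranges need numerical logarithms.\<close>

lemma linear_core_le:
  fixes s w :: real
  assumes s: "0 \<le> s" and w: "0 \<le> w" "w \<le> 49/22"
  shows "s * (1 + w * s) \<le> exp (164/100 * s + log_cost w)"
proof -
  consider "w \<le> 45/100" | "45/100 \<le> w" "w \<le> 77/100" | "77/100 \<le> w" "w \<le> 12/10" | "12/10 \<le> w"
    by linarith
  then show ?thesis
  proof cases
    case 1
    show ?thesis
    proof (rule linear_core_piece[where ?t0.0 = "1/5", OF s w(1)])
      show "ln ((1 + 1/5) / (164/100 - 1 / (1 + 1/5) * w) ^ 1) + (1 / (1 + 1/5) - 2) \<le> log_cost w"
      proof (rule log_cost_ge_between[OF w(1) 1])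
        have "ln ((1 + 1/5) / (164/100 - 1 / (1 + 1/5) * 0) ^ 1 :: real) \<le> -31237/100000"
          by (rule ln_le_by_taylor) (simp_all add: eval_nat_numeral fact_numeral)
        moreover have "-31237/100000 \<le> log_cost 0 - (1 / (1 + 1/5) - 2)"
          by (simp add: log_cost_def power2_eq_square)
        ultimately show "ln ((1 + 1/5) / (164/100 - 1 / (1 + 1/5) * 0) ^ 1) + (1 / (1 + 1/5) - 2) \<le> log_cost 0" by simp
        have "ln ((1 + 1/5) / (164/100 - 1 / (1 + 1/5) * (45/100)) ^ 1 :: real) \<le> -527/10000"
          by (rule ln_le_by_taylor) (simp_all add: eval_nat_numeral fact_numeral)
        moreover have "-527/10000 \<le> log_cost (45/100) - (1 / (1 + 1/5) - 2)"
          by (simp add: log_cost_def power2_eq_square)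
        ultimately show "ln ((1 + 1/5) / (164/100 - 1 / (1 + 1/5) * (45/100)) ^ 1) + (1 / (1 + 1/5) - 2) \<le> log_cost (45/100)" by simp
      qed auto
    qed (use 1 in auto)
  next
    case 2
    show ?thesis
    proof (rule linear_core_piece[where ?t0.0 = "1/2", OF s w(1)])
      show "ln ((1 + 1/2) / (164/100 - 1 / (1 + 1/2) * w) ^ 1) + (1 / (1 + 1/2) - 2) \<le> log_cost w"
      proof (rule log_cost_ge_between[OF 2])
        have "ln ((1 + 1/2) / (164/100 - 1 / (1 + 1/2) * (45/100)) ^ 1 :: real) \<le> 113/1000"
          by (rule ln_le_by_taylor) (simp_all add: eval_nat_numeral fact_numeral)
        moreover have "113/1000 \<le> log_cost (45/100) - (1 / (1 + 1/2) - 2)"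
          by (simp add: log_cost_def power2_eq_square)
        ultimately show "ln ((1 + 1/2) / (164/100 - 1 / (1 + 1/2) * (45/100)) ^ 1) + (1 / (1 + 1/2) - 2) \<le> log_cost (45/100)" by simp
        have "ln ((1 + 1/2) / (164/100 - 1 / (1 + 1/2) * (77/100)) ^ 1 :: real) \<le> 2863/10000"
          by (rule ln_le_by_taylor) (simp_all add: eval_nat_numeral fact_numeral)
        moreover have "2863/10000 \<le> log_cost (77/100) - (1 / (1 + 1/2) - 2)"
          by (simp add: log_cost_def power2_eq_square)
        ultimately show "ln ((1 + 1/2) / (164/100 - 1 / (1 + 1/2) * (77/100)) ^ 1) + (1 / (1 + 1/2) - 2) \<le> log_cost (77/100)" by simp
      qed auto
    qed (use 2 in auto)
  next
    case 3
    show ?thesis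
    proof (rule linear_core_piece[where ?t0.0 = "33/40", OF s w(1)])
      show "ln ((1 + 33/40) / (164/100 - 1 / (1 + 33/40) * w) ^ 1) + (1 / (1 + 33/40) - 2) \<le> log_cost w"
      proof (rule log_cost_ge_between[OF 3])
        have "ln ((1 + 33/40) / (164/100 - 1 / (1 + 33/40) * (77/100)) ^ 1 :: real) \<le> 81/200"
          by (rule ln_le_by_taylor) (simp_all add: eval_nat_numeral fact_numeral)
        moreover have "81/200 \<le> log_cost (77/100) - (1 / (1 + 33/40) - 2)"
          by (simp add: log_cost_def power2_eq_square)
        ultimately show "ln ((1 + 33/40) / (164/100 - 1 / (1 + 33/40) * (77/100)) ^ 1) + (1 / (1 + 33/40) - 2) \<le> log_cost (77/100)" by simp
        have "ln ((1 + 33/40) / (164/100 - 1 / (1 + 33/40) * (12/10)) ^ 1 :: real) \<le> 31/50"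
          by (rule ln_le_by_taylor) (simp_all add: eval_nat_numeral fact_numeral)
        moreover have "31/50 \<le> log_cost (12/10) - (1 / (1 + 33/40) - 2)"
          by (simp add: log_cost_def power2_eq_square)
        ultimately show "ln ((1 + 33/40) / (164/100 - 1 / (1 + 33/40) * (12/10)) ^ 1) + (1 / (1 + 33/40) - 2) \<le> log_cost (12/10)" by simp
      qed auto
    qed (use 3 in auto)
  next
    case 4
    show ?thesis
    proof (rule linear_core_piece[where ?t0.0 = "3/2", OF s w(1)])
      show "ln ((1 + 3/2) / (164/100 - 1 / (1 + 3/2) * w) ^ 1) + (1 / (1 + 3/2) - 2) \<le> log_cost w"
      proof (rule log_cost_ge_between[OF 4 w(2)])
        have "ln ((1 + 3/2) / (164/100 - 1 / (1 + 3/2) * (12/10)) ^ 1 :: real) \<le> 96/125"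
          by (rule ln_le_by_taylor) (simp_all add: eval_nat_numeral fact_numeral)
        moreover have "96/125 \<le> log_cost (12/10) - (1 / (1 + 3/2) - 2)"
          by (simp add: log_cost_def power2_eq_square)
        ultimately show "ln ((1 + 3/2) / (164/100 - 1 / (1 + 3/2) * (12/10)) ^ 1) + (1 / (1 + 3/2) - 2) \<le> log_cost (12/10)" by simp
        have "ln ((1 + 3/2) / (164/100 - 1 / (1 + 3/2) * (49/22)) ^ 1 :: real) \<le> 603/500"
          by (rule ln_le_by_taylor) (simp_all add: eval_nat_numeral fact_numeral)
        moreover have "603/500 \<le> log_cost (49/22) - (1 / (1 + 3/2) - 2)"
          by (simp add: log_cost_def power2_eq_square)
        ultimately show "ln ((1 + 3/2) / (164/100 - 1 / (1 + 3/2) * (49/22)) ^ 1) + (1 / (1 + 3/2) - 2) \<le> log_cost (49/22)" by simp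
      qed auto
    qed (use w in auto)
  qed
qed

text \<open>Each factor \<open>s\<close> takes half of the multiplier, 82/100, and \<open>w\<close>
  is bounded by its tangent at \<open>w0\<close>; a chord replaces \<open>w\<^sup>2\<close> in
  \<open>log_cost\<close>.\<close>

lemma quadratic_core_le:
  fixes s w :: real
  assumes s: "0 \<le> s" and w: "0 < w" "w \<le> 49/22"
  shows "3/2 * s\<^sup>2 * w \<le> exp (164/100 * s + log_cost w)"
proof -
  have main: "3/2 * s\<^sup>2 * w \<le> exp (164/100 * s + log_cost w)"
    if w0: "0 < w0" and L: "ln (6 * w0 / (164/100)\<^sup>2) + (w / w0 - 3) \<le> log_cost w" for w0
  proof -
    have "s\<^sup>2 \<le> (1 / (82/100) * exp (s * (82/100) - 1))\<^sup>2"
      using le_exp_tangent[of "1 / (82/100)" s] s by (intro power_mono) auto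
    then have "s\<^sup>2 * w \<le> (1 / (82/100) * exp (s * (82/100) - 1))\<^sup>2 * (w0 * exp (w / w0 - 1))"
      using le_exp_tangent[OF w0, of w] w by (intro mult_mono) auto
    also have "\<dots> = w0 / (82/100)\<^sup>2 * exp ((s * (82/100) - 1) + (s * (82/100) - 1) + (w / w0 - 1))"
      unfolding exp_add by (simp add: power2_eq_square)
    also have "(s * (82/100) - 1) + (s * (82/100) - 1) + (w / w0 - 1) = 164/100 * s + (w / w0 - 3)"
      by simp
    finally have "3/2 * s\<^sup>2 * w \<le> 6 * w0 / (164/100)\<^sup>2 * exp (164/100 * s + (w / w0 - 3))"
      by (simp add: power2_eq_square)
    then show ?thesis by (rule exp_boundI) (use w0 L in auto)
  qed
  show ?thesis
  proof (cases "w \<le> 3/2")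
    case True
    have "ln (6 * (6/5) / (164/100)\<^sup>2 :: real) \<le> 9851/10000"
      by (rule ln_le_by_taylor) (simp_all add: eval_nat_numeral fact_numeral)
    moreover have "0 \<le> w * (3/2 - w)" using True w by simp
    then have "w\<^sup>2 \<le> 3/2 * w" by (simp add: power2_eq_square algebra_simps)
    moreover have "w / (6/5) = 5/6 * w" by simp
    ultimately have "ln (6 * (6/5) / (164/100)\<^sup>2) + (w / (6/5) - 3) \<le> log_cost w"
      using True w unfolding log_cost_def by argo
    then show ?thesis by (intro main[of "6/5"]) auto
  next
    case False
    have "ln (6 * (49/22) / (164/100)\<^sup>2 :: real) \<le> 16038/10000"
      by (rule ln_le_by_taylor) (simp_all add: eval_nat_numeral fact_numeral)
    moreover have "0 \<le> (w - 3/2) * (49/22 - w)" using False w by simp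
    moreover have "(w - 3/2) * (49/22 - w) = (3/2 + 49/22) * w - 147/44 - w\<^sup>2" by algebra
    moreover have "w / (49/22) = 22/49 * w" by simp
    ultimately have "ln (6 * (49/22) / (164/100)\<^sup>2) + (w / (49/22) - 3) \<le> log_cost w"
      using False w unfolding log_cost_def by argo
    then show ?thesis by (intro main[of "49/22"]) auto
  qed
qed

text \<open>The additional factor is \<open>F\<close> for a long flip, where
  \<open>w = 1 / v \<le> 1\<close>. The two factors \<open>s\<close> share the multiplier
  \<open>y\<close>.\<close>

lemma linear_core_penalty_le:
  fixes s w :: real
  assumes s: "0 \<le> s" and w: "0 \<le> w" "w \<le> 1"
  shows "s / (123/100) * (s * (1 + w * s)) \<le> exp (164/100 * s + log_cost w)"
proof -
  define c where "c = (1 / (1 + 3/2) :: real)"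
  define y where "y = 164/100 - c * w"
  have y: "0 < y" using w by (simp add: y_def c_def)
  have "s \<le> 2 / y * exp (s * y / 2 - 1)" using le_exp_tangent[of "2 / y" s] y by simp
  then have "s * s \<le> (2 / y * exp (s * y / 2 - 1)) * (2 / y * exp (s * y / 2 - 1))"
    using s y by (intro mult_mono) auto
  moreover have "1 + w * s \<le> 5/2 * exp ((1 + w * s) * c - 1)"
    using le_exp_tangent[of "5/2" "1 + w * s"] by (simp add: c_def)
  ultimately have "(s * s) * (1 + w * s)
      \<le> ((2 / y * exp (s * y / 2 - 1)) * (2 / y * exp (s * y / 2 - 1))) * (5/2 * exp ((1 + w * s) * c - 1))"
    by (rule mult_mono) (use s w y in auto)
  also have "\<dots> = 10 / y ^ 2 * exp ((s * y / 2 - 1) + (s * y / 2 - 1) + ((1 + w * s) * c - 1))"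
    unfolding exp_add by (simp add: power2_eq_square)
  also have "(s * y / 2 - 1) + (s * y / 2 - 1) + ((1 + w * s) * c - 1) = 164/100 * s + (c - 3)"
    by (simp add: y_def algebra_simps)
  finally have "s / (123/100) * (s * (1 + w * s)) \<le> (1000 / 123) / y ^ 2 * exp (164/100 * s + (c - 3))"
    by (simp add: mult.assoc)
  then show ?thesis
  proof (rule exp_boundI)
    show "ln (1000 / 123 / y ^ 2) + (c - 3) \<le> log_cost w"
      unfolding y_def
    proof (rule log_cost_ge_between[OF w])
      have "ln (1000 / 123 / (164/100 - c * 0) ^ 2 :: real) \<le> 111/100"
        by (rule ln_le_by_taylor) (simp_all add: c_def eval_nat_numeral fact_numeral)
      moreover have "111/100 \<le> log_cost 0 - (c - 3)" by (simp add: c_def log_cost_def)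
      ultimately show "ln (1000 / 123 / (164/100 - c * 0) ^ 2) + (c - 3) \<le> log_cost 0" by simp
      have "ln (1000 / 123 / (164/100 - c * 1) ^ 2 :: real) \<le> 167/100"
        by (rule ln_le_by_taylor) (simp_all add: c_def eval_nat_numeral fact_numeral)
      moreover have "167/100 \<le> log_cost 1 - (c - 3)" by (simp add: c_def log_cost_def)
      ultimately show "ln (1000 / 123 / (164/100 - c * 1) ^ 2) + (c - 3) \<le> log_cost 1" by simp
    qed (auto simp: c_def)
  qed (use y in auto)
qed

lemma quadratic_core_penalty_le:
  fixes s w :: real
  assumes s: "0 \<le> s" and w: "0 \<le> w" "w \<le> 1"
  shows "s / (123/100) * (3/2 * s\<^sup>2 * w) \<le> exp (164/100 * s + log_cost w)"
proof -
  define x where "x = 300/164 * exp (s * (164/300) - 1)"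
  have "s \<le> x" using le_exp_tangent[of "300/164" s] by (simp add: x_def)
  moreover have x0: "0 \<le> x" by (simp add: x_def)
  ultimately have "s ^ 3 \<le> x ^ 3" using s by (intro power_mono) auto
  then have "s ^ 3 * w \<le> x ^ 3 * (1 * exp (w / 1 - 1))"
    using le_exp_tangent[of 1 w] w s x0 by (intro mult_mono) auto
  also have "\<dots> = (300/164) ^ 3 * exp ((s * (164/300) - 1) + (s * (164/300) - 1) + (s * (164/300) - 1) + (w - 1))"
    unfolding exp_add x_def by (simp add: power3_eq_cube)
  also have "(s * (164/300) - 1) + (s * (164/300) - 1) + (s * (164/300) - 1) + (w - 1) = 164/100 * s + (w - 4)"
    by simp
  finally have "s / (123/100) * (3/2 * s\<^sup>2 * w) \<le> (150/123 * (300/164) ^ 3) * exp (164/100 * s + (w - 4))"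
    by (simp add: power2_eq_square power3_eq_cube mult_ac)
  then show ?thesis
  proof (rule exp_boundI)
    have "ln (150/123 * (300/164) ^ 3 :: real) \<le> 202/100"
      by (rule ln_le_by_taylor) (simp_all add: eval_nat_numeral fact_numeral)
    moreover have "0 \<le> w * (1 - w)" using w by simp
    then have "w\<^sup>2 \<le> w" by (simp add: power2_eq_square algebra_simps)
    ultimately show "ln (150/123 * (300/164) ^ 3 :: real) + (w - 4) \<le> log_cost w"
      using w by (simp add: log_cost_def)
  qed simp
qed

text \<open>This is the share of one flip in \<open>(R 0)\<^sup>2 * E 0\<close>, except that the
  factor with \<open>1 / \<rho>\<close> is taken at the flip's own index instead of the next
  one.\<close>

definition step_cost :: "real \<Rightarrow> real \<Rightarrow> real" where
  "step_cost s v = (s / v)\<^sup>2 * (1 + max (v / s) (1/2)) * (if v < 1 then 1 else max 1 (s / (123/100)))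
     * ((v + max s (27/49)) / (v + s))"

lemma step_cost_le:
  assumes s: "0 < s" and v: "22/49 \<le> v"
  shows "step_cost s v \<le> exp (164/100 * s + log_cost (1 / v)) / v"
proof -
  define w where "w = 1 / v"
  have v0: "0 < v" using v by simp
  have w: "0 < w" "w \<le> 49/22" using v by (auto simp: w_def divide_simps)
  define c where "c = max (s * (1 + w * max s (27/49))) (3/2 * s\<^sup>2 * w)"
  have "(s / v)\<^sup>2 * (1 + max (v / s) (1/2)) * ((v + max s (27/49)) / (v + s)) \<le> c / v"
  proof (cases "s \<le> 2 * v")
    case True
    then have "1 + max (v / s) (1/2) = (s + v) / s" using s v0 by (simp add: max_def field_simps)
    then have "(s / v)\<^sup>2 * (1 + max (v / s) (1/2)) * ((v + max s (27/49)) / (v + s))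
        = s * (v + max s (27/49)) / (v * v)"
      using s v0 by (simp add: power2_eq_square add.commute)
    also have "\<dots> = s * (1 + w * max s (27/49)) / v"
      using v0 by (simp add: w_def add_divide_distrib distrib_left)
    also have "\<dots> \<le> c / v" using v0 by (intro divide_right_mono) (auto simp: c_def)
    finally show ?thesis .
  next
    case False
    then have m: "max (v / s) (1/2) = 1/2" "max s (27/49) = s"
      using s v by (auto simp: max_def divide_simps)
    have "(s / v)\<^sup>2 * (1 + max (v / s) (1/2)) * ((v + max s (27/49)) / (v + s)) = 3/2 * s\<^sup>2 * w / v"
      using s v0 unfolding m by (simp add: w_def power2_eq_square)
    also have "\<dots> \<le> c / v" using v0 by (intro divide_right_mono) (auto simp: c_def)
    finally show ?thesis .
  qed
  moreover define f where "f = (if v < 1 then 1 else max 1 (s / (123/100)))"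
  have f: "1 \<le> f" by (simp add: f_def)
  moreover have "step_cost s v = f * ((s / v)\<^sup>2 * (1 + max (v / s) (1/2)) * ((v + max s (27/49)) / (v + s)))"
    by (simp only: step_cost_def f_def mult_ac)
  ultimately have "step_cost s v \<le> f * (c / v)" by (simp only:) (intro mult_left_mono, auto)
  moreover have "f * c \<le> exp (164/100 * s + log_cost w)"
  proof -
    have small: "s * (1 + w * max s (27/49)) \<le> exp (164/100 * s + log_cost w)"
    proof (cases "s \<le> 27/49")
      case True
      \<comment> \<open>Below 27/49 the left side is linear in \<open>s\<close>. The exponential
        tangent there has rate 49/27, more than 164/100, and \<open>s - 27/49\<close> is not
        positive, so the case reduces to \<open>s = 27/49\<close>.\<close>
      have "s \<le> 27/49 * exp (s / (27/49) - 1)" by (rule le_exp_tangent) simp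
      also have "\<dots> \<le> 27/49 * exp (164/100 * (s - 27/49))" using True by simp
      finally have "s * (1 + w * (27/49)) \<le> 27/49 * exp (164/100 * (s - 27/49)) * (1 + w * (27/49))"
        using w by (intro mult_right_mono) auto
      also have "\<dots> = exp (164/100 * (s - 27/49)) * (27/49 * (1 + w * (27/49)))" by simp
      also have "\<dots> \<le> exp (164/100 * (s - 27/49)) * exp (164/100 * (27/49) + log_cost w)"
        using linear_core_le[of "27/49" w] w by (intro mult_left_mono) auto
      also have "\<dots> = exp (164/100 * (s - 27/49) + (164/100 * (27/49) + log_cost w))" by (rule mult_exp_exp)
      also have "164/100 * (s - 27/49) + (164/100 * (27/49) + log_cost w) = 164/100 * s + log_cost w" by algebra
      finally show ?thesis using True by (simp add: max_def)
    next
      case False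
      then show ?thesis using linear_core_le[of s w] s w by (simp add: max_def)
    qed
    have quad: "3/2 * s\<^sup>2 * w \<le> exp (164/100 * s + log_cost w)"
      using quadratic_core_le s w by simp
    show ?thesis
    proof (cases "v < 1 \<or> s \<le> 123/100")
      case True
      then have "f = 1" by (auto simp: f_def)
      then show ?thesis using small quad by (simp add: c_def)
    next
      case False
      then have fs: "f = s / (123/100)" and "max s (27/49) = s" and w1: "w \<le> 1"
        by (auto simp: f_def w_def)
      then have "f * c = max (f * (s * (1 + w * s))) (f * (3/2 * s\<^sup>2 * w))"
        using f by (simp add: c_def max_mult_distrib_left)
      then show ?thesis
        using linear_core_penalty_le[of s w, folded fs] quadratic_core_penalty_le[of s w, folded fs] s w w1
        by (metis less_imp_le max.bounded_iff)
    qed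
  qed
  then have "f * (c / v) \<le> exp (164/100 * s + log_cost w) / v" using v0 by (simp add: divide_right_mono)
  ultimately show ?thesis by (simp add: w_def)
qed

section \<open>Power-law excesses\<close>

definition \<Psi> :: "real \<Rightarrow> real" where "\<Psi> u = log_cost (1 / u) - ln u"

text \<open>Summation by parts: from the top downwards, each tail sum of \<open>x\<close> is
  weighted by a nonnegative increment of \<open>c\<close>.\<close>

lemma abel_nonneg:
  fixes c x :: "nat \<Rightarrow> real"
  assumes c: "\<And>j. j < k \<Longrightarrow> 0 \<le> c j" "\<And>j. Suc j < k \<Longrightarrow> c j \<le> c (Suc j)"
    and x: "\<And>i. i < k \<Longrightarrow> 0 \<le> (\<Sum>j\<in>{i..<k}. x j)"
  shows "0 \<le> (\<Sum>j<k. c j * x j)"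
proof (cases k)
  case (Suc k')
  have "c i * (\<Sum>j\<in>{i..<k}. x j) \<le> (\<Sum>j\<in>{i..<k}. c j * x j)" if "i \<le> k'" for i
    using that
  proof (induction i rule: inc_induct)
    case base
    then show ?case by (simp add: Suc)
  next
    case (step i)
    have "c i * (\<Sum>j\<in>{Suc i..<k}. x j) \<le> c (Suc i) * (\<Sum>j\<in>{Suc i..<k}. x j)"
      using step Suc by (intro mult_right_mono c x) auto
    then show ?case
      using step Suc by (simp add: sum.atLeast_Suc_lessThan distrib_left)
  qed
  from this[of 0] have "c 0 * (\<Sum>j\<in>{0..<k}. x j) \<le> (\<Sum>j<k. c j * x j)"
    by (simp add: atLeast0LessThan)
  moreover have "0 \<le> c 0 * (\<Sum>j\<in>{0..<k}. x j)" using c(1)[of 0] x[of 0] Suc by simp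
  ultimately show ?thesis by linarith
qed simp

text \<open>\<open>- \<psi>\<close> is the derivative of \<open>\<Psi>\<close>.\<close>

definition \<psi> :: "real \<Rightarrow> real" where "\<psi> u = 1 / u + 3/5 * (1 / u)\<^sup>2 - 1/10 * (1 / u) ^ 3"

lemma \<psi>_antimono:
  assumes "22/49 \<le> u" "u \<le> u'"
  shows "\<psi> u' \<le> \<psi> u" "0 \<le> \<psi> u"
proof -
  have *: "0 \<le> x + 3/5 * x\<^sup>2 - 1/10 * x ^ 3 \<and> y + 3/5 * y\<^sup>2 - 1/10 * y ^ 3 \<le> x + 3/5 * x\<^sup>2 - 1/10 * x ^ 3"
    if "0 < y" "y \<le> x" "x \<le> 49/22" for x y :: real
  proof -
    have "0 \<le> x * (1 + 3/5 * x - 1/10 * (x * x))"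
    proof -
      have "x * x \<le> 3 * x" using that by (intro mult_right_mono) auto
      then have "0 \<le> 1 + 3/5 * x - 1/10 * (x * x)" using that by argo
      then show ?thesis using that by (intro mult_nonneg_nonneg) auto
    qed
    moreover have "x * (1 + 3/5 * x - 1/10 * (x * x)) = x + 3/5 * x\<^sup>2 - 1/10 * x ^ 3" by algebra
    moreover have "0 \<le> (x - y) * (1 + 3/5 * (x + y) - 1/10 * (x * x + x * y + y * y))"
    proof -
      have "x * x \<le> 3 * x" "x * y \<le> 3 * y" "y * y \<le> 3 * y"
        using that by (intro mult_right_mono; simp)+
      then have "0 \<le> 1 + 3/5 * (x + y) - 1/10 * (x * x + x * y + y * y)" using that by argo
      then show ?thesis using that by (intro mult_nonneg_nonneg) auto
    qed
    moreover have "(x - y) * (1 + 3/5 * (x + y) - 1/10 * (x * x + x * y + y * y))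
        = x + 3/5 * x\<^sup>2 - 1/10 * x ^ 3 - (y + 3/5 * y\<^sup>2 - 1/10 * y ^ 3)" by algebra
    ultimately show ?thesis by linarith
  qed
  have "0 < 1 / u'" "1 / u' \<le> 1 / u" "1 / u \<le> 49/22"
    using assms by (auto simp: divide_simps)
  from *[OF this] show "\<psi> u' \<le> \<psi> u" "0 \<le> \<psi> u" by (auto simp: \<psi>_def)
qed

text \<open>Convexity of \<open>\<Psi>\<close>. In the reciprocals \<open>a\<close> and
  \<open>b\<close> the quadratic part leaves an explicit remainder with the factor
  \<open>(a - b)\<^sup>2\<close>, nonnegative in the range considered; the logarithm is handled
  separately.\<close>

lemma \<Psi>_tangent:
  assumes "22/49 \<le> u" "22/49 \<le> x"
  shows "\<Psi> u - \<psi> u * (x - u) \<le> \<Psi> x"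
proof -
  define a where "a = 1 / x"
  define b where "b = 1 / u"
  have ab: "0 < a" "a \<le> 49/22" "0 < b" "b \<le> 49/22" using assms by (auto simp: a_def b_def divide_simps)
  have u: "u = 1 / b" "x = 1 / a" by (auto simp: a_def b_def)
  have "ln (x / u) \<le> x / u - 1" using assms by (intro ln_le_minus_one) auto
  then have l: "ln x - ln u \<le> b * (x - u)"
    using assms by (simp add: ln_div b_def diff_divide_distrib)
  have "0 \<le> (a - b)\<^sup>2 * (3/5 - 1/20 * (a + 2 * b)) / a" using ab by simp
  also have "\<dots> = (log_cost a - log_cost b) + (3/5 * b\<^sup>2 - 1/10 * b ^ 3) * (1 / a - 1 / b)"
    using ab by (simp add: log_cost_def field_simps eval_nat_numeral)
  also have "1 / a - 1 / b = x - u" by (simp add: u)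
  finally show ?thesis
    using l unfolding \<Psi>_def \<psi>_def a_def[symmetric] b_def[symmetric] by (simp add: algebra_simps)
qed

text \<open>Weak majorization for a convex decreasing function: since \<open>w\<close> decreases,
  the slopes \<open>\<psi> (w j)\<close> increase with \<open>j\<close>, so the tail hypothesis
  suffices.\<close>

lemma \<Psi>_sum_le:
  fixes w w' :: "nat \<Rightarrow> real"
  assumes w: "\<And>j. j < k \<Longrightarrow> 22/49 \<le> w j" "\<And>j. Suc j < k \<Longrightarrow> w (Suc j) \<le> w j"
    and w': "\<And>j. j < k \<Longrightarrow> 22/49 \<le> w' j"
    and tail: "\<And>i. i < k \<Longrightarrow> (\<Sum>j\<in>{i..<k}. w' j) \<le> (\<Sum>j\<in>{i..<k}. w j)"
  shows "(\<Sum>j<k. \<Psi> (w j)) \<le> (\<Sum>j<k. \<Psi> (w' j))"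
proof -
  have "0 \<le> (\<Sum>j<k. \<psi> (w j) * (w j - w' j))"
    using w tail by (intro abel_nonneg \<psi>_antimono) (auto simp: sum_subtractf)
  also have "\<dots> \<le> (\<Sum>j<k. \<Psi> (w' j) - \<Psi> (w j))"
    using \<Psi>_tangent w(1) w' by (intro sum_mono) (force simp: algebra_simps)
  finally show ?thesis by (simp add: sum_subtractf)
qed

text \<open>
  A rational exponent slightly below \<open>alpha_star\<close>. Excesses of the size \<open>profile k\<close> are the worst
  case for the selection of flips below.
\<close>

definition \<alpha> :: real where "\<alpha> = 71/49"
definition profile :: "nat \<Rightarrow> nat \<Rightarrow> real" where
  "profile k j = 22/49 * ((real k + 1) / (real j + 2)) powr \<alpha>"

lemma profile_ge: "j < k \<Longrightarrow> 22/49 \<le> profile k j"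
  using ge_one_powr_ge_zero[of "(real k + 1) / (real j + 2)" \<alpha>] by (simp add: profile_def \<alpha>_def)

text \<open>Comparison with an integral. The shift \<open>j + 2\<close> in \<open>profile\<close>
  puts the argument at the right end of each interval, where the decreasing derivative is
  smallest.\<close>

lemma profile_tail:
  assumes "i \<le> k"
  shows "(\<Sum>j\<in>{i..<k}. profile k j) \<le> (real k + 1) * (((real k + 1) / (real i + 1)) powr (22/49) - 1)"
proof -
  define f where "f j = (real k + 1) powr \<alpha> * (real j + 1) powr (- (22/49))" for j :: nat
  have step: "profile k j \<le> f j - f (Suc j)" for j
  proof -
    have "\<exists>z>real j + 1. z < real j + 2 \<and>
        (real j + 2) powr (- (22/49)) - (real j + 1) powr (- (22/49))
        = (real j + 2 - (real j + 1)) * (- (22/49) * z powr (- (22/49) - 1))"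
      by (rule MVT2) (auto intro!: derivative_eq_intros)
    then obtain z where z: "real j + 1 < z" "z < real j + 2"
      "(real j + 2) powr (- (22/49)) - (real j + 1) powr (- (22/49)) = - (22/49) * z powr (- \<alpha>)"
      by (auto simp: \<alpha>_def)
    have "(real j + 2) powr (- \<alpha>) \<le> z powr (- \<alpha>)"
      using z by (intro powr_mono2') (auto simp: \<alpha>_def)
    then have "22/49 * (real j + 2) powr (- \<alpha>) \<le> (real j + 1) powr (- (22/49)) - (real j + 2) powr (- (22/49))"
      using z by simp
    then have "(real k + 1) powr \<alpha> * (22/49 * (real j + 2) powr (- \<alpha>))
        \<le> (real k + 1) powr \<alpha> * ((real j + 1) powr (- (22/49)) - (real j + 2) powr (- (22/49)))"
      by (intro mult_left_mono) auto
    moreover have "profile k j = (real k + 1) powr \<alpha> * (22/49 * (real j + 2) powr (- \<alpha>))"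
      by (simp add: profile_def powr_divide powr_minus_divide)
    moreover have "f j - f (Suc j)
        = (real k + 1) powr \<alpha> * ((real j + 1) powr (- (22/49)) - (real j + 2) powr (- (22/49)))"
    proof -
      have "real (Suc j) + 1 = real j + 2" by simp
      then show ?thesis unfolding f_def by (simp only: right_diff_distrib)
    qed
    ultimately show ?thesis by (simp only:)
  qed
  have "(\<Sum>j\<in>{i..<k}. profile k j) \<le> (\<Sum>j\<in>{i..<k}. f j - f (Suc j))"
    by (intro sum_mono step)
  also have "\<dots> = f i - f k"
    using sum_Suc_diff'[OF assms, of "\<lambda>j. - f j"] by simp
  also have "\<dots> = (real k + 1) * (((real k + 1) / (real i + 1)) powr (22/49) - 1)"
  proof -
    define Q where "Q = (real k + 1) powr (22/49)"
    have Q: "0 < Q" by (simp add: Q_def)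
    have "(real k + 1) powr \<alpha> = (real k + 1) powr (1 + 22/49)" by (simp add: \<alpha>_def)
    then have K: "(real k + 1) powr \<alpha> = (real k + 1) * Q" unfolding powr_add by (simp add: Q_def)
    have "f k = real k + 1" using Q unfolding f_def K by (simp add: powr_minus_divide Q_def)
    moreover have "((real k + 1) / (real i + 1)) powr (22/49) = Q * (real i + 1) powr (- (22/49))"
      by (simp add: Q_def powr_divide powr_minus_divide)
    moreover have "f i = (real k + 1) * (Q * (real i + 1) powr (- (22/49)))"
      unfolding f_def K by (simp only: mult.assoc)
    ultimately show ?thesis by (simp only: right_diff_distrib mult_1_right)
  qed
  finally show ?thesis .
qed

text \<open>\<open>\<Psi>\<close> evaluated at \<open>22/49 * t powr (- \<alpha>)\<close>; the last
  coefficients are \<open>3/5 * (49/22)\<close> and \<open>1/20 * (49/22)\<^sup>2\<close>.\<close>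

definition \<phi> :: "real \<Rightarrow> real" where
  "\<phi> t = - 1479/1000 - ln (22/49) + \<alpha> * ln t + 147/110 * t powr \<alpha> - 2401/9680 * t powr (2 * \<alpha>)"

text \<open>The antiderivative of \<open>\<phi>\<close> that tends to 0 at 0, so that
  \<open>\<Phi> 1\<close> is its integral over the unit interval.\<close>

definition \<Phi> :: "real \<Rightarrow> real" where
  "\<Phi> t = (- 1479/1000 - ln (22/49)) * t + \<alpha> * (t * ln t - t)
    + 147/110 * (t powr (\<alpha> + 1) / (\<alpha> + 1)) - 2401/9680 * (t powr (2 * \<alpha> + 1) / (2 * \<alpha> + 1))"

lemma \<Psi>_profile: "\<Psi> (profile k j) = \<phi> ((real j + 2) / (real k + 1))"
proof -
  define t where "t = (real j + 2) / (real k + 1)"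
  have t: "0 < t" by (simp add: t_def)
  have "profile k j = 22/49 * (1 / t) powr \<alpha>" by (simp add: profile_def t_def)
  also have "\<dots> = 22/49 / t powr \<alpha>" using t by (simp add: powr_divide)
  finally have p: "profile k j = 22/49 / t powr \<alpha>" .
  have "t powr (2 * \<alpha>) = (t powr \<alpha>)\<^sup>2" using t by (simp add: powr_powr[symmetric] mult.commute powr_realpow)
  moreover have "ln (profile k j) = ln (22/49) - \<alpha> * ln t"
  proof -
    have "ln (22/49 / t powr \<alpha>) = ln (22/49) - ln (t powr \<alpha>)" using t by (subst ln_div) auto
    then show ?thesis using t by (simp add: p ln_powr)
  qed
  ultimately show ?thesis
    unfolding \<Psi>_def \<phi>_def t_def[symmetric] log_cost_def by (simp add: p power2_eq_square)
qed

lemma \<phi>_mono: "0 < x \<Longrightarrow> x \<le> y \<Longrightarrow> y \<le> 1 \<Longrightarrow> \<phi> x \<le> \<phi> y"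
proof -
  assume xy: "0 < x" "x \<le> y" "y \<le> 1"
  define a where "a = x powr \<alpha>"
  define b where "b = y powr \<alpha>"
  have ab: "0 < a" "a \<le> b" "b \<le> 1"
    using xy powr_mono2[of \<alpha> x y] powr_mono2[of \<alpha> y 1] by (auto simp: a_def b_def \<alpha>_def)
  have sq: "x powr (2 * \<alpha>) = a\<^sup>2" "y powr (2 * \<alpha>) = b\<^sup>2"
    using xy by (simp_all add: a_def b_def powr_powr[symmetric] mult.commute powr_realpow)
  have "0 \<le> (b - a) * (147/110 - 2401/9680 * (a + b))" using ab by (intro mult_nonneg_nonneg) auto
  also have "\<dots> = 147/110 * b - 2401/9680 * b\<^sup>2 - (147/110 * a - 2401/9680 * a\<^sup>2)" by algebra
  finally have "147/110 * a - 2401/9680 * a\<^sup>2 \<le> 147/110 * b - 2401/9680 * b\<^sup>2" by simp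
  moreover have "\<alpha> * ln x \<le> \<alpha> * ln y" using xy by (intro mult_left_mono) (auto simp: \<alpha>_def)
  ultimately show ?thesis
    unfolding \<phi>_def sq by (simp add: a_def[symmetric] b_def[symmetric])
qed

lemma \<Phi>_deriv:
  assumes t: "0 < t" shows "(\<Phi> has_real_derivative \<phi> t) (at t)"
proof -
  have P: "((\<lambda>t. t powr (r + 1) / (r + 1)) has_real_derivative t powr r) (at t)" if "0 < r" for r :: real
    using DERIV_cdivide[OF has_real_derivative_powr[OF t, of "r + 1"], of "r + 1"] that by simp
  have L: "((\<lambda>t. c * t + \<alpha> * (t * ln t - t)) has_real_derivative c + \<alpha> * ln t) (at t)" for c
    using t by (auto intro!: derivative_eq_intros)
  have \<alpha>: "0 < \<alpha>" "0 < 2 * \<alpha>" by (auto simp: \<alpha>_def)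
  show ?thesis
    unfolding \<Phi>_def[abs_def] \<phi>_def
    by (rule DERIV_diff[OF DERIV_add[OF L DERIV_cmult[OF P[OF \<alpha>(1)]]] DERIV_cmult[OF P[OF \<alpha>(2)]]])
qed

text \<open>The bound on the logarithm of the cost grows like \<open>164/100 + \<Phi> 1\<close>
  times \<open>k + 1\<close>. Its negativity is where the size of \<open>\<alpha>\<close>
  enters.\<close>

lemma \<Phi>_1: "164/100 + \<Phi> 1 < - 4/1000"
proof -
  have "ln (49/22 :: real) \<le> 801/1000"
    by (rule ln_le_by_taylor) (simp_all add: eval_nat_numeral fact_numeral)
  moreover have "ln (inverse (49/22) :: real) = - ln (49/22)" by (rule ln_inverse)
  then have "ln (22/49 :: real) = - ln (49/22)" by (simp only: inverse_divide)
  moreover have "\<Phi> 1 = - 1479/1000 - ln (22/49) - 71/49 + 147/110 / (120/49) - 2401/9680 / (191/49)"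
    unfolding \<Phi>_def \<alpha>_def by (simp add: powr_one_eq_one)
  ultimately show ?thesis by simp
qed

text \<open>A Riemann sum of the increasing \<open>\<phi>\<close> is compared with its integral. The
  missing part near 0 costs at most \<open>3 * ln n\<close> plus a constant, since
  \<open>2 * \<alpha> \<le> 3\<close>; the negative linear term absorbs it.\<close>

lemma profile_sum_bounded:
  "\<exists>B. \<forall>k. 164/100 * (real k + 1) + (\<Sum>j<k. \<Psi> (profile k j)) \<le> B"
proof -
  define c where "c = 2 * \<bar>1479/1000 + ln (22/49 :: real)\<bar> + 6"
  have bound: "(\<Sum>j<k. \<Psi> (profile k j)) \<le> (real k + 1) * \<Phi> 1 + 3 * ln (real k + 1) + c + \<phi> 1"
    if k1: "1 \<le> k" for k
  proof -
    define n where "n = real k + 1"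
    have n: "2 \<le> n" using k1 by (simp add: n_def)
    have step: "\<phi> ((real j + 2) / n) \<le> n * \<Phi> ((real (Suc j) + 2) / n) - n * \<Phi> ((real j + 2) / n)"
      if "Suc j < k" for j
    proof -
      have le: "(real j + 2) / n < (real (Suc j) + 2) / n"
        using n by (intro divide_strict_right_mono) auto
      have "\<exists>z>(real j + 2) / n. z < (real (Suc j) + 2) / n \<and>
          \<Phi> ((real (Suc j) + 2) / n) - \<Phi> ((real j + 2) / n)
          = ((real (Suc j) + 2) / n - (real j + 2) / n) * \<phi> z"
        using n by (intro MVT2 le \<Phi>_deriv) (auto intro: less_le_trans[of 0 "(real j + 2) / n"])
      then obtain z where z: "(real j + 2) / n < z" "z < (real (Suc j) + 2) / n"
        "\<Phi> ((real (Suc j) + 2) / n) - \<Phi> ((real j + 2) / n)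
          = ((real (Suc j) + 2) / n - (real j + 2) / n) * \<phi> z" by blast
      have "(real (Suc j) + 2) / n \<le> 1" using that n by (simp add: n_def divide_le_eq)
      then have "z \<le> 1" using z(2) by linarith
      moreover have "0 < (real j + 2) / n" using n by simp
      ultimately have "\<phi> ((real j + 2) / n) \<le> \<phi> z" using z(1) by (intro \<phi>_mono) auto
      moreover have "(real (Suc j) + 2) / n - (real j + 2) / n = 1 / n"
        by (simp add: diff_divide_distrib[symmetric])
      ultimately have "\<phi> ((real j + 2) / n) \<le> n * (\<Phi> ((real (Suc j) + 2) / n) - \<Phi> ((real j + 2) / n))"
        using z(3) n by simp
      then show ?thesis by (simp add: right_diff_distrib)
    qed
    obtain k' where k': "k = Suc k'" using k1 not0_implies_Suc[of k] by auto
    have "(\<Sum>j<k'. \<phi> ((real j + 2) / n))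
        \<le> (\<Sum>j<k'. n * \<Phi> ((real (Suc j) + 2) / n) - n * \<Phi> ((real j + 2) / n))"
      using k' by (intro sum_mono step) auto
    also have "\<dots> = n * \<Phi> ((real k' + 2) / n) - n * \<Phi> (2 / n)"
      by (subst sum_lessThan_telescope) simp
    finally have "(\<Sum>j<k'. \<phi> ((real j + 2) / n)) \<le> n * \<Phi> ((real k' + 2) / n) - n * \<Phi> (2 / n)" .
    moreover have "(real k' + 2) / n = 1" using k' n by (simp add: n_def)
    moreover have "(\<Sum>j<k. \<phi> ((real j + 2) / n)) = (\<Sum>j<k'. \<phi> ((real j + 2) / n)) + \<phi> ((real k' + 2) / n)"
      by (simp add: k')
    ultimately have "(\<Sum>j<k. \<phi> ((real j + 2) / n)) \<le> n * \<Phi> 1 - n * \<Phi> (2 / n) + \<phi> 1"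
      by simp
    moreover have "- (n * \<Phi> (2 / n)) \<le> 3 * ln n + c"
    proof -
      define t where "t = 2 / n"
      have t: "0 < t" "t \<le> 1" "n * t = 2" using n by (auto simp: t_def)
      have p1: "0 \<le> t powr (\<alpha> + 1)" by simp
      have p2: "t powr (2 * \<alpha> + 1) \<le> t"
        using powr_mono'[of 1 "2 * \<alpha> + 1" t] t by (simp add: \<alpha>_def)
      define x where "x = n * (147/110 * (t powr (\<alpha> + 1) / (\<alpha> + 1)))"
      define y where "y = n * (2401/9680 * (t powr (2 * \<alpha> + 1) / (2 * \<alpha> + 1)))"
      have "0 \<le> x"
        unfolding x_def using n by (intro mult_nonneg_nonneg divide_nonneg_nonneg) (auto simp: \<alpha>_def)
      have "y \<le> n * t"
      proof -
        have "2401/9680 * (t powr (2 * \<alpha> + 1) / (2 * \<alpha> + 1)) \<le> 1 * t"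
          using p2 t by (simp add: \<alpha>_def)
        then show ?thesis unfolding y_def using n by (intro mult_left_mono) auto
      qed
      have "n * \<Phi> t = (n * t) * (- 1479/1000 - ln (22/49)) + \<alpha> * ((n * t) * ln t - n * t) + x - y"
        by (simp add: \<Phi>_def x_def y_def algebra_simps)
      then have "- (n * \<Phi> t) = 2 * (1479/1000 + ln (22/49)) - 2 * \<alpha> * ln t + 2 * \<alpha> - x + y"
        unfolding t(3) by (simp add: algebra_simps)
      then have "- (n * \<Phi> t) \<le> 2 * (1479/1000 + ln (22/49)) - 2 * \<alpha> * ln t + 2 * \<alpha> + 1 * (n * t)"
        using \<open>0 \<le> x\<close> \<open>y \<le> n * t\<close> by linarith
      also have "ln t = ln 2 - ln n" using n by (simp add: t_def ln_div)
      also have "2 * (1479/1000 + ln (22/49)) - 2 * \<alpha> * (ln 2 - ln n) + 2 * \<alpha> + 1 * (n * t)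
          \<le> 3 * ln n + c"
      proof -
        have "0 \<le> ln n" "0 \<le> ln (2::real)" using n by auto
        moreover have "1479/1000 + ln (22/49 :: real) \<le> \<bar>1479/1000 + ln (22/49)\<bar>" by (rule abs_ge_self)
        ultimately show ?thesis unfolding t(3) c_def \<alpha>_def by argo
      qed
      finally show ?thesis by (simp add: t_def)
    qed
    ultimately show ?thesis by (simp add: \<Psi>_profile n_def)
  qed
  \<comment> \<open>The number 750 is 3 divided by the slack 4/1000.\<close>
  define B where "B = max (164/100) (c + \<phi> 1 + 3 * ln 750)"
  have "164/100 * (real k + 1) + (\<Sum>j<k. \<Psi> (profile k j)) \<le> B" for k
  proof (cases "1 \<le> k")
    case True
    define n where "n = real k + 1"
    have n: "0 < n" by (simp add: n_def)
    have "n * (164/100 + \<Phi> 1) \<le> n * (- 4/1000)"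
      using \<Phi>_1 n by (intro mult_left_mono) auto
    then have "164/100 * n + n * \<Phi> 1 \<le> - 4/1000 * n" by (simp add: distrib_left mult.commute)
    moreover have "3 * ln n \<le> 4/1000 * n + 3 * ln 750"
      using ln_le_minus_one[of "n / 750"] n by (simp add: ln_div)
    ultimately have "164/100 * n + (\<Sum>j<k. \<Psi> (profile k j)) \<le> c + \<phi> 1 + 3 * ln 750"
      using bound[OF True] unfolding n_def[symmetric] by linarith
    then show ?thesis by (simp add: B_def n_def)
  next
    case False
    then have "k = 0" by simp
    then show ?thesis by (simp add: B_def)
  qed
  then show ?thesis by blast
qed

section \<open>Selecting the flips\<close>

text \<open>
  The flips are the \<open>k\<close> longest steps, where \<open>k\<close> minimizes \<open>T k * (k + 1) powr (22/49)\<close> for the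
  total length \<open>T k\<close> of the other steps. Minimality makes the excesses at least as spread out as the profile.
\<close>

lemma select_flips:
  fixes e :: "nat \<Rightarrow> real"
  assumes e: "\<And>t. t \<in> {1..N} \<Longrightarrow> 0 \<le> e t"
  obtains K \<sigma> where "K \<subseteq> {1..N}" "0 < \<sigma>"
    "\<sigma> * (real (card K) + 1) = real N + 1 + (\<Sum>t\<in>{1..N} - K. e t)"
    "\<sigma> * (real (card K) + 1) \<le> (real N + 1) powr \<alpha>"
    "\<And>t. t \<in> K \<Longrightarrow> 22/49 \<le> e t / \<sigma>"
    "(\<Sum>t\<in>K. \<Psi> (e t / \<sigma>)) \<le> (\<Sum>j<card K. \<Psi> (profile (card K) j))"
proof -
  define xs where "xs = rev (sort_key e [1..<Suc N])"
  have set: "set xs = {1..N}" and len: "length xs = N" and dist: "distinct xs"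
    by (auto simp: xs_def)
  have desc: "e (xs ! j) \<le> e (xs ! i)" if "i \<le> j" "j < N" for i j
  proof -
    have "sorted (map e (sort_key e [1..<Suc N]))" by simp
    then have "sorted (rev (map e xs))" by (simp add: xs_def rev_map)
    then show ?thesis
      using that len sorted_rev_nth_mono[of "map e xs" i j] by simp
  qed
  \<comment> \<open>The constant \<open>N + 1\<close> is independent of the choice of flips:
    \<open>N - k\<close> steps count 1 besides their excess, and each of the \<open>k + 1\<close>
    segments has an additional 1.\<close>
  define T where "T j = real N + 1 + (\<Sum>i\<in>{j..<N}. e (xs ! i))" for j
  have nth_set: "xs ! i \<in> {1..N}" if "i < N" for i using that set len nth_mem by blast
  have Tpos: "real N + 1 \<le> T j" for j
  proof -
    have "0 \<le> (\<Sum>i\<in>{j..<N}. e (xs ! i))" by (intro sum_nonneg e nth_set) simp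
    then show ?thesis by (simp add: T_def)
  qed
  define c where "c j = T j * (real j + 1) powr (22/49)" for j
  obtain k where k: "k \<le> N" "\<And>j. j \<le> N \<Longrightarrow> c k \<le> c j"
  proof -
    have "Min (c ` {..N}) \<in> c ` {..N}" by (intro Min_in) auto
    then obtain k where "k \<in> {..N}" "c k = Min (c ` {..N})" by (metis imageE)
    then show ?thesis using that[of k] by simp
  qed
  define \<sigma> where "\<sigma> = T k / (real k + 1)"
  define K where "K = set (take k xs)"
  have \<sigma>: "0 < \<sigma>" "\<sigma> * (real k + 1) = T k" using Tpos[of k] by (auto simp: \<sigma>_def)
  have card: "card K = k"
    unfolding K_def using dist len k(1) by (simp add: distinct_card)
  have sumK: "(\<Sum>t\<in>K. f t) = (\<Sum>i<k. f (xs ! i))" for f :: "nat \<Rightarrow> real"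
  proof -
    have "(\<Sum>t\<in>K. f t) = sum_list (map f (take k xs))"
      unfolding K_def using dist by (simp add: sum_list_distinct_conv_sum_set)
    also have "\<dots> = (\<Sum>i<k. f (xs ! i))"
      using len k(1) by (simp add: sum_list_sum_nth atLeast0LessThan)
    finally show ?thesis .
  qed
  have sumAll: "(\<Sum>t\<in>{1..N}. f t) = (\<Sum>i<N. f (xs ! i))" for f :: "nat \<Rightarrow> real"
  proof -
    have "(\<Sum>t\<in>{1..N}. f t) = sum_list (map f xs)"
      using dist set by (simp add: sum_list_distinct_conv_sum_set)
    also have "\<dots> = (\<Sum>i<N. f (xs ! i))"
      using len by (simp add: sum_list_sum_nth atLeast0LessThan)
    finally show ?thesis .
  qed
  have sub: "K \<subseteq> {1..N}" using set set_take_subset[of k xs] by (auto simp: K_def)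
  have Tk: "T k = real N + 1 + (\<Sum>t\<in>{1..N} - K. e t)"
  proof -
    have "{..<N} = {..<k} \<union> {k..<N}" using k(1) by auto
    then have "(\<Sum>i<N. e (xs ! i)) = (\<Sum>i<k. e (xs ! i)) + (\<Sum>i\<in>{k..<N}. e (xs ! i))"
      by (simp add: sum.union_disjoint ivl_disj_int)
    moreover have "(\<Sum>t\<in>{1..N} - K. e t) = (\<Sum>t\<in>{1..N}. e t) - (\<Sum>t\<in>K. e t)"
      using sub by (intro sum_diff) auto
    ultimately show ?thesis using sumK[of e] sumAll[of e] unfolding T_def by linarith
  qed
  have TkN: "T k \<le> (real N + 1) powr \<alpha>"
  proof -
    have "T k * 1 \<le> T k * (real k + 1) powr (22/49)"
      using Tpos[of k] by (intro mult_left_mono ge_one_powr_ge_zero) auto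
    also have "\<dots> \<le> T N * (real N + 1) powr (22/49)" using k(2)[of N] by (simp add: c_def)
    also have "\<dots> = (real N + 1) powr (1 + 22/49)" unfolding powr_add by (simp add: T_def)
    finally show ?thesis by (simp add: \<alpha>_def)
  qed
  define w where "w j = e (xs ! j) / \<sigma>" for j
  have tail: "(\<Sum>j\<in>{i..<k}. profile k j) \<le> (\<Sum>j\<in>{i..<k}. w j)" if "i < k" for i
  proof -
    have "T k * ((real k + 1) / (real i + 1)) powr (22/49) \<le> T i"
    proof -
      have "T k * (real k + 1) powr (22/49) \<le> T i * (real i + 1) powr (22/49)"
        using k(2)[of i] k(1) that by (simp add: c_def)
      then show ?thesis by (simp add: powr_divide divide_le_eq)
    qed
    then have "(T k * ((real k + 1) / (real i + 1)) powr (22/49) - T k) / \<sigma> \<le> (T i - T k) / \<sigma>"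
      using \<sigma> by (intro divide_right_mono) auto
    also have "T i - T k = (\<Sum>j\<in>{i..<k}. e (xs ! j))"
    proof -
      have "{i..<N} = {i..<k} \<union> {k..<N}" using that k(1) by auto
      then show ?thesis by (simp add: T_def sum.union_disjoint ivl_disj_int)
    qed
    also have "\<dots> / \<sigma> = (\<Sum>j\<in>{i..<k}. w j)" by (simp add: w_def sum_divide_distrib)
    also have "(T k * ((real k + 1) / (real i + 1)) powr (22/49) - T k) / \<sigma>
        = (real k + 1) * (((real k + 1) / (real i + 1)) powr (22/49) - 1)"
    proof -
      define P where "P = ((real k + 1) / (real i + 1)) powr (22/49)"
      have "T k * P - T k = \<sigma> * ((real k + 1) * (P - 1))" unfolding \<sigma>(2)[symmetric] by algebra
      then show ?thesis using \<sigma>(1) by (simp add: P_def)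
    qed
    finally have "(real k + 1) * (((real k + 1) / (real i + 1)) powr (22/49) - 1) \<le> (\<Sum>j\<in>{i..<k}. w j)" .
    then show ?thesis using profile_tail[of i k] that by simp
  qed
  have wdesc: "w j \<le> w i" if "i \<le> j" "j < k" for i j
    unfolding w_def using desc[OF that(1)] that k(1) \<sigma> by (intro divide_right_mono) auto
  have wge: "22/49 \<le> w j" if "j < k" for j
  proof -
    obtain k' where k': "k = Suc k'" using \<open>j < k\<close> gr0_implies_Suc[of k] by auto
    have "22/49 \<le> profile k k'" using profile_ge k' by simp
    also have "\<dots> \<le> w k'" using tail[of k'] k' by simp
    also have "\<dots> \<le> w j" using wdesc[of j k'] that k' by simp
    finally show ?thesis .
  qed
  have "(\<Sum>j<k. \<Psi> (w j)) \<le> (\<Sum>j<k. \<Psi> (profile k j))"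
    using wge wdesc profile_ge tail by (intro \<Psi>_sum_le) auto
  then have "(\<Sum>t\<in>K. \<Psi> (e t / \<sigma>)) \<le> (\<Sum>j<card K. \<Psi> (profile (card K) j))"
    by (simp add: sumK card w_def)
  moreover have "22/49 \<le> e t / \<sigma>" if "t \<in> K" for t
  proof -
    obtain j where "j < k" "t = xs ! j"
      using \<open>t \<in> K\<close> len k(1) by (auto simp: K_def in_set_conv_nth)
    then show ?thesis using wge[of j] by (simp add: w_def)
  qed
  ultimately show ?thesis
    using that[of K \<sigma>] sub \<sigma> Tk TkN by (simp add: card)
qed

lemma enumerate_finite:
  assumes "K \<subseteq> {1..N}"
  obtains T :: "nat \<Rightarrow> nat" where "T 0 = 0" "T (Suc (card K)) = Suc N"
    "\<And>i. i \<le> card K \<Longrightarrow> T i < T (Suc i)" "bij_betw (\<lambda>i. T (Suc i)) {..<card K} K"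
proof -
  have fin: "finite K" using assms finite_subset by blast
  define L where "L = sorted_list_of_set K"
  have L: "set L = K" "distinct L" "length L = card K" "sorted_wrt (<) L"
    using fin by (auto simp: L_def)
  \<comment> \<open>The values 0 and \<open>Suc N\<close> are virtual flips that delimit the first
    and the last segment.\<close>
  define T where "T i = (if i = 0 then 0 else if i \<le> card K then L ! (i - 1) else Suc N)" for i
  have mem: "L ! i \<in> {1..N}" if "i < card K" for i
  proof -
    have "L ! i \<in> set L" using that L(3) by (intro nth_mem) simp
    then show ?thesis using assms unfolding L(1) by (rule subsetD[rotated])
  qed
  have "T i < T (Suc i)" if i: "i \<le> card K" for i
  proof -
    have prev: "T i \<in> {1..N}" if "i \<noteq> 0" using mem[of "i - 1"] that i by (simp add: T_def)
    show ?thesis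
    proof (cases "i = card K")
      case True
      have "T (Suc i) = Suc N" unfolding T_def True by simp
      moreover have "T i < Suc N"
      proof (cases "i = 0")
        case True
        then show ?thesis unfolding T_def by simp
      next
        case False
        then have "T i \<in> {1..N}" by (rule prev)
        then show ?thesis by simp
      qed
      ultimately show ?thesis by (simp only:)
    next
      case False
      then have Si: "T (Suc i) = L ! i" using i by (simp add: T_def)
      show ?thesis
      proof (cases "i = 0")
        case True
        then show ?thesis using mem[of 0] False i Si by (simp add: T_def)
      next
        case i0: False
        then have "T i = L ! (i - 1)" using i by (simp add: T_def)
        moreover have "L ! (i - 1) < L ! i"
          using sorted_wrt_nth_less[OF L(4), of "i - 1" i] L(3) i i0 False by simp
        ultimately show ?thesis using Si by simp
      qed
    qed
  qed
  moreover have "bij_betw (\<lambda>i. T (Suc i)) {..<card K} K"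
  proof -
    have "bij_betw ((!) L) {..<length L} (set L)" using L(2) by (rule bij_betw_nth) auto
    then have "bij_betw ((!) L) {..<card K} K" using L by simp
    then show ?thesis by (rule bij_betw_cong[THEN iffD1, rotated]) (auto simp: T_def)
  qed
  ultimately show ?thesis using that[of T] by (simp add: T_def)
qed

lemma sum_split_at:
  fixes f :: "nat \<Rightarrow> real"
  assumes T0: "T 0 = 0" and T: "\<And>i. i \<le> k \<Longrightarrow> T i < T (Suc i)" and m: "m \<le> k"
  shows "(\<Sum>t\<in>{0<..<T (Suc m)}. f t)
    = (\<Sum>i\<le>m. \<Sum>t\<in>{T i<..<T (Suc i)}. f t) + (\<Sum>i<m. f (T (Suc i)))"
  using m
proof (induction m)
  case 0
  then show ?case by (simp add: T0)
next
  case (Suc m)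
  have pos: "0 < T (Suc m)" using T[of m] Suc.prems by simp
  have lt: "T (Suc m) < T (Suc (Suc m))" using T[of "Suc m"] Suc.prems by simp
  define A where "A = {T (Suc m)<..<T (Suc (Suc m))}"
  have "{0<..<T (Suc (Suc m))} = {0<..<T (Suc m)} \<union> insert (T (Suc m)) A"
    using pos lt by (auto simp: A_def)
  moreover have "sum f ({0<..<T (Suc m)} \<union> insert (T (Suc m)) A)
      = sum f {0<..<T (Suc m)} + sum f (insert (T (Suc m)) A)"
    by (rule sum.union_disjoint) (auto simp: A_def)
  moreover have "sum f (insert (T (Suc m)) A) = f (T (Suc m)) + sum f A"
    by (rule sum.insert) (auto simp: A_def)
  ultimately have "sum f {0<..<T (Suc (Suc m))} = sum f {0<..<T (Suc m)} + (f (T (Suc m)) + sum f A)"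
    by (simp only:)
  moreover have "sum f {0<..<T (Suc m)}
      = (\<Sum>i\<le>m. \<Sum>t\<in>{T i<..<T (Suc i)}. f t) + (\<Sum>i<m. f (T (Suc i)))"
    using Suc by simp
  ultimately show ?case by (simp add: A_def)
qed

context flip_pattern
begin

text \<open>Shifting the factors \<open>B (Suc i)\<close> to \<open>B i\<close> costs the last one,
  which is 2 because \<open>\<rho> k = 1\<close>, while \<open>B 0 \<ge> 1\<close>.\<close>

lemma cost_le: "(R 0)\<^sup>2 * E 0 \<le> 2 * (\<Prod>i<k. step_cost (s i) (v i))"
proof -
  define B where "B i = 1 + max (1 / \<rho> i) (1/2)" for i
  define F' where "F' i = F i * ((v i + max (s i) (27/49)) / (v i + s i))" for i
  have B1: "1 \<le> B i" for i by (auto simp: B_def)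
  have F': "0 \<le> F' i" if "i \<le> k" for i
    unfolding F'_def using F_ge1[of i] short_ge1[OF that] by (intro mult_nonneg_nonneg) linarith+
  have "(R 0)\<^sup>2 * E 0 = (\<Prod>i<k. (\<rho> i)\<^sup>2 * b i)"
    by (simp add: R_def E_def prod_power_distrib prod.distrib atLeast0LessThan)
  also have "\<dots> = (\<Prod>i<k. (\<rho> i)\<^sup>2 * F' i) * (\<Prod>i<k. B (Suc i))"
    unfolding prod.distrib[symmetric] by (intro prod.cong refl) (simp add: b_def B_def F'_def)
  also have "\<dots> \<le> (\<Prod>i<k. (\<rho> i)\<^sup>2 * F' i) * (2 * (\<Prod>i<k. B i))"
  proof (rule mult_left_mono)
    have "(\<Prod>i<k. B (Suc i)) \<le> B 0 * (\<Prod>i<k. B (Suc i))"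
      using B1[of 0] prod_ge_1[of "{..<k}" "\<lambda>i. B (Suc i)"] B1 by simp
    also have "\<dots> = (\<Prod>i<Suc k. B i)" by (simp only: prod.lessThan_Suc_shift)
    also have "\<dots> = 2 * (\<Prod>i<k. B i)" by (simp add: B_def \<rho>_last)
    finally show "(\<Prod>i<k. B (Suc i)) \<le> 2 * (\<Prod>i<k. B i)" .
    show "0 \<le> (\<Prod>i<k. (\<rho> i)\<^sup>2 * F' i)" using F' by (intro prod_nonneg) auto
  qed
  also have "\<dots> = 2 * (\<Prod>i<k. (\<rho> i)\<^sup>2 * F' i * B i)" by (simp add: prod.distrib)
  also have "(\<Prod>i<k. (\<rho> i)\<^sup>2 * F' i * B i) = (\<Prod>i<k. step_cost (s i) (v i))"
    by (intro prod.cong refl) (simp add: step_cost_def F'_def B_def F_def \<rho>_def)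
  finally show ?thesis .
qed

end

lemma step_cost_nonneg: "0 < s \<Longrightarrow> 0 < v \<Longrightarrow> 0 \<le> step_cost s v"
  unfolding step_cost_def by (intro mult_nonneg_nonneg divide_nonneg_nonneg) auto

lemma step_cost_prod_le:
  fixes k :: nat
  assumes s: "\<And>i. i < k \<Longrightarrow> 0 < s i" and v: "\<And>i. i < k \<Longrightarrow> 22/49 \<le> v i"
  shows "(\<Prod>i<k. step_cost (s i) (v i)) \<le> exp (164/100 * (\<Sum>i<k. s i) + (\<Sum>i<k. \<Psi> (v i)))"
proof -
  have "(\<Prod>i<k. step_cost (s i) (v i)) \<le> (\<Prod>i<k. exp (164/100 * s i + \<Psi> (v i)))"
  proof (rule prod_mono)
    fix i assume "i \<in> {..<k}"
    then have sv: "0 < s i" "22/49 \<le> v i" using s v by auto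
    have "exp (164/100 * s i + log_cost (1 / v i)) / v i = exp (164/100 * s i + \<Psi> (v i))"
      using sv by (simp add: \<Psi>_def exp_add exp_diff add_diff_eq)
    then show "0 \<le> step_cost (s i) (v i) \<and> step_cost (s i) (v i) \<le> exp (164/100 * s i + \<Psi> (v i))"
      using step_cost_le[OF sv] step_cost_nonneg[of "s i" "v i"] sv by simp
  qed
  also have "\<dots> = exp (\<Sum>i<k. 164/100 * s i + \<Psi> (v i))" by (simp add: exp_sum)
  also have "\<dots> = exp (164/100 * (\<Sum>i<k. s i) + (\<Sum>i<k. \<Psi> (v i)))"
    by (simp only: sum.distrib sum_distrib_left)
  finally show ?thesis .
qed

lemma worst_rate_ge_powr:
  assumes \<eta>: "\<And>t. t \<in> {1..N} \<Longrightarrow> 0 < \<eta> t" and C0: "0 < C"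
    and C: "\<And>k. exp (164/100 * (real k + 1) + (\<Sum>j<k. \<Psi> (profile k j))) \<le> C"
  shows "ereal (1 / (8 * C * (real N + 1) powr \<alpha>)) \<le> worst_rate N \<eta>"
proof -
  \<comment> \<open>Steps of size at most 1 have excess 0; they cannot become flips, since a flip
    has excess at least \<open>22/49 * \<sigma>\<close>.\<close>
  define e where "e t = max (\<eta> t - 1) 0" for t
  have e0: "0 \<le> e t" for t by (simp add: e_def)
  obtain K \<sigma> where K: "K \<subseteq> {1..N}" and \<sigma>: "0 < \<sigma>"
    and \<sigma>k: "\<sigma> * (real (card K) + 1) = real N + 1 + (\<Sum>t\<in>{1..N} - K. e t)"
    and \<sigma>N: "\<sigma> * (real (card K) + 1) \<le> (real N + 1) powr \<alpha>"
    and eK: "\<And>t. t \<in> K \<Longrightarrow> 22/49 \<le> e t / \<sigma>"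
    and \<Psi>K: "(\<Sum>t\<in>K. \<Psi> (e t / \<sigma>)) \<le> (\<Sum>j<card K. \<Psi> (profile (card K) j))"
    by (rule select_flips[of N e, OF e0]) (rule that)
  define k where "k = card K"
  obtain T where T0: "T 0 = 0" and TN: "T (Suc k) = Suc N" and T: "\<And>i. i \<le> k \<Longrightarrow> T i < T (Suc i)"
    and bij: "bij_betw (\<lambda>i. T (Suc i)) {..<k} K"
    by (rule enumerate_finite[OF K, folded k_def]) (rule that)
  define seg where "seg i = 1 + (\<Sum>t\<in>{T i<..<T (Suc i)}. \<eta> t)" for i
  \<comment> \<open>The last segment is given twice the bound for the total length, so that its
    remaining steps use at most half of it.\<close>
  define s where "s i = (if i < k then seg i else 2 * (\<sigma> * (real k + 1)))" for i
  define v where "v i = (if i < k then \<eta> (T (Suc i)) - 1 else s k)" for i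
  have TK: "T (Suc i) \<in> K" if "i < k" for i
    using bij that by (auto simp: bij_betw_def)
  have ve: "v i = e (T (Suc i))" if "i < k" for i
  proof -
    have "0 < e (T (Suc i)) / \<sigma>" using eK[OF TK[OF that]] by linarith
    then have "0 < e (T (Suc i))" using \<sigma> by (simp add: zero_less_divide_iff)
    then show ?thesis using that by (auto simp: v_def e_def)
  qed
  have Tle: "T i \<le> Suc N" if "i \<le> Suc k" for i
    using that
  proof (induction i rule: inc_induct)
    case (step i)
    then show ?case using T[of i] by simp
  qed (simp add: TN)
  have seg_ge1: "1 \<le> seg i" if "i \<le> k" for i
  proof -
    have "0 \<le> (\<Sum>t\<in>{T i<..<T (Suc i)}. \<eta> t)"
    proof (rule sum_nonneg)
      fix t assume "t \<in> {T i<..<T (Suc i)}"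
      then have "t \<in> {1..N}" using Tle[of "Suc i"] that by auto
      then show "0 \<le> \<eta> t" using \<eta> by (simp add: less_imp_le)
    qed
    then show ?thesis by (simp add: seg_def)
  qed
  have total: "(\<Sum>i\<le>k. seg i) \<le> \<sigma> * (real k + 1)"
  proof -
    have "(\<Sum>t\<in>{1..N}. 1 + e t) = (\<Sum>t\<in>{0<..<T (Suc k)}. 1 + e t)"
      by (intro sum.cong) (auto simp: TN)
    also have "\<dots> = (\<Sum>i\<le>k. \<Sum>t\<in>{T i<..<T (Suc i)}. 1 + e t) + (\<Sum>i<k. 1 + e (T (Suc i)))"
      by (rule sum_split_at[OF T0 T order_refl])
    also have "(\<Sum>i<k. 1 + e (T (Suc i))) = (\<Sum>t\<in>K. 1 + e t)"
      by (rule sum.reindex_bij_betw[OF bij])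
    finally have "(\<Sum>i\<le>k. \<Sum>t\<in>{T i<..<T (Suc i)}. 1 + e t) = (\<Sum>t\<in>{1..N} - K. 1 + e t)"
      using K by (simp add: sum_diff)
    also have "\<dots> = real (card ({1..N} - K)) + (\<Sum>t\<in>{1..N} - K. e t)"
      by (simp add: sum.distrib)
    also have "real (card ({1..N} - K)) = real N - real k"
      using K card_mono[OF _ K] by (simp add: card_Diff_subset finite_subset k_def of_nat_diff)
    finally have eq: "(\<Sum>i\<le>k. \<Sum>t\<in>{T i<..<T (Suc i)}. 1 + e t)
        = real N - real k + (\<Sum>t\<in>{1..N} - K. e t)" .
    have "(\<Sum>i\<le>k. seg i) \<le> (\<Sum>i\<le>k. 1 + (\<Sum>t\<in>{T i<..<T (Suc i)}. 1 + e t))"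
      unfolding seg_def by (intro sum_mono add_left_mono) (auto simp: e_def)
    also have "\<dots> = real k + 1 + (\<Sum>i\<le>k. \<Sum>t\<in>{T i<..<T (Suc i)}. 1 + e t)"
      by (simp add: sum.distrib)
    also have "\<dots> = \<sigma> * (real k + 1)" unfolding eq using \<sigma>k by (simp add: k_def)
    finally show ?thesis .
  qed
  have seg_k: "(\<Sum>i<k. seg i) + seg k \<le> \<sigma> * (real k + 1)"
    using total by (simp add: lessThan_Suc_atMost[symmetric])
  have seg_last: "seg k \<le> \<sigma> * (real k + 1)"
  proof -
    have "0 \<le> (\<Sum>i<k. seg i)" using seg_ge1 by (intro sum_nonneg) (force intro: order_trans[of 0 1])
    then show ?thesis using seg_k by linarith
  qed
  have sk: "s k = 2 * (\<sigma> * (real k + 1))" by (simp add: s_def)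
  have sk0: "0 < s k" unfolding sk using \<sigma> by simp
  interpret flip_pattern k "\<lambda>i. s i / \<sigma>" "\<lambda>i. v i / \<sigma>"
  proof
    show "0 < s i / \<sigma>" if "i \<le> k" for i
      using that seg_ge1[of i] sk0 \<sigma> by (cases "i = k") (auto simp: s_def)
    show "22/49 \<le> v i / \<sigma>" if "i \<le> k" for i
    proof (cases "i = k")
      case True
      then have "v i / \<sigma> = 2 * (real k + 1)" using \<sigma> by (simp add: v_def sk)
      then show ?thesis by simp
    next
      case False
      then show ?thesis using that ve[of i] eK[OF TK[of i]] by simp
    qed
    show "v k / \<sigma> = s k / \<sigma>" by (simp add: v_def)
  qed
  obtain p z where p: "\<And>i. i \<le> k \<Longrightarrow> p i \<in> Rd (Suc k)" "\<And>i. i \<le> k \<Longrightarrow> p i \<noteq> 0"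
    and z0: "z 0 = 0"
    and z: "\<And>i. i < k \<Longrightarrow> z (Suc i) = z i - (v i / \<sigma>) *\<^sub>R p i - (s (Suc i) / \<sigma>) *\<^sub>R p (Suc i)"
    and c1: "\<And>i j. i \<le> k \<Longrightarrow> j \<le> k \<Longrightarrow> p j \<bullet> (z i - z j) \<le> 0"
    and c2: "\<And>i j. i \<le> k \<Longrightarrow> j \<le> k \<Longrightarrow> p j \<bullet> (z i + (s i / \<sigma>) *\<^sub>R p i - z j) \<le> s i / \<sigma> * (p i \<bullet> p i)"
    and p0: "(s 0 / \<sigma>)\<^sup>2 * (p 0 \<bullet> p 0) = (R 0)\<^sup>2 * E 0" and pk: "(s k / \<sigma>)\<^sup>2 * (p k \<bullet> p k) = 1"
    by (rule vectors_exist) (rule that)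
  have cost: "(R 0)\<^sup>2 * E 0 \<le> 2 * C"
  proof -
    have "(\<Sum>i<k. s i / \<sigma>) \<le> real k + 1"
    proof -
      have "(\<Sum>i<k. s i) = (\<Sum>i<k. seg i)" by (intro sum.cong) (auto simp: s_def)
      also have "\<dots> \<le> \<sigma> * (real k + 1)" using seg_k seg_ge1[of k] by simp
      finally have "(\<Sum>i<k. s i) / \<sigma> \<le> real k + 1" using \<sigma> by (simp add: divide_le_eq mult.commute)
      then show ?thesis by (simp add: sum_divide_distrib)
    qed
    moreover have "(\<Sum>i<k. \<Psi> (v i / \<sigma>)) \<le> (\<Sum>j<k. \<Psi> (profile k j))"
    proof -
      have "(\<Sum>i<k. \<Psi> (v i / \<sigma>)) = (\<Sum>i<k. \<Psi> (e (T (Suc i)) / \<sigma>))"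
        by (intro sum.cong) (auto simp: ve)
      also have "\<dots> = (\<Sum>t\<in>K. \<Psi> (e t / \<sigma>))" by (rule sum.reindex_bij_betw[OF bij])
      finally show ?thesis using \<Psi>K by (simp add: k_def)
    qed
    ultimately have "164/100 * (\<Sum>i<k. s i / \<sigma>) + (\<Sum>i<k. \<Psi> (v i / \<sigma>))
        \<le> 164/100 * (real k + 1) + (\<Sum>j<k. \<Psi> (profile k j))"
      by (intro add_mono mult_left_mono) auto
    then have "exp (164/100 * (\<Sum>i<k. s i / \<sigma>) + (\<Sum>i<k. \<Psi> (v i / \<sigma>))) \<le> C"
      using C[of k] by (meson exp_le_cancel_iff order_trans)
    moreover have "(\<Prod>i<k. step_cost (s i / \<sigma>) (v i / \<sigma>))
        \<le> exp (164/100 * (\<Sum>i<k. s i / \<sigma>) + (\<Sum>i<k. \<Psi> (v i / \<sigma>)))"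
      by (rule step_cost_prod_le) (rule s_pos v_ge, simp)+
    ultimately have "(\<Prod>i<k. step_cost (s i / \<sigma>) (v i / \<sigma>)) \<le> C" by linarith
    then show ?thesis using cost_le by linarith
  qed
  \<comment> \<open>One factor 2 comes from \<open>cost_le\<close>, one from the halved final
    height, and one from \<open>s k\<close>.\<close>
  define M where "M = 8 * C * (real N + 1) powr \<alpha>"
  have M0: "0 < M" using C0 by (simp add: M_def)
  have "ereal (1 / M) \<le> worst_rate N \<eta>"
  \<comment> \<open>The pattern measures lengths in the unit \<open>\<sigma>\<close>; returning to
    the original unit scales the positions \<open>z\<close> but not the gradients
    \<open>p\<close>.\<close>
  proof (rule worst_rate_ge[where d = "Suc k" and k = k and p = p and z = "\<lambda>i. \<sigma> *\<^sub>R z i" and s = s and v = v and T = T])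
    show "(2::real) * (1 + (\<Sum>t\<in>{T k<..<T (Suc k)}. \<eta> t)) \<le> s k"
      using seg_last unfolding seg_def sk by simp
    show "\<eta> (T (Suc i)) = 1 + v i" if "i < k" for i using that by (simp add: v_def)
    show "\<sigma> *\<^sub>R z (Suc i) = \<sigma> *\<^sub>R z i - v i *\<^sub>R p i - s (Suc i) *\<^sub>R p (Suc i)" if "i < k" for i
      using z[OF that] \<sigma> by (simp add: scaleR_diff_right)
    show "p j \<bullet> (\<sigma> *\<^sub>R z i - \<sigma> *\<^sub>R z j) \<le> 0" if "i \<le> k" "j \<le> k" for i j
      using c1[OF that] \<sigma> by (simp add: scaleR_diff_right[symmetric] mult_nonneg_nonpos)
    show "p j \<bullet> (\<sigma> *\<^sub>R z i + s i *\<^sub>R p i - \<sigma> *\<^sub>R z j) \<le> s i * (p i \<bullet> p i)" if "i \<le> k" "j \<le> k" for i j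
    proof -
      have "\<sigma> *\<^sub>R z i + s i *\<^sub>R p i - \<sigma> *\<^sub>R z j = \<sigma> *\<^sub>R (z i + (s i / \<sigma>) *\<^sub>R p i - z j)"
        using \<sigma> by (simp add: scaleR_diff_right scaleR_add_right)
      then have "p j \<bullet> (\<sigma> *\<^sub>R z i + s i *\<^sub>R p i - \<sigma> *\<^sub>R z j)
          = \<sigma> * (p j \<bullet> (z i + (s i / \<sigma>) *\<^sub>R p i - z j))" by simp
      also have "\<dots> \<le> \<sigma> * (s i / \<sigma> * (p i \<bullet> p i))"
        using c2[OF that] \<sigma> by (intro mult_left_mono) auto
      finally show ?thesis using \<sigma> by simp
    qed
    show "(s 0)\<^sup>2 * (p 0 \<bullet> p 0) \<le> M * (s k * (p k \<bullet> p k) / 2)"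
    proof -
      have "(s 0)\<^sup>2 * (p 0 \<bullet> p 0) = \<sigma>\<^sup>2 * ((R 0)\<^sup>2 * E 0)"
        unfolding p0[symmetric] using \<sigma> by (simp add: power_divide)
      also have "\<dots> \<le> \<sigma>\<^sup>2 * (2 * C)" using cost by (intro mult_left_mono) auto
      also have "\<dots> \<le> M * (s k * (p k \<bullet> p k) / 2)"
      proof -
        have "(s k)\<^sup>2 * (p k \<bullet> p k) = \<sigma>\<^sup>2" using pk \<sigma> by (simp add: power_divide)
        then have a: "s k * (s k * (p k \<bullet> p k)) = \<sigma>\<^sup>2" by (simp add: power2_eq_square)
        have "4 * C * s k \<le> M"
        proof -
          have "s k \<le> 2 * (real N + 1) powr \<alpha>" using \<sigma>N[folded k_def] sk by linarith
          then have "4 * C * s k \<le> 4 * C * (2 * (real N + 1) powr \<alpha>)"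
            using C0 by (intro mult_left_mono) auto
          then show ?thesis by (simp add: M_def)
        qed
        then have "4 * C * s k * (s k * (p k \<bullet> p k) / 2) \<le> M * (s k * (p k \<bullet> p k) / 2)"
          using sk0 by (intro mult_right_mono) auto
        moreover have "4 * C * s k * (s k * (p k \<bullet> p k) / 2) = \<sigma>\<^sup>2 * (2 * C)"
          unfolding a[symmetric] by simp
        ultimately show ?thesis by (simp only:)
      qed
      finally show ?thesis .
    qed
  qed (use p \<eta> T0 TN T M0 z0 in \<open>auto simp: s_def seg_def\<close>)
  then show ?thesis by (simp add: M_def)
qed

text \<open>Raising to the power 49 reduces the claim to
  \<open>2 ^ 71 \<le> (2732/1000) ^ 49\<close>.\<close>

lemma \<alpha>_le_alpha_star: "\<alpha> \<le> alpha_star"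
proof -
  have "(2 powr \<alpha>) ^ 49 = (2 powr \<alpha>) powr real 49" by (rule powr_realpow[symmetric]) simp
  also have "\<dots> = 2 powr (\<alpha> * real 49)" by (rule powr_powr)
  also have "\<alpha> * real 49 = real 71" by (simp add: \<alpha>_def)
  also have "2 powr real 71 = (2 :: real) ^ 71" by (rule powr_realpow) simp
  also have "\<dots> \<le> (2732/1000) ^ 49" by (simp add: power_divide)
  also have "\<dots> \<le> (1 + sqrt 3) ^ 49"
  proof (rule power_mono)
    have "1732/1000 \<le> sqrt 3" by (rule real_le_rsqrt) (simp add: power2_eq_square)
    then show "2732/1000 \<le> 1 + sqrt 3" by simp
  qed simp
  finally have "2 powr \<alpha> \<le> 1 + sqrt 3"
    by (subst (asm) power_mono_iff) auto
  then show ?thesis by (simp add: alpha_star_def le_log_iff add_pos_nonneg)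
qed

theorem theorem1p1:
  shows "\<exists>c>0. \<forall>\<^sub>F N in sequentially. \<forall>\<eta> :: nat \<Rightarrow> real. (\<forall>t\<in>{1..N}. 0 < \<eta> t) \<longrightarrow>
           ereal (real N powr (- alpha_star)) \<le> ereal c * worst_rate N \<eta>"
proof -
  obtain B where B: "\<And>k. 164/100 * (real k + 1) + (\<Sum>j<k. \<Psi> (profile k j)) \<le> B"
    using profile_sum_bounded by blast
  define c where "c = 8 * exp B * 2 powr \<alpha>"
  have "ereal (real N powr (- alpha_star)) \<le> ereal c * worst_rate N \<eta>"
    if N: "1 \<le> N" and \<eta>: "\<forall>t\<in>{1..N}. 0 < \<eta> t" for N :: nat and \<eta>
  proof -
    have "(real N + 1) powr \<alpha> \<le> (2 * real N) powr \<alpha>"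
      using N by (intro powr_mono2) (auto simp: \<alpha>_def)
    then have le: "(real N + 1) powr \<alpha> \<le> 2 powr \<alpha> * real N powr \<alpha>" by (simp add: powr_mult)
    have "real N powr (- alpha_star) \<le> real N powr (- \<alpha>)"
      using N \<alpha>_le_alpha_star by (intro powr_mono) auto
    also have "\<dots> = c / (8 * exp B * (2 powr \<alpha> * real N powr \<alpha>))"
      using N by (simp add: c_def powr_minus_divide)
    also have "\<dots> \<le> c / (8 * exp B * (real N + 1) powr \<alpha>)"
      using le N by (intro divide_left_mono mult_left_mono mult_pos_pos) (auto simp: c_def)
    finally have "ereal (real N powr (- alpha_star)) \<le> ereal c * ereal (1 / (8 * exp B * (real N + 1) powr \<alpha>))"
      by simp
    also have "\<dots> \<le> ereal c * worst_rate N \<eta>"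
      using worst_rate_ge_powr[of N \<eta> "exp B"] \<eta> B
      by (intro ereal_mult_left_mono) (auto simp: c_def)
    finally show ?thesis .
  qed
  then show ?thesis
    by (intro exI[of _ c] conjI eventually_sequentiallyI[of 1]) (auto simp: c_def)
qed

end
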